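(* Let $U\subseteq\mathbb{C}$ be open and connected, let $f$ be a nonconstant meromorphic function on $U$, and let $z_0\in U$ be a simple root of $f$ (so $f(z_0)=0\neq f'(z_0)$). Suppose $f''(z_0)\neq 0$. Let $\mathcal{S}_f$ be the secant map, $\mathcal{A}(f,z_0)$ the basin of attraction of $(z_0,z_0)$, $\phi=\frac12(1+\sqrt5)$, and $\pi_1:\mathbb{C}^2\to\mathbb{C}$ the first coordinate projection. Then: **(1)** For each $w_0\in\mathbb{C}$ with $e^{w_0}=\frac{f''(z_0)}{2f'(z_0)}$, there exist an open set $V\subseteq\mathbb{C}^2$ with $(z_0,z_0)\in V\subseteq\mathcal{A}(f,z_0)$ and $\mathcal{S}_f(V)\subseteq V$, and a holomorphic map $\mathcal{H}_{f,z_0,w_0}:V\to\mathbb{C}$ such that $$\mathcal{H}_{f,z_0,w_0}(z_0,z_0)=\exp\left(\frac{5+3\sqrt5}{10}\,w_0\right)$$ and $$\lim_{n\to\infty}\left|(\pi_1\circ\mathcal{S}_f^{\circ n})(x,y)-z_0\right|^{1/\phi^n}=|\mathcal{H}_{f,z_0,w_0}(x,y)|\cdot|x-z_0|^{\phi/\sqrt5}\cdot|y-z_0|^{1/\sqrt5}$$ for all $(x,y)\in V$. **(2)** For each fixed $w_0$ with $e^{w_0}=\frac{f''(z_0)}{2f'(z_0)}$, the corresponding $\mathcal{H}_{f,z_0,w_0}$ is unique in the sense that any two functions with the properties in (1) (for the same $w_0$, each on its own domain $V$) agree on the overlap of their domains. **(3)** There exists a unique continuous function $\widehat{\mathcal{H}}_{f,z_0}:\mathcal{A}(f,z_0)\to\mathbb{R}$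 such that $$\lim_{n\to\infty}\left|(\pi_1\circ\mathcal{S}_f^{\circ n})(x,y)-z_0\right|^{1/\phi^n}=\widehat{\mathcal{H}}_{f,z_0}(x,y)\cdot|x-z_0|^{\phi/\sqrt5}\cdot|y-z_0|^{1/\sqrt5}$$ for all $(x,y)\in\mathcal{A}(f,z_0)$, and $\widehat{\mathcal{H}}_{f,z_0}(x,y)=|\mathcal{H}_{f,z_0,w_0}(x,y)|$ for every function $\mathcal{H}_{f,z_0,w_0}:V\to\mathbb{C}$ as in (1) (even letting $w_0$ vary) and every $(x,y)\in V$. **(4)** The function $\widehat{\mathcal{H}}_{f,z_0}$ from (3) satisfies $$\widehat{\mathcal{H}}_{f,z_0}(x,y)=\left[\widehat{\mathcal{H}}_{f,z_0}(\mathcal{S}_f(x,y))\right]^{1/\phi}\cdot|\mathcal{G}_{f,z_0}(x,y)|^{1/\sqrt5}$$ for all $(x,y)\in\mathcal{A}(f,z_0)$, and $\widehat{\mathcal{H}}_{f,z_0}$ is real analytic wherever it is nonzero, i.e. on the set $\widehat{\mathcal{H}}_{f,z_0}^{-1}(\mathbb{R}\setminus\{0\})$.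
   Context: Secant map: $\mathcal{S}_f:U\times U\dashrightarrow\mathbb{P}^1\times\mathbb{P}^1$ is given by $$\mathcal{S}_f(x,y)=\left(\frac{f(x)y-f(y)x}{f(x)-f(y)},\,x\right),$$ and is extended holomorphically to all points of $U\times U$ where such an extension exists; remaining points are indeterminate and excluded from its domain. In particular $\mathcal{S}_f(x,x)=\left(x-\frac{f(x)}{f'(x)},x\right)$ if $x$ is not a pole and $f'(x)\neq0$; $\mathcal{S}_f(x,y)=(y,x)$ if $x$ is a pole of $f$ and $y$ is not; and $\mathcal{S}_f(x,y)=(x,x)$ if $y$ is a pole and $x$ is not. An iterate $\mathcal{S}_f^{\circ n}(x,y)$ is defined when the preceding iterates lie in $U\times U$ and in the domain of $\mathcal{S}_f$. For a simple root $z_0$ of $f$, $(z_0,z_0)$ is a superattracting fixed point of $\mathcal{S}_f$, and its basin of attraction is $$\mathcal{A}(f,z_0)=\left\{(x,y)\in U\times U:\ \lim_{n\to\infty}\mathcal{S}_f^{\circ n}(x,y)=(z_0,z_0)\right\}$$ (all iterates being defined and in $U\times U$). It is nonempty, open, and fully invariant under $\mathcal{S}_f$. $\mathcal{G}_{f,z_0}:\mathcal{A}(f,z_0)\to\mathbb{C}$ is the unique holomorphic function such that $\mathcal{S}_f(x,y)=\left(z_0+\mathcal{G}_{f,z_0}(x,y)(x-z_0)(y-z_0),\,x\right)$ for all $(x,y)\in\mathcal{A}(f,z_0)$; it satisfies $\mathcal{G}_{f,z_0}(z_0,z_0)=\frac{f''(z_0)}{2f'(z_0)}$.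
   Formalization: In (2), two such functions are shown to agree only on the connected component of the overlap of their domains that contains (z_0,z_0); agreement on the whole overlap fails, e.g. for f(z)=z+z^2, z_0=0, when V is disconnected. *)

theory Defs
  imports "HOL-Complex_Analysis.Complex_Analysis"
begin

section \<open>Holomorphic maps of two complex variables\<close>

text \<open>Complex Frechet differentiability at every point; the sets in question are always open.\<close>

definition holomorphic2_on :: "(complex \<times> complex \<Rightarrow> complex) \<Rightarrow> (complex \<times> complex) set \<Rightarrow> bool"
    (infixl \<open>(holomorphic2'_on)\<close> 50) where
  "h holomorphic2_on W \<longleftrightarrow>
     (\<forall>p\<in>W. \<exists>a b. (h has_derivative (\<lambda>(u, v). a * u + b * v)) (at p within W))"

datatype riemann_sphere = Fin complex | Infty

text \<open>The two standard charts of the Riemann sphere. \<open>aff\<close> is a chart on the complement of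
  \<open>Infty\<close> and \<open>coaff\<close> one on the complement of \<open>Fin 0\<close>; their values
  at the respective excluded point are junk.\<close>

fun aff :: "riemann_sphere \<Rightarrow> complex" where
  "aff (Fin z) = z"
| "aff Infty = 0"

fun coaff :: "riemann_sphere \<Rightarrow> complex" where
  "coaff (Fin z) = inverse z"
| "coaff Infty = 0"

text \<open>Holomorphy of a map into the Riemann sphere: every point has a neighbourhood that is mapped
  into one of the chart domains, holomorphically when read in that chart.\<close>

definition sphere_holomorphic2_on ::
    "(complex \<times> complex \<Rightarrow> riemann_sphere) \<Rightarrow> (complex \<times> complex) set \<Rightarrow> bool"
    (infixl \<open>(sphere'_holomorphic2'_on)\<close> 50) where
  "h sphere_holomorphic2_on W \<longleftrightarrow>
     (\<forall>p\<in>W. \<exists>N. open N \<and> p \<in> N \<and> N \<subseteq> W \<and>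
        (Infty \<notin> h ` N \<and> (aff \<circ> h) holomorphic2_on N \<or>
         Fin 0 \<notin> h ` N \<and> (coaff \<circ> h) holomorphic2_on N))"

definition of_C2 :: "complex \<times> complex \<Rightarrow> riemann_sphere \<times> riemann_sphere" where
  "of_C2 = map_prod Fin Fin"

definition to_C2 :: "riemann_sphere \<times> riemann_sphere \<Rightarrow> complex \<times> complex" where
  "to_C2 = map_prod aff aff"

section \<open>The secant map\<close>

text \<open>In all definitions below, \<open>f\<close> is meant to be nicely meromorphic on \<open>U\<close>. Such an \<open>f\<close>
  takes the dummy value \<open>0\<close> at its poles, so poles have to be excluded explicitly.\<close>

definition secant_regular :: "complex set \<Rightarrow> (complex \<Rightarrow> complex) \<Rightarrow> (complex \<times> complex) set" where
  "secant_regular U f =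
     {(x, y). x \<in> U \<and> y \<in> U \<and> \<not> is_pole f x \<and> \<not> is_pole f y \<and> f x \<noteq> f y}"

definition secant_extension ::
    "complex set \<Rightarrow> (complex \<Rightarrow> complex) \<Rightarrow> (complex \<times> complex) set \<Rightarrow>
     (complex \<times> complex \<Rightarrow> riemann_sphere \<times> riemann_sphere) \<Rightarrow> bool" where
  "secant_extension U f W h \<longleftrightarrow>
     open W \<and> W \<subseteq> U \<times> U \<and>
     (fst \<circ> h) sphere_holomorphic2_on W \<and> (snd \<circ> h) sphere_holomorphic2_on W \<and>
     (\<forall>(x, y) \<in> W \<inter> secant_regular U f. h (x, y) = of_C2 ((f x * y - f y * x) / (f x - f y), x))"

definition secant_dom :: "complex set \<Rightarrow> (complex \<Rightarrow> complex) \<Rightarrow> (complex \<times> complex) set" where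
  "secant_dom U f = {p. \<exists>W h. p \<in> W \<and> secant_extension U f W h}"

text \<open>Only meaningful on \<open>secant_dom U f\<close>. The value is uniquely determined there if \<open>f\<close> is
  nonconstant and \<open>U\<close> is connected, because \<open>secant_regular U f\<close> is then dense in \<open>U \<times> U\<close>.\<close>

definition secant_map ::
    "complex set \<Rightarrow> (complex \<Rightarrow> complex) \<Rightarrow> complex \<times> complex \<Rightarrow> riemann_sphere \<times> riemann_sphere" where
  "secant_map U f p = (THE q. \<exists>W h. p \<in> W \<and> secant_extension U f W h \<and> h p = q)"

text \<open>\<open>None\<close> means that the iterate is not defined.\<close>

primrec secant_iter ::
    "complex set \<Rightarrow> (complex \<Rightarrow> complex) \<Rightarrow> nat \<Rightarrow> complex \<times> complex \<Rightarrow>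
     (riemann_sphere \<times> riemann_sphere) option" where
  "secant_iter U f 0 p = Some (of_C2 p)"
| "secant_iter U f (Suc n) p =
     (case secant_iter U f n p of
        None \<Rightarrow> None
      | Some q \<Rightarrow> if q \<in> of_C2 ` secant_dom U f then Some (secant_map U f (to_C2 q)) else None)"

text \<open>The iterates as points of \<open>\<complex>\<^sup>2\<close>, for orbits that stay in \<open>U \<times> U\<close> (junk otherwise).\<close>

definition secant_orbit ::
    "complex set \<Rightarrow> (complex \<Rightarrow> complex) \<Rightarrow> nat \<Rightarrow> complex \<times> complex \<Rightarrow> complex \<times> complex" where
  "secant_orbit U f n p = to_C2 (the (secant_iter U f n p))"

definition secant_basin ::
    "complex set \<Rightarrow> (complex \<Rightarrow> complex) \<Rightarrow> complex \<Rightarrow> (complex \<times> complex) set" where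
  "secant_basin U f z0 =
     {p \<in> U \<times> U. (\<forall>n. secant_iter U f n p \<in> Some ` of_C2 ` (U \<times> U)) \<and>
                 (\<lambda>n. secant_orbit U f n p) \<longlonglongrightarrow> (z0, z0)}"

text \<open>A function with domain \<open>secant_basin U f z0\<close> is represented by its extensional
  extension, so that it is unique as a HOL function.\<close>

definition secant_cofactor ::
    "complex set \<Rightarrow> (complex \<Rightarrow> complex) \<Rightarrow> complex \<Rightarrow> complex \<times> complex \<Rightarrow> complex" where
  "secant_cofactor U f z0 =
     (THE G. G \<in> extensional (secant_basin U f z0) \<and>
             G holomorphic2_on secant_basin U f z0 \<and>
             (\<forall>(x, y) \<in> secant_basin U f z0.
                secant_map U f (x, y) = of_C2 (z0 + G (x, y) * (x - z0) * (y - z0), x)))"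

section \<open>The asymptotic functions\<close>

definition phi :: real where
  "phi = (1 + sqrt 5) / 2"

text \<open>At \<open>(x, y)\<close>, the limit of \<open>|\<pi>\<^sub>1(S\<^sup>n(x, y)) - z0|\<close> to the power \<open>1/\<phi>\<^sup>n\<close> is
  \<open>c\<close> times the monomial in \<open>|x - z0|\<close> and \<open>|y - z0|\<close>. Recall that \<open>0 powr a = 0\<close>.\<close>

definition secant_rate_at ::
    "complex set \<Rightarrow> (complex \<Rightarrow> complex) \<Rightarrow> complex \<Rightarrow> complex \<times> complex \<Rightarrow> real \<Rightarrow> bool" where
  "secant_rate_at U f z0 p c \<longleftrightarrow>
     (\<lambda>n. norm (fst (secant_orbit U f n p) - z0) powr (1 / phi ^ n))
       \<longlonglongrightarrow> c * norm (fst p - z0) powr (phi / sqrt 5) * norm (snd p - z0) powr (1 / sqrt 5)"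

text \<open>\<open>V\<close> is only required to be open, so \<open>H\<close> is determined only on the connected component of
  \<open>(z0, z0)\<close>, and two such functions have to agree only on the component of \<open>(z0, z0)\<close> in the
  overlap of their domains. Example: for \<open>f z = z + z\<^sup>2\<close> and \<open>z0 = 0\<close> put \<open>u = x / (1 + x)\<close>,
  \<open>v = y / (1 + y)\<close>; the secant map becomes \<open>(u, v) \<mapsto> (u v, u)\<close>. For small \<open>\<epsilon>\<close> the union of
  \<open>{|u| < \<epsilon>, |v| < \<epsilon>}\<close> and \<open>{|u| < \<epsilon>, |v - 3\<epsilon>| < \<epsilon>/2}\<close> is an admissible \<open>V\<close>, and the sign
  of \<open>H\<close> on the second piece can be changed freely.\<close>

definition secant_local_H ::
    "complex set \<Rightarrow> (complex \<Rightarrow> complex) \<Rightarrow> complex \<Rightarrow> complex \<Rightarrow> (complex \<times> complex) set \<Rightarrow>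
     (complex \<times> complex \<Rightarrow> complex) \<Rightarrow> bool" where
  "secant_local_H U f z0 w0 V H \<longleftrightarrow>
     open V \<and> (z0, z0) \<in> V \<and> V \<subseteq> secant_basin U f z0 \<and> secant_map U f ` V \<subseteq> of_C2 ` V \<and>
     H holomorphic2_on V \<and>
     H (z0, z0) = exp (of_real ((5 + 3 * sqrt 5) / 10) * w0) \<and>
     (\<forall>p\<in>V. secant_rate_at U f z0 p (norm (H p)))"

definition secant_global_H ::
    "complex set \<Rightarrow> (complex \<Rightarrow> complex) \<Rightarrow> complex \<Rightarrow> (complex \<times> complex \<Rightarrow> real) \<Rightarrow> bool" where
  "secant_global_H U f z0 Hh \<longleftrightarrow>
     continuous_on (secant_basin U f z0) Hh \<and>
     (\<forall>p\<in>secant_basin U f z0. secant_rate_at U f z0 p (Hh p))"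

text \<open>Local expansion in a convergent power series in the coordinates; the exponents range over
  the multi-indices \<open>\<alpha> : Basis \<rightarrow> \<nat>\<close>.\<close>

definition real_analytic_at :: "('a::euclidean_space \<Rightarrow> real) \<Rightarrow> 'a \<Rightarrow> bool" where
  "real_analytic_at g p \<longleftrightarrow>
     (\<exists>r>0. \<exists>c :: ('a \<Rightarrow> nat) \<Rightarrow> real. \<forall>h. norm h < r \<longrightarrow>
        ((\<lambda>\<alpha>. c \<alpha> * (\<Prod>b\<in>Basis. (h \<bullet> b) ^ \<alpha> b)) has_sum g (p + h)) (Basis \<rightarrow>\<^sub>E UNIV))"

end

theory Submission
  imports Defs
begin

text \<open>In the basin the secant map is \<open>(x, y) \<mapsto> (z0 + G(x, y) (x - z0) (y - z0), x)\<close>. Along an orbit the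
  logarithms of \<open>|x - z0|\<close> therefore satisfy a Fibonacci recursion with the inhomogeneous term
  \<open>ln |G|\<close>, and dividing by \<open>phi\<^sup>n\<close> gives the limit, with the global function
  \<open>exp (\<Sum>k. ln |G(T\<^sup>k p)| / (sqrt 5 phi\<^sup>k))\<close>, read as \<open>0\<close> if some \<open>G(T\<^sup>k p)\<close> vanishes.
  On an invariant polydisc around \<open>(z0, z0)\<close> a branch of the logarithm of \<open>G\<close>, chosen by \<open>w0\<close>, makes the
  series holomorphic, and its exponential is \<open>H\<close>. Since every orbit enters the polydisc, the
  functional equation carries continuity, and analyticity where the function is not zero, back to the
  whole basin. Uniqueness of \<open>H\<close>: the quotient of two candidates has modulus 1 near \<open>(z0, z0)\<close>,
  hence is constant there, and the identity theorem applies.\<close>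

section \<open>Holomorphic functions of two variables\<close>

text \<open>The value of \<open>H\<close> at the centre is forced: the centre is fixed by
  \<open>T\<close>, so there the series is w0 times the geometric sum of 1 / (sqrt 5 phi^k), which
  is (5 + 3 sqrt 5) / 10. Zeros of \<open>G\<close> shape the argument. Near them ln |G| is
  unbounded, so the series alone yields neither continuity nor analyticity on the whole basin.
  Continuity can be pulled back through the functional equation because powers with positive
  exponent are continuous at 0. For analyticity, what is pulled back is the existence of a
  holomorphic \<open>h\<close> with rate = exp (Re h); only at the end is exp (Re h) = |exp (h /
  2)|^2 = E * cnj E expanded into a real power series, as a product of two convergent series. The
  secant map and its cofactor are definite descriptions. Both are evaluated by continuity from the
  points where a formula determines them: regular points for the map, points off the lines x = z0
  and y = z0 for the cofactor. Existence of the cofactor needs division by x - z0 and by y - z0 in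
  two variables, which is the main use of Osgood's lemma below.\<close>

definition cdiff2 :: "(complex \<times> complex \<Rightarrow> complex) \<Rightarrow> complex \<times> complex \<Rightarrow> bool" where
  "cdiff2 h p \<longleftrightarrow> (\<exists>a b. (h has_derivative (\<lambda>(u, v). a * u + b * v)) (at p))"

text \<open>On open sets the derivative within \<open>W\<close> is the full derivative, so
  holomorphy is a pointwise condition that does not mention \<open>W\<close>, and the calculus rules
  below chain freely.\<close>

lemma holomorphic2_on_cdiff2: "open W \<Longrightarrow> h holomorphic2_on W \<longleftrightarrow> (\<forall>p\<in>W. cdiff2 h p)"
  unfolding holomorphic2_on_def cdiff2_def by (metis at_within_open)

lemma cdiff2_isCont: "cdiff2 h p \<Longrightarrow> isCont h p"
  unfolding cdiff2_def using has_derivative_continuous by blast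

lemma holomorphic2_on_imp_continuous_on: "h holomorphic2_on W \<Longrightarrow> continuous_on W h"
  unfolding holomorphic2_on_def continuous_on_eq_continuous_within
  using has_derivative_continuous by blast

lemma holomorphic2_on_subset: "h holomorphic2_on W \<Longrightarrow> V \<subseteq> W \<Longrightarrow> h holomorphic2_on V"
  unfolding holomorphic2_on_def using has_derivative_subset by blast

lemma cdiff2_transform:
  assumes "cdiff2 h p" "open N" "p \<in> N" "\<And>q. q \<in> N \<Longrightarrow> h q = g q"
  shows "cdiff2 g p"
  using assms unfolding cdiff2_def by (meson has_derivative_transform_within_open)

lemma cdiff2_const: "cdiff2 (\<lambda>p. c) p"
  unfolding cdiff2_def by (rule exI[of _ 0], rule exI[of _ 0]) (auto simp: case_prod_unfold)

lemma cdiff2_fst: "cdiff2 (\<lambda>p. fst p) p"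
  unfolding cdiff2_def
  by (rule exI[of _ 1], rule exI[of _ 0]) (auto simp: case_prod_unfold intro!: derivative_eq_intros)

lemma cdiff2_snd: "cdiff2 (\<lambda>p. snd p) p"
  unfolding cdiff2_def
  by (rule exI[of _ 0], rule exI[of _ 1]) (auto simp: case_prod_unfold intro!: derivative_eq_intros)

lemma cdiff2_add: "cdiff2 g p \<Longrightarrow> cdiff2 h p \<Longrightarrow> cdiff2 (\<lambda>p. g p + h p) p"
  unfolding cdiff2_def
proof (elim exE)
  fix a b c d
  assume "(g has_derivative (\<lambda>(u, v). a * u + b * v)) (at p)"
    "(h has_derivative (\<lambda>(u, v). c * u + d * v)) (at p)"
  from has_derivative_add[OF this]
  show "\<exists>a b. ((\<lambda>p. g p + h p) has_derivative (\<lambda>(u, v). a * u + b * v)) (at p)"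
    by (intro exI[of _ "a + c"] exI[of _ "b + d"]) (simp add: case_prod_unfold algebra_simps)
qed

lemma cdiff2_mult: "cdiff2 g p \<Longrightarrow> cdiff2 h p \<Longrightarrow> cdiff2 (\<lambda>p. g p * h p) p"
  unfolding cdiff2_def
proof (elim exE)
  fix a b c d
  assume "(g has_derivative (\<lambda>(u, v). a * u + b * v)) (at p)"
    "(h has_derivative (\<lambda>(u, v). c * u + d * v)) (at p)"
  from has_derivative_mult[OF this]
  show "\<exists>a b. ((\<lambda>p. g p * h p) has_derivative (\<lambda>(u, v). a * u + b * v)) (at p)"
    by (intro exI[of _ "a * h p + g p * c"] exI[of _ "b * h p + g p * d"])
      (simp add: case_prod_unfold algebra_simps)
qed

lemma cdiff2_compose1:
  assumes "cdiff2 h p" "k field_differentiable (at (h p))"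
  shows "cdiff2 (\<lambda>p. k (h p)) p"
proof -
  obtain a b where ab: "(h has_derivative (\<lambda>(u, v). a * u + b * v)) (at p)"
    using assms(1) unfolding cdiff2_def by blast
  obtain c where c: "(k has_derivative ((*) c)) (at (h p))"
    using assms(2) unfolding field_differentiable_def has_field_derivative_def by blast
  show ?thesis
    using has_derivative_compose[OF ab c] unfolding cdiff2_def
    by (intro exI[of _ "c * a"] exI[of _ "c * b"]) (simp add: case_prod_unfold algebra_simps)
qed

lemma cdiff2_compose2:
  assumes "cdiff2 h (g1 p, g2 p)" "cdiff2 g1 p" "cdiff2 g2 p"
  shows "cdiff2 (\<lambda>p. h (g1 p, g2 p)) p"
proof -
  obtain a b where ab: "(h has_derivative (\<lambda>(u, v). a * u + b * v)) (at (g1 p, g2 p))"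
    using assms(1) unfolding cdiff2_def by blast
  obtain c d where c: "(g1 has_derivative (\<lambda>(u, v). c * u + d * v)) (at p)"
    using assms(2) unfolding cdiff2_def by blast
  obtain c' d' where c': "(g2 has_derivative (\<lambda>(u, v). c' * u + d' * v)) (at p)"
    using assms(3) unfolding cdiff2_def by blast
  show ?thesis
    using has_derivative_compose[OF has_derivative_Pair[OF c c'] ab] unfolding cdiff2_def
    by (intro exI[of _ "a * c + b * c'"] exI[of _ "a * d + b * d'"])
      (simp add: case_prod_unfold algebra_simps)
qed

lemma cdiff2_minus: "cdiff2 h p \<Longrightarrow> cdiff2 (\<lambda>p. - h p) p"
  using cdiff2_mult[OF cdiff2_const[of "-1"], of h p] by simp

lemma cdiff2_diff: "cdiff2 g p \<Longrightarrow> cdiff2 h p \<Longrightarrow> cdiff2 (\<lambda>p. g p - h p) p"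
  using cdiff2_add[OF _ cdiff2_minus, of g p h] by simp

lemma cdiff2_inverse: "cdiff2 h p \<Longrightarrow> h p \<noteq> 0 \<Longrightarrow> cdiff2 (\<lambda>p. inverse (h p)) p"
  by (rule cdiff2_compose1[where k = inverse])
    (auto intro!: field_differentiable_inverse field_differentiable_ident)

lemma cdiff2_divide: "cdiff2 g p \<Longrightarrow> cdiff2 h p \<Longrightarrow> h p \<noteq> 0 \<Longrightarrow> cdiff2 (\<lambda>p. g p / h p) p"
  using cdiff2_mult[OF _ cdiff2_inverse, of g p h] by (simp add: field_simps)

lemmas cdiff2_intros = cdiff2_const cdiff2_fst cdiff2_snd cdiff2_add cdiff2_mult cdiff2_minus
  cdiff2_diff cdiff2_inverse cdiff2_divide

lemma cdiff2_slice1: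
  assumes "cdiff2 h (x, y)"
  shows "(\<lambda>x. h (x, y)) field_differentiable (at x)"
proof -
  obtain a b where ab: "(h has_derivative (\<lambda>(u, v). a * u + b * v)) (at (x, y))"
    using assms(1) unfolding cdiff2_def by blast
  have "((\<lambda>x. (x, y)) has_derivative (\<lambda>u. (u, 0))) (at x)"
    by (auto intro!: derivative_eq_intros)
  from has_derivative_compose[OF this ab] have "((\<lambda>x. h (x, y)) has_field_derivative a) (at x)"
    unfolding has_field_derivative_def by simp
  then show ?thesis unfolding field_differentiable_def by blast
qed

lemma cdiff2_slice2:
  assumes "cdiff2 h (x, y)"
  shows "(\<lambda>y. h (x, y)) field_differentiable (at y)"
proof -
  obtain a b where ab: "(h has_derivative (\<lambda>(u, v). a * u + b * v)) (at (x, y))"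
    using assms(1) unfolding cdiff2_def by blast
  have "((\<lambda>y. (x, y)) has_derivative (\<lambda>u. (0, u))) (at y)"
    by (auto intro!: derivative_eq_intros)
  from has_derivative_compose[OF this ab] have "((\<lambda>y. h (x, y)) has_field_derivative b) (at y)"
    unfolding has_field_derivative_def by simp
  then show ?thesis unfolding field_differentiable_def by blast
qed

section \<open>Polydiscs and Osgood's lemma\<close>

lemma open_contains_polydisc:
  fixes a b :: complex
  assumes "open W" "(a, b) \<in> W"
  obtains r where "r > 0" "cball a r \<times> cball b r \<subseteq> W"
proof -
  obtain A B where AB: "open A" "open B" "a \<in> A" "b \<in> B" "A \<times> B \<subseteq> W"
    using open_prod_elim[OF assms] by (metis mem_Sigma_iff)
  obtain r1 r2 where "r1 > 0" "cball a r1 \<subseteq> A" "r2 > 0" "cball b r2 \<subseteq> B"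
    using AB by (meson open_contains_cball_eq)
  then have "cball a (min r1 r2) \<times> cball b (min r1 r2) \<subseteq> W"
    using AB(5) by (force simp: subset_iff)
  then show thesis using that[of "min r1 r2"] \<open>r1 > 0\<close> \<open>r2 > 0\<close> by auto
qed

text \<open>Uniform continuity on a compact polydisc, phrased so that one coordinate can be moved
  while the other is held fixed. It compares two parallel slices of \<open>F\<close>
  uniformly.\<close>

lemma uniform_slices:
  fixes F :: "complex \<times> complex \<Rightarrow> complex"
  assumes "continuous_on (cball a r \<times> cball b r) F" "e > 0" "r > 0"
  obtains d where "d > 0" "d \<le> r"
    "\<And>x x' y y'. x \<in> cball a r \<Longrightarrow> x' \<in> cball a r \<Longrightarrow> y \<in> cball b r \<Longrightarrow> y' \<in> cball b r \<Longrightarrow>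
       dist x x' < d \<Longrightarrow> dist y y' < d \<Longrightarrow> dist (F (x, y)) (F (x', y')) < e"
proof -
  have "uniformly_continuous_on (cball a r \<times> cball b r) F"
    using assms(1) by (intro compact_uniformly_continuous compact_Times compact_cball)
  then obtain d where d: "d > 0"
    "\<And>p q. p \<in> cball a r \<times> cball b r \<Longrightarrow> q \<in> cball a r \<times> cball b r \<Longrightarrow> dist q p < d \<Longrightarrow>
       dist (F q) (F p) < e"
    unfolding uniformly_continuous_on_def using \<open>e > 0\<close> by metis
  show thesis
  proof (rule that[of "min (d/2) r"])
    fix x x' y y'
    assume *: "x \<in> cball a r" "x' \<in> cball a r" "y \<in> cball b r" "y' \<in> cball b r"
       "dist x x' < min (d/2) r" "dist y y' < min (d/2) r"
    have "dist (x, y) (x', y') \<le> dist x x' + dist y y'"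
      by (simp add: dist_prod_def sqrt_sum_squares_le_sum)
    then have "dist (x, y) (x', y') < d" using * by simp
    then show "dist (F (x, y)) (F (x', y')) < e" using d(2) * by auto
  qed (use d(1) assms(3) in auto)
qed

text \<open>Osgood's lemma: continuity of the partial derivative in \<open>y\<close> follows from Cauchy's inequality
  for the difference of two slices.\<close>

lemma osgood:
  fixes F :: "complex \<times> complex \<Rightarrow> complex"
  assumes W: "open W" and cont: "continuous_on W F"
    and d1: "\<And>x y. (x, y) \<in> W \<Longrightarrow> (\<lambda>x. F (x, y)) field_differentiable (at x)"
    and d2: "\<And>x y. (x, y) \<in> W \<Longrightarrow> (\<lambda>y. F (x, y)) field_differentiable (at y)"
  shows "F holomorphic2_on W"
  unfolding holomorphic2_on_cdiff2[OF W]
proof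
  fix p assume "p \<in> W"
  obtain a b where p: "p = (a, b)" by force
  obtain r where r: "r > 0" "cball a r \<times> cball b r \<subseteq> W"
    using open_contains_polydisc[OF W] \<open>p \<in> W\<close> p by metis
  define D where "D x y = deriv (\<lambda>y. F (x, y)) y" for x y
  have hol: "(\<lambda>y. F (x, y)) holomorphic_on cball b r" if "x \<in> cball a r" for x
    using d2 r(2) that unfolding holomorphic_on_def
    by (meson field_differentiable_at_within mem_Sigma_iff subset_iff)
  have Dd: "((\<lambda>y. F (x, y)) has_field_derivative D x y) (at y)" if "(x, y) \<in> W" for x y
    using d2[OF that] unfolding D_def by (simp add: field_differentiable_derivI)
  have contW: "continuous_on (cball a r \<times> cball b r) F"
    using cont r(2) continuous_on_subset by blast
  have Dcont: "continuous (at (a, b)) (\<lambda>(x, y). D x y)"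
    unfolding continuous_at_eps_delta
  proof (intro allI impI)
    fix e :: real assume e: "e > 0"
    \<comment> \<open>Cauchy's inequality on a disc of radius r / 2 turns e * r / 8 into e / 4;
      another e / 2 is spent on the continuity of \<open>D a\<close> in its second argument.\<close>
    have e': "e * r / 8 > 0" using e r(1) by simp
    from uniform_slices[OF contW e' r(1)]
    obtain d where d: "d > 0" "d \<le> r"
      "\<And>x x' y y'. x \<in> cball a r \<Longrightarrow> x' \<in> cball a r \<Longrightarrow> y \<in> cball b r \<Longrightarrow> y' \<in> cball b r \<Longrightarrow>
         dist x x' < d \<Longrightarrow> dist y y' < d \<Longrightarrow> dist (F (x, y)) (F (x', y')) < e * r / 8" by blast
    have "(\<lambda>y. D a y) holomorphic_on ball b r"
      unfolding D_def using hol[of a] r(1)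
      by (intro holomorphic_deriv holomorphic_on_subset[OF hol[of a]]) auto
    then have "isCont (\<lambda>y. D a y) b"
      using r(1) holomorphic_on_imp_continuous_on continuous_on_eq_continuous_at
      by (metis centre_in_ball open_ball)
    then obtain d' where d': "d' > 0" "\<And>y. dist y b < d' \<Longrightarrow> dist (D a y) (D a b) < e / 2"
      using e unfolding continuous_at_eps_delta by (meson half_gt_zero)
    have "dist (D x y) (D a b) < e" if xy: "dist (x, y) (a, b) < min d (min d' (r / 2))" for x y
    proof -
      have x: "dist x a < min d (min d' (r / 2))" and y: "dist y b < min d (min d' (r / 2))"
        using xy dist_fst_le[of "(x, y)" "(a, b)"] dist_snd_le[of "(x, y)" "(a, b)"] by auto
      have sub: "cball y (r/2) \<subseteq> cball b r"
        using y by (intro cball_subset_cball_iff[THEN iffD2]) (auto simp: dist_commute)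
      have xa: "x \<in> cball a r" "a \<in> cball a r" using x r(1) by (auto simp: dist_commute)
      have bd: "norm (F (x, w) - F (a, w)) \<le> e * r / 8" if "w \<in> cball y (r/2)" for w
        using d(3)[of x a w w] xa sub that x d(1) by (auto simp: dist_norm subset_iff)
      have h: "(\<lambda>w. F (x, w) - F (a, w)) holomorphic_on cball y (r/2)"
        by (intro holomorphic_on_diff holomorphic_on_subset[OF hol sub] xa)
      have "norm ((deriv ^^ 1) (\<lambda>w. F (x, w) - F (a, w)) y) \<le> fact 1 * (e * r / 8) / (r / 2) ^ 1"
      proof (rule Cauchy_inequality)
        show "(\<lambda>w. F (x, w) - F (a, w)) holomorphic_on ball y (r/2)"
          using holomorphic_on_subset[OF h] by auto
        show "continuous_on (cball y (r/2)) (\<lambda>w. F (x, w) - F (a, w))"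
          using h holomorphic_on_imp_continuous_on by blast
      qed (use r(1) bd in \<open>auto simp: dist_norm\<close>)
      moreover have yb: "y \<in> cball b r" using sub r(1) by (meson centre_in_cball half_gt_zero less_imp_le subsetD)
      moreover have "deriv (\<lambda>w. F (x, w) - F (a, w)) y = D x y - D a y"
        unfolding D_def
        by (intro deriv_diff d2) (use xa yb r(2) in auto)
      ultimately have "norm (D x y - D a y) \<le> e / 4" using r(1) by simp
      moreover have "dist (D a y) (D a b) < e / 2" using d'(2) y by simp
      ultimately show ?thesis using dist_triangle[of "D x y" "D a b" "D a y"] e
        by (simp add: dist_norm)
    qed
    then show "\<exists>d>0. \<forall>x'. dist x' (a, b) < d \<longrightarrow>
        dist (case x' of (x, y) \<Rightarrow> D x y) (case (a, b) of (x, y) \<Rightarrow> D x y) < e"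
      using d(1) d'(1) r(1) by (intro exI[of _ "min d (min d' (r/2))"]) auto
  qed
  obtain c where c: "((\<lambda>x. F (x, b)) has_field_derivative c) (at a)"
    using d1[of a b] \<open>p \<in> W\<close> p unfolding field_differentiable_def by auto
  \<comment> \<open>\<open>has_derivative_partialsI\<close> asks for the x-derivative at the point
    only and for a y-derivative that is continuous there. This is why only \<open>D\<close> had to
    be studied.\<close>
  have "((\<lambda>(x, y). F (x, y)) has_derivative
          (\<lambda>(tx, ty). c * tx + blinfun_apply (blinfun_mult_right (D a b)) ty))
          (at (a, b) within ball a r \<times> ball b r)"
  proof (rule has_derivative_partialsI[where fy = "\<lambda>x y. blinfun_mult_right (D x y)"])
    show "((\<lambda>x. F (x, b)) has_derivative (*) c) (at a within ball a r)"
      using c unfolding has_field_derivative_def by (rule has_derivative_at_withinI)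
    fix x y assume "x \<in> ball a r" "y \<in> ball b r"
    then have "(x, y) \<in> W" using r(2) by auto
    then show "((\<lambda>y. F (x, y)) has_derivative blinfun_apply (blinfun_mult_right (D x y)))
        (at y within ball b r)"
      using Dd[of x y] unfolding has_field_derivative_def
      by (simp add: has_derivative_at_withinI)
  next
    have "continuous (at (a, b) within ball a r \<times> ball b r) (\<lambda>(x, y). D x y)"
      using Dcont continuous_at_imp_continuous_at_within by blast
    then show "continuous (at (a, b) within ball a r \<times> ball b r) (\<lambda>(x, y). blinfun_mult_right (D x y))"
      by (simp add: case_prod_unfold bounded_linear.continuous[OF bounded_linear_blinfun_mult_right])
  qed (use r(1) in auto)
  moreover have "(a, b) \<in> ball a r \<times> ball b r" "open (ball a r \<times> ball b r)"
    using r(1) by (auto intro: open_Times)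
  ultimately show "cdiff2 F p"
    unfolding cdiff2_def p
    by (intro exI[of _ c] exI[of _ "D a b"]) (simp add: at_within_open[OF \<open>(a, b) \<in> _\<close>])
qed

section \<open>Slices, and division by x - a along a line of zeros\<close>

lemma holomorphic2_slice1:
  assumes "F holomorphic2_on W" "open W" "\<And>x. x \<in> S \<Longrightarrow> (x, y) \<in> W"
  shows "(\<lambda>x. F (x, y)) holomorphic_on S"
  using assms cdiff2_slice1 unfolding holomorphic2_on_cdiff2[OF assms(2)] holomorphic_on_def
  by (meson field_differentiable_at_within)

lemma holomorphic2_slice2:
  assumes "F holomorphic2_on W" "open W" "\<And>y. y \<in> S \<Longrightarrow> (x, y) \<in> W"
  shows "(\<lambda>y. F (x, y)) holomorphic_on S"
  using assms cdiff2_slice2 unfolding holomorphic2_on_cdiff2[OF assms(2)] holomorphic_on_def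
  by (meson field_differentiable_at_within)

text \<open>On the circle the factor z - a has constant modulus \<open>R\<close>, so the bound for
  the product gives one for \<open>h\<close> there. The maximum principle carries it inside, also to
  the centre, where the product says nothing about \<open>h\<close>.\<close>

lemma cball_quotient_bound:
  fixes h :: "complex \<Rightarrow> complex"
  assumes "h holomorphic_on S" "open S" "cball a R \<subseteq> S" "R > 0"
    and "\<And>z. dist a z = R \<Longrightarrow> norm ((z - a) * h z) \<le> B" and "x \<in> cball a R"
  shows "norm (h x) \<le> B / R"
proof (rule maximum_modulus_frontier[of h "cball a R"])
  show "h holomorphic_on interior (cball a R)" "continuous_on (closure (cball a R)) h"
    using assms(1,3) holomorphic_on_subset holomorphic_on_imp_continuous_on interior_subset
    by (metis closure_closed closed_cball, metis closure_closed closed_cball)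
  fix z assume "z \<in> frontier (cball a R)"
  then have "dist a z = R" using \<open>R > 0\<close> by (simp add: frontier_cball)
  with assms(5)[of z] have "R * norm (h z) \<le> B"
    by (simp add: norm_mult dist_norm norm_minus_commute)
  then show "norm (h z) \<le> B / R" using \<open>R > 0\<close> by (simp add: pos_le_divide_eq mult.commute)
qed (use assms in auto)

text \<open>The value on the line x = a is the limit of the quotient when \<open>F\<close> vanishes
  on that line; it is written as a derivative to fit \<open>pole_lemma_open\<close>.\<close>

definition divquot :: "(complex \<times> complex \<Rightarrow> complex) \<Rightarrow> complex \<Rightarrow> complex \<times> complex \<Rightarrow> complex" where
  "divquot F a = (\<lambda>(x, y). if x = a then deriv (\<lambda>x. F (x, y)) a else F (x, y) / (x - a))"

lemma open_slice1: "open W \<Longrightarrow> open {x. (x, y) \<in> W}"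
  using open_vimage[of W "\<lambda>x. (x, y)"] by (simp add: vimage_def continuous_intros)

lemma open_slice2: "open W \<Longrightarrow> open {y. (x, y) \<in> W}"
  using open_vimage[of W "\<lambda>y. (x, y)"] by (simp add: vimage_def continuous_intros)

lemma divquot_slice:
  assumes W: "open W" and F: "F holomorphic2_on W" and z: "\<And>y. (a, y) \<in> W \<Longrightarrow> F (a, y) = 0"
  shows "(\<lambda>x. divquot F a (x, y)) holomorphic_on {x. (x, y) \<in> W}"
proof -
  have "(\<lambda>x. F (x, y)) holomorphic_on {x. (x, y) \<in> W}"
    by (rule holomorphic2_slice1[OF F W]) simp
  show ?thesis
  proof (cases "(a, y) \<in> W")
    case True
    have "(\<lambda>x. divquot F a (x, y)) =
        (\<lambda>x. if x = a then deriv (\<lambda>x. F (x, y)) a else (F (x, y) - F (a, y)) / (x - a))"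
      using z[OF True] by (auto simp: divquot_def)
    then show ?thesis
      using pole_lemma_open[OF \<open>(\<lambda>x. F (x, y)) holomorphic_on _\<close> open_slice1[OF W], of a] by simp
  next
    case False
    have "(\<lambda>x. F (x, y) / (x - a)) holomorphic_on {x. (x, y) \<in> W}"
      using False by (intro holomorphic_intros \<open>(\<lambda>x. F (x, y)) holomorphic_on _\<close>) auto
    then show ?thesis
      by (rule holomorphic_transform) (use False in \<open>auto simp: divquot_def\<close>)
  qed
qed

text \<open>At points with \<open>x = a\<close>: by the maximum principle in \<open>x\<close>, the difference of two slices
  \<open>divquot F a (\<cdot>, y) - divquot F a (\<cdot>, b)\<close> is controlled by \<open>F\<close> on a circle around \<open>a\<close>.\<close>

lemma divquot_continuous:
  assumes W: "open W" and F: "F holomorphic2_on W" and z: "\<And>y. (a, y) \<in> W \<Longrightarrow> F (a, y) = 0"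
  shows "continuous_on W (divquot F a)"
proof (intro continuous_at_imp_continuous_on ballI)
  fix p assume "p \<in> W"
  obtain c b where p: "p = (c, b)" by force
  show "isCont (divquot F a) p"
  proof (cases "c = a")
    case False
    have "cdiff2 F p" using F \<open>p \<in> W\<close> W by (simp add: holomorphic2_on_cdiff2)
    then have "cdiff2 (\<lambda>q. F q / (fst q - a)) p"
      by (intro cdiff2_intros) (use False p in auto)
    then have "cdiff2 (divquot F a) p"
    proof (rule cdiff2_transform)
      show "open {q. fst q \<noteq> a}" by (intro open_Collect_neq continuous_intros)
    qed (use False p in \<open>auto simp: divquot_def\<close>)
    then show ?thesis by (rule cdiff2_isCont)
  next
    case True
    obtain r where r: "r > 0" "cball a r \<times> cball b r \<subseteq> W"
      using open_contains_polydisc[OF W] \<open>p \<in> W\<close> p True by metis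
    have cW: "continuous_on (cball a r \<times> cball b r) F"
      using holomorphic2_on_imp_continuous_on[OF F] r(2) continuous_on_subset by blast
    have sl: "(\<lambda>x. divquot F a (x, y)) holomorphic_on {x. (x, y) \<in> W}" for y
      using divquot_slice[OF assms] .
    have "isCont (\<lambda>x. divquot F a (x, b)) a"
      using sl[of b] open_slice1[OF W, of b] \<open>p \<in> W\<close> p True holomorphic_on_imp_continuous_on
        continuous_on_eq_continuous_at by blast
    show ?thesis
      unfolding continuous_at_eps_delta p True
    proof (intro allI impI)
      fix e :: real assume e: "e > 0"
      obtain d1 where d1: "d1 > 0" "\<And>x. dist x a < d1 \<Longrightarrow> dist (divquot F a (x, b)) (divquot F a (a, b)) < e / 2"
        using e \<open>isCont (\<lambda>x. divquot F a (x, b)) a\<close> unfolding continuous_at_eps_delta by (meson half_gt_zero)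
      have er: "e / 4 * r > 0" using e r by simp
      obtain d2 where d2: "d2 > 0" "d2 \<le> r"
        "\<And>x x' y y'. x \<in> cball a r \<Longrightarrow> x' \<in> cball a r \<Longrightarrow> y \<in> cball b r \<Longrightarrow> y' \<in> cball b r \<Longrightarrow>
         dist x x' < d2 \<Longrightarrow> dist y y' < d2 \<Longrightarrow> dist (F (x, y)) (F (x', y')) < e / 4 * r"
        using uniform_slices[OF cW er r(1)] by blast
      have "dist (divquot F a (x, y)) (divquot F a (a, b)) < e" if xy: "dist (x, y) (a, b) < min d1 d2" for x y
      proof -
        have x: "dist x a < min d1 d2" and y: "dist y b < min d1 d2"
          using xy dist_fst_le[of "(x, y)" "(a, b)"] dist_snd_le[of "(x, y)" "(a, b)"] by auto
        have yb: "y \<in> cball b r" using y d2 by (auto simp: dist_commute)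
        have "norm (divquot F a (x, y) - divquot F a (x, b)) \<le> (e / 4 * r) / r"
        proof (rule cball_quotient_bound[where h = "\<lambda>x. divquot F a (x, y) - divquot F a (x, b)" and x = x])
          show "(\<lambda>x. divquot F a (x, y) - divquot F a (x, b)) holomorphic_on
            {x. (x, y) \<in> W} \<inter> {x. (x, b) \<in> W}"
            by (intro holomorphic_on_diff holomorphic_on_subset[OF sl]) auto
          show "open ({x. (x, y) \<in> W} \<inter> {x. (x, b) \<in> W})"
            using W by (intro open_Int open_slice1)
          show "cball a r \<subseteq> {x. (x, y) \<in> W} \<inter> {x. (x, b) \<in> W}"
            using r yb by auto
          fix w assume w: "dist a w = r"
          have "(w - a) * (divquot F a (w, y) - divquot F a (w, b)) = F (w, y) - F (w, b)"
            using w r(1) by (auto simp: divquot_def right_diff_distrib)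
          moreover have "dist (F (w, y)) (F (w, b)) < e / 4 * r"
            using w yb y r(1) d2(1) by (intro d2(3)) auto
          ultimately show "norm ((w - a) * (divquot F a (w, y) - divquot F a (w, b))) \<le> e / 4 * r"
            by (simp add: dist_norm)
        qed (use r(1) x d2 in \<open>auto simp: dist_commute\<close>)
        then have "dist (divquot F a (x, y)) (divquot F a (x, b)) \<le> e / 4"
          using r(1) by (simp add: dist_norm)
        moreover have "dist (divquot F a (x, b)) (divquot F a (a, b)) < e / 2" using d1 x by simp
        ultimately show ?thesis
          using dist_triangle[of "divquot F a (x, y)" "divquot F a (a, b)" "divquot F a (x, b)"] e by linarith
      qed
      then show "\<exists>d>0. \<forall>x'. dist x' (a, b) < d \<longrightarrow> dist (divquot F a x') (divquot F a (a, b)) < e"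
        using d1(1) d2(1) by (intro exI[of _ "min d1 d2"]) auto
    qed
  qed
qed

text \<open>Continuity being known, Osgood's lemma leaves separate holomorphy. In x this is the
  removable singularity of each slice, and in y it is clear for x \<noteq> a. The slice on the line
  x = a is a uniform limit of the slices at points \<open>h n\<close> \<noteq> a that tend to
  a.\<close>

lemma divquot_holomorphic2:
  assumes W: "open W" and F: "F holomorphic2_on W" and z: "\<And>y. (a, y) \<in> W \<Longrightarrow> F (a, y) = 0"
  shows "divquot F a holomorphic2_on W"
proof (rule osgood[OF W divquot_continuous[OF assms]])
  have sl: "(\<lambda>x. divquot F a (x, y)) holomorphic_on {x. (x, y) \<in> W}" for y
    using divquot_slice[OF assms] .
  show "(\<lambda>x. divquot F a (x, y)) field_differentiable at x" if "(x, y) \<in> W" for x y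
    using sl[of y] that open_slice1[OF W, of y] by (simp add: holomorphic_on_imp_differentiable_at)
  have off: "(\<lambda>y. divquot F a (x, y)) holomorphic_on {y. (x, y) \<in> W}" if "x \<noteq> a" for x
  proof -
    have "(\<lambda>y. F (x, y) / (x - a)) holomorphic_on {y. (x, y) \<in> W}"
      using that by (intro holomorphic_intros holomorphic2_slice2[OF F W]) auto
    then show ?thesis using that by (simp add: divquot_def)
  qed
  show "(\<lambda>y. divquot F a (x, y)) field_differentiable at y" if xy: "(x, y) \<in> W" for x y
  proof (cases "x = a")
    case False
    then show ?thesis
      using off[of x] xy open_slice2[OF W, of x] by (simp add: holomorphic_on_imp_differentiable_at)
  next
    case True
    obtain r where r: "r > 0" "cball a r \<times> cball y r \<subseteq> W"
      using open_contains_polydisc[OF W] xy True by metis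
    have cQ: "continuous_on (cball a r \<times> cball y r) (divquot F a)"
      using divquot_continuous[OF assms] r(2) continuous_on_subset by blast
    define h where "h n = a + of_real (r / real (n + 2))" for n :: nat
    have hr: "h n \<in> cball a r" "h n \<noteq> a" for n
    proof -
      have "norm (h n - a) = r / real (n + 2)"
        using r(1) unfolding h_def by (simp only: add_diff_cancel_left' norm_of_real) simp
      moreover have "r / real (n + 2) \<le> r / 1" using r(1) by (intro divide_left_mono) auto
      moreover have "r / real (n + 2) > 0" using r(1) by simp
      ultimately show "h n \<in> cball a r" "h n \<noteq> a"
        by (auto simp: dist_norm norm_minus_commute)
    qed
    have "h \<longlonglongrightarrow> a + of_real 0"
      unfolding h_def by (intro tendsto_intros) real_asymp
    then have hlim: "h \<longlonglongrightarrow> a" by simp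
    have "uniform_limit (cball y r) (\<lambda>n w. divquot F a (h n, w)) (\<lambda>w. divquot F a (a, w)) sequentially"
    proof (rule uniform_limitI)
      fix e :: real assume "e > 0"
      from uniform_slices[OF cQ this r(1)] obtain d where d: "d > 0"
        "\<And>x x' w w'. x \<in> cball a r \<Longrightarrow> x' \<in> cball a r \<Longrightarrow> w \<in> cball y r \<Longrightarrow> w' \<in> cball y r \<Longrightarrow>
         dist x x' < d \<Longrightarrow> dist w w' < d \<Longrightarrow> dist (divquot F a (x, w)) (divquot F a (x', w')) < e" by metis
      have "\<forall>\<^sub>F n in sequentially. dist (h n) a < d"
        using tendstoD[OF hlim d(1)] .
      then show "\<forall>\<^sub>F n in sequentially. \<forall>w\<in>cball y r. dist (divquot F a (h n, w)) (divquot F a (a, w)) < e"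
        by eventually_elim (use d hr r(1) in auto)
    qed
    moreover have "continuous_on (cball y r) (\<lambda>w. divquot F a (h n, w))"
      "(\<lambda>w. divquot F a (h n, w)) holomorphic_on ball y r" for n
    proof -
      have "(\<lambda>w. divquot F a (h n, w)) holomorphic_on cball y r"
        by (rule holomorphic_on_subset[OF off[OF hr(2)]]) (use r(2) hr(1) in auto)
      then show "continuous_on (cball y r) (\<lambda>w. divquot F a (h n, w))"
        "(\<lambda>w. divquot F a (h n, w)) holomorphic_on ball y r"
        using holomorphic_on_imp_continuous_on holomorphic_on_subset ball_subset_cball by blast+
    qed
    ultimately have "(\<lambda>w. divquot F a (a, w)) holomorphic_on ball y r"
      using holomorphic_uniform_limit[of y r "\<lambda>n w. divquot F a (h n, w)" sequentially] by auto
    then show ?thesis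
      using True r(1) holomorphic_on_imp_differentiable_at[of _ "ball y r" y] by simp
  qed
qed

text \<open>Weierstrass' theorem in each variable separately; the limit is continuous, so Osgood's
  lemma joins the two.\<close>

lemma uniform_limit_holomorphic2:
  assumes W: "open W" and f: "\<And>n. f n holomorphic2_on W"
    and lim: "uniform_limit W f g sequentially"
  shows "g holomorphic2_on W"
proof (rule osgood[OF W])
  show "continuous_on W g"
    by (rule uniform_limit_theorem[OF _ lim])
      (auto intro!: always_eventually holomorphic2_on_imp_continuous_on f)
  fix x y assume xy: "(x, y) \<in> W"
  have u1: "uniform_limit {x. (x, y) \<in> W} (\<lambda>n x. f n (x, y)) (\<lambda>x. g (x, y)) sequentially"
    using lim unfolding uniform_limit_iff by (fast elim: eventually_mono)
  have "(\<lambda>x. g (x, y)) holomorphic_on {x. (x, y) \<in> W}"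
  proof (rule holomorphic_uniform_sequence[OF open_slice1[OF W]])
    show "(\<lambda>x. f n (x, y)) holomorphic_on {x. (x, y) \<in> W}" for n
      by (rule holomorphic2_slice1[OF f W]) simp
    show "\<exists>d>0. cball x d \<subseteq> {x. (x, y) \<in> W} \<and>
      uniform_limit (cball x d) (\<lambda>n x. f n (x, y)) (\<lambda>x. g (x, y)) sequentially"
      if "x \<in> {x. (x, y) \<in> W}" for x
      using that open_slice1[OF W, of y] u1 uniform_limit_on_subset
      by (meson open_contains_cball)
  qed
  then show "(\<lambda>x. g (x, y)) field_differentiable at x"
    using xy open_slice1[OF W, of y] by (simp add: holomorphic_on_imp_differentiable_at)
  have u2: "uniform_limit {y. (x, y) \<in> W} (\<lambda>n y. f n (x, y)) (\<lambda>y. g (x, y)) sequentially"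
    using lim unfolding uniform_limit_iff by (fast elim: eventually_mono)
  have "(\<lambda>y. g (x, y)) holomorphic_on {y. (x, y) \<in> W}"
  proof (rule holomorphic_uniform_sequence[OF open_slice2[OF W]])
    show "(\<lambda>y. f n (x, y)) holomorphic_on {y. (x, y) \<in> W}" for n
      by (rule holomorphic2_slice2[OF f W]) simp
    show "\<exists>d>0. cball y d \<subseteq> {y. (x, y) \<in> W} \<and>
      uniform_limit (cball y d) (\<lambda>n y. f n (x, y)) (\<lambda>y. g (x, y)) sequentially"
      if "y \<in> {y. (x, y) \<in> W}" for y
      using that open_slice2[OF W, of x] u2 uniform_limit_on_subset
      by (meson open_contains_cball)
  qed
  then show "(\<lambda>y. g (x, y)) field_differentiable at y"
    using xy open_slice2[OF W, of x] by (simp add: holomorphic_on_imp_differentiable_at)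
qed

text \<open>The diagonal is not a coordinate line, but with s = x - y it becomes s = 0, where
  \<open>divquot\<close> applies. The factorisation holds for all x and y, even outside
  \<open>S\<close>: off the diagonal it is the definition of the quotient, and on it both sides are
  0.\<close>

lemma divided_difference_holomorphic2:
  assumes S: "open S" and f: "f holomorphic_on S"
  obtains q where "q holomorphic2_on S \<times> S" "\<And>x y. f x - f y = (x - y) * q (x, y)"
    "\<And>x. x \<in> S \<Longrightarrow> q (x, x) = deriv f x"
proof -
  define F where "F = (\<lambda>(s, y). f (y + s) - f y)"
  define W where "W = {p. snd p + fst p \<in> S \<and> snd p \<in> S}"
  have W: "open W"
  proof -
    have "W = (\<lambda>p. snd p + fst p) -` S \<inter> snd -` S" unfolding W_def by auto
    then show ?thesis using S by (auto intro!: open_Int open_vimage continuous_intros)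
  qed
  have fd: "f field_differentiable at x" if "x \<in> S" for x
    using f S that by (rule holomorphic_on_imp_differentiable_at)
  have "F holomorphic2_on W"
    unfolding holomorphic2_on_cdiff2[OF W] F_def case_prod_unfold
    by (intro ballI cdiff2_diff cdiff2_compose1[where k = f] cdiff2_intros fd) (auto simp: W_def)
  then have Q: "divquot F 0 holomorphic2_on W"
    by (rule divquot_holomorphic2[OF W]) (simp add: F_def)
  define q where "q = (\<lambda>p. divquot F 0 (fst p - snd p, snd p))"
  have "q holomorphic2_on S \<times> S"
    unfolding holomorphic2_on_cdiff2[OF open_Times[OF S S]] q_def
  proof
    fix p assume "p \<in> S \<times> S"
    then have "cdiff2 (divquot F 0) (fst p - snd p, snd p)"
      using Q unfolding holomorphic2_on_cdiff2[OF W] by (auto simp: W_def)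
    then show "cdiff2 (\<lambda>p. divquot F 0 (fst p - snd p, snd p)) p"
      by (intro cdiff2_compose2[where h = "divquot F 0"] cdiff2_intros)
  qed
  moreover have "f x - f y = (x - y) * q (x, y)" for x y
    by (auto simp: q_def divquot_def F_def)
  moreover have "q (x, x) = deriv f x" if "x \<in> S" for x
  proof -
    have "((\<lambda>s. f (x + s) - f x) has_field_derivative deriv f x) (at 0)"
      using DERIV_shift[of f "deriv f x" 0 x] fd[OF that]
      by (auto intro!: derivative_eq_intros simp: field_differentiable_derivI add.commute)
    then show ?thesis by (simp add: q_def divquot_def F_def DERIV_imp_deriv)
  qed
  ultimately show thesis by (rule that)
qed

lemma holomorphic2_swap:
  assumes "F holomorphic2_on W" "open W"
  shows "(\<lambda>p. F (snd p, fst p)) holomorphic2_on {p. (snd p, fst p) \<in> W}"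
    "open {p. (snd p, fst p) \<in> W}"
proof -
  show o: "open {p. (snd p, fst p) \<in> W}"
    using open_vimage[OF assms(2), of "\<lambda>p. (snd p, fst p)"]
    by (simp add: vimage_def continuous_intros)
  show "(\<lambda>p. F (snd p, fst p)) holomorphic2_on {p. (snd p, fst p) \<in> W}"
    using assms(1) unfolding holomorphic2_on_cdiff2[OF o] holomorphic2_on_cdiff2[OF assms(2)]
    by (auto intro!: cdiff2_compose2[where h = F] cdiff2_intros)
qed

text \<open>\<open>F\<close> vanishes on both axes; the second division is legitimate on the line \<open>x = a\<close> too, by
  continuity of the first quotient.\<close>

lemma holomorphic2_divide_axes:
  assumes W: "open W" and F: "F holomorphic2_on W" and za: "\<And>y. (a, y) \<in> W \<Longrightarrow> F (a, y) = 0"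
    and zb: "\<And>x. (x, b) \<in> W \<Longrightarrow> F (x, b) = 0"
  obtains G where "G holomorphic2_on W" "\<And>x y. (x, y) \<in> W \<Longrightarrow> F (x, y) = G (x, y) * (x - a) * (y - b)"
proof -
  define Q where "Q = divquot F a"
  have Q: "Q holomorphic2_on W" unfolding Q_def by (rule divquot_holomorphic2[OF W F za])
  have Qz: "Q (x, b) = 0" if xb: "(x, b) \<in> W" for x
  proof (cases "x = a")
    case False then show ?thesis using zb[OF xb] by (simp add: Q_def divquot_def)
  next
    case True
    \<comment> \<open>\<open>F\<close> vanishes on the whole row y = b near a, so the derivative
      that defines \<open>Q (a, b)\<close> is 0.\<close>
    have "((\<lambda>x. F (x, b)) has_field_derivative 0) (at a)"
      using open_slice1[OF W, of b] xb True zb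
      by (intro has_field_derivative_transform_within_open[OF DERIV_const[of 0], of "{x. (x, b) \<in> W}"]) auto
    then show ?thesis using True by (simp add: Q_def divquot_def DERIV_imp_deriv)
  qed
  define Q' where "Q' = divquot (\<lambda>p. Q (snd p, fst p)) b"
  have Q': "Q' holomorphic2_on {p. (snd p, fst p) \<in> W}"
    unfolding Q'_def
    by (rule divquot_holomorphic2[OF holomorphic2_swap(2)[OF Q W] holomorphic2_swap(1)[OF Q W]]) (auto simp: Qz)
  define G where "G = (\<lambda>p. Q' (snd p, fst p))"
  show thesis
  proof (rule that)
    show "G holomorphic2_on W"
      using holomorphic2_swap(1)[OF Q' holomorphic2_swap(2)[OF Q W]] unfolding G_def by simp
    show "F (x, y) = G (x, y) * (x - a) * (y - b)" if xy: "(x, y) \<in> W" for x y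
    proof -
      have "F (x, y) = (x - a) * Q (x, y)" using za xy by (auto simp: Q_def divquot_def)
      moreover have "Q (x, y) = (y - b) * Q' (y, x)" using Qz xy by (auto simp: Q'_def divquot_def)
      ultimately show ?thesis by (simp add: G_def)
    qed
  qed
qed

section \<open>Identity theorem and functions of modulus 1\<close>

lemma holomorphic2_zero_polydisc:
  assumes H: "H holomorphic2_on ball a r \<times> ball b r"
    and N: "open N" "N \<noteq> {}" "N \<subseteq> ball a r \<times> ball b r" and z: "\<And>p. p \<in> N \<Longrightarrow> H p = 0"
    and p: "p \<in> ball a r \<times> ball b r"
  shows "H p = 0"
proof -
  obtain c d where "(c, d) \<in> N" using N(2) by auto
  then obtain s where s: "s > 0" "cball c s \<times> cball d s \<subseteq> N"
    using open_contains_polydisc[OF N(1)] by metis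
  have oW: "open (ball a r \<times> ball b r)" by (intro open_Times open_ball)
  have sub: "ball c s \<subseteq> ball a r" "ball d s \<subseteq> ball b r"
    using s N(3) by (auto simp: subset_iff) (metis dist_self less_imp_le)+
  \<comment> \<open>The one-variable identity theorem is used twice: along x for each y of the small
    disc, which gives zeros on a full strip, and then along y for each x.\<close>
  have 1: "H (x, y) = 0" if "y \<in> ball d s" "x \<in> ball a r" for x y
  proof (rule analytic_continuation_open[of "ball c s" "ball a r" "\<lambda>x. H (x, y)" "\<lambda>_. 0"])
    show "(\<lambda>x. H (x, y)) holomorphic_on ball a r"
      by (rule holomorphic2_slice1[OF H oW]) (use that sub in auto)
    show "H (z, y) = 0" if "z \<in> ball c s" for z
      by (rule z) (use that \<open>y \<in> ball d s\<close> s in auto)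
  qed (use s(1) sub that in auto)
  obtain x y where xy: "p = (x, y)" "x \<in> ball a r" "y \<in> ball b r" using p by auto
  have "H (x, y) = 0"
  proof (rule analytic_continuation_open[of "ball d s" "ball b r" "\<lambda>y. H (x, y)" "\<lambda>_. 0"])
    show "(\<lambda>y. H (x, y)) holomorphic_on ball b r"
      by (rule holomorphic2_slice2[OF H oW]) (use xy in auto)
  qed (use s(1) sub 1 xy in auto)
  then show ?thesis using xy by simp
qed

text \<open>The set \<open>Z\<close> of points with a neighbourhood of agreement is open by
  construction. It is also closed in \<open>W\<close>: a polydisc in \<open>W\<close> that meets
  \<open>Z\<close> contains an open set of agreement, hence agrees entirely. Connectedness
  finishes.\<close>

lemma holomorphic2_identity:
  assumes W: "open W" "connected W" and H: "H1 holomorphic2_on W" "H2 holomorphic2_on W"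
    and N: "open N" "p0 \<in> N" "N \<subseteq> W" "\<And>p. p \<in> N \<Longrightarrow> H1 p = H2 p" and p: "p \<in> W"
  shows "H1 p = H2 p"
proof -
  define Z where "Z = {p \<in> W. \<exists>N. open N \<and> p \<in> N \<and> (\<forall>q\<in>N. q \<in> W \<and> H1 q = H2 q)}"
  have "open Z"
    unfolding open_subopen[of Z]
  proof
    fix p assume "p \<in> Z"
    then obtain N where "open N" "p \<in> N" "\<forall>q\<in>N. q \<in> W \<and> H1 q = H2 q" unfolding Z_def by auto
    then show "\<exists>T. open T \<and> p \<in> T \<and> T \<subseteq> Z" by (intro exI[of _ N]) (auto simp: Z_def)
  qed
  moreover have "open (W - Z)"
    unfolding open_subopen[of "W - Z"]
  proof
    fix p assume p: "p \<in> W - Z"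
    obtain a b where ab: "p = (a, b)" by force
    obtain r where r: "r > 0" "cball a r \<times> cball b r \<subseteq> W"
      using open_contains_polydisc[OF W(1)] p ab by (metis DiffD1)
    define B where "B = ball a r \<times> ball b r"
    have B: "open B" "B \<subseteq> W" "p \<in> B" unfolding B_def using r ab by (auto intro: open_Times)
    have "(\<lambda>q. H1 q - H2 q) holomorphic2_on B"
      using H B unfolding holomorphic2_on_cdiff2[OF W(1)] holomorphic2_on_cdiff2[OF B(1)]
      by (auto intro: cdiff2_diff)
    note zero = holomorphic2_zero_polydisc[OF this[unfolded B_def]]
    have "B \<inter> Z = {}"
    proof (rule ccontr)
      assume "B \<inter> Z \<noteq> {}"
      then obtain q N where q: "q \<in> B" "open N" "q \<in> N" "\<forall>q\<in>N. q \<in> W \<and> H1 q = H2 q"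
        unfolding Z_def by auto
      have "H1 p' = H2 p'" if "p' \<in> B" for p'
        using zero[of "B \<inter> N" p'] q B that unfolding B_def by auto
      then have "p \<in> Z" unfolding Z_def using B p by blast
      then show False using p by simp
    qed
    then show "\<exists>T. open T \<and> p \<in> T \<and> T \<subseteq> W - Z" using B by (intro exI[of _ B]) auto
  qed
  moreover have "p0 \<in> Z" unfolding Z_def using N by blast
  moreover have "Z \<subseteq> W" unfolding Z_def by auto
  ultimately have "W - Z = {}"
    using connectedD[OF W(2), of Z "W - Z"] by (cases "W - Z = {}") auto
  then show ?thesis using p unfolding Z_def by blast
qed

text \<open>The maximum modulus principle on slices: constant in x from (x, y) to (a, y), then
  constant in y from there to (a, b).\<close>

lemma holomorphic2_unimodular_const:
  assumes H: "H holomorphic2_on ball a r \<times> ball b r"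
    and n: "\<And>p. p \<in> ball a r \<times> ball b r \<Longrightarrow> norm (H p) = 1" and p: "p \<in> ball a r \<times> ball b r"
  shows "H p = H (a, b)"
proof -
  obtain x y where xy: "p = (x, y)" "x \<in> ball a r" "y \<in> ball b r" using p by auto
  have oW: "open (ball a r \<times> ball b r)" by (intro open_Times open_ball)
  have "r > 0" using xy(2) zero_le_dist[of a x] by (simp del: zero_le_dist)
  then have ab: "a \<in> ball a r" "b \<in> ball b r" by auto
  have "(\<lambda>x. H (x, y)) constant_on ball a r"
    by (rule maximum_modulus_principle[of _ _ "ball a r" a])
      (use n ab xy in \<open>auto intro!: holomorphic2_slice1[OF H oW]\<close>)
  moreover have "(\<lambda>y. H (a, y)) constant_on ball b r"
    by (rule maximum_modulus_principle[of _ _ "ball b r" b])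
      (use n ab xy in \<open>auto intro!: holomorphic2_slice2[OF H oW]\<close>)
  ultimately show ?thesis using ab xy unfolding constant_on_def by metis
qed

section \<open>Power series in two variables and real analyticity\<close>

lemma has_sum_product_complex:
  fixes f :: "'a \<Rightarrow> complex" and g :: "'b \<Rightarrow> complex"
  assumes f: "(f has_sum s) A" and g: "(g has_sum t) B"
  shows "((\<lambda>(i, j). f i * g j) has_sum s * t) (A \<times> B)"
proof -
  have fa: "(\<lambda>i. norm (f i)) summable_on A" and ga: "(\<lambda>j. norm (g j)) summable_on B"
    using f g summable_on_iff_abs_summable_on_complex has_sum_imp_summable by blast+
  have "(\<lambda>p. norm ((\<lambda>(i, j). f i * g j) p)) summable_on (A \<times> B)"
    unfolding Infinite_Sum.abs_summable_on_Sigma_iff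
    using fa ga by (auto simp: norm_mult infsum_cmult_right' abs_mult infsum_nonneg intro!: summable_on_cmult_left summable_on_cmult_right)
  then have "(\<lambda>(i, j). f i * g j) summable_on (A \<times> B)"
    using abs_summable_summable by blast
  then show ?thesis
    by (intro has_sum_SigmaI[where g = "\<lambda>i. f i * t"])
      (auto intro!: has_sum_cmult_right g has_sum_cmult_left f)
qed

text \<open>Collects the terms over each fibre of \<open>g\<close>. Fibres may be infinite, since
  subfamilies of a summable family are summable.\<close>

lemma has_sum_regroup:
  fixes f :: "'a \<Rightarrow> complex"
  assumes f: "(f has_sum s) X" and g: "\<And>x. x \<in> X \<Longrightarrow> g x \<in> Y"
  shows "((\<lambda>y. infsum f {x \<in> X. g x = y}) has_sum s) Y"
proof (rule has_sum_Sigma'[where f = "\<lambda>(y, x). f x" and B = "\<lambda>y. {x \<in> X. g x = y}"])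
  have "bij_betw (\<lambda>x. (g x, x)) X (Sigma Y (\<lambda>y. {x \<in> X. g x = y}))"
    using g by (auto simp: bij_betw_def inj_on_def)
  from has_sum_reindex_bij_betw[OF this, of "\<lambda>(y, x). f x" s] f
  show "((\<lambda>(y, x). f x) has_sum s) (Sigma Y (\<lambda>y. {x \<in> X. g x = y}))" by simp
  show "((\<lambda>x. case (y, x) of (y, x) \<Rightarrow> f x) has_sum infsum f {x \<in> X. g x = y}) {x \<in> X. g x = y}"
    for y
  proof -
    have "f summable_on {x \<in> X. g x = y}"
      using has_sum_imp_summable[OF f] by (rule summable_on_subset_banach) auto
    then show ?thesis using has_sum_infsum by auto
  qed
qed

text \<open>Repeated division by \<open>x - a\<close> yields the Taylor coefficients in \<open>x\<close> as holomorphic functions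
  \<open>Fs n (a, y)\<close> of \<open>y\<close>, together with geometric bounds.\<close>

lemma double_power_series:
  assumes F: "F holomorphic2_on ball a R \<times> ball b R" and R: "R > 0"
  obtains e :: "nat \<times> nat \<Rightarrow> complex" where
    "\<And>u v. norm u < R / 4 \<Longrightarrow> norm v < R / 4 \<Longrightarrow>
       ((\<lambda>(n, m). e (n, m) * u ^ n * v ^ m) has_sum F (a + u, b + v)) UNIV"
proof -
  define W where "W = ball a R \<times> ball b R"
  have W: "open W" unfolding W_def by (intro open_Times open_ball)
  \<comment> \<open>Halving gives a compact polydisc for the bounds. The factor 2 / r per division
    below costs another factor 2, so convergence is obtained for norms below R / 4.\<close>
  define r where "r = R / 2"
  have r: "r > 0" "r < R" using R by (auto simp: r_def)
  have sub: "cball a r \<subseteq> ball a R" "cball b r \<subseteq> ball b R" using r by auto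
  define Fs where "Fs = rec_nat F (\<lambda>_ g. divquot (\<lambda>p. g p - g (a, snd p)) a)"
  have Fs0: "Fs 0 = F" and FsS: "Fs (Suc n) = divquot (\<lambda>p. Fs n p - Fs n (a, snd p)) a" for n
    by (auto simp: Fs_def)
  have hol: "Fs n holomorphic2_on W" for n
  proof (induction n)
    case 0 then show ?case using F by (simp add: Fs0 W_def)
  next
    case (Suc n)
    have "(\<lambda>p. Fs n p - Fs n (a, snd p)) holomorphic2_on W"
      using Suc unfolding holomorphic2_on_cdiff2[OF W]
      by (auto intro!: cdiff2_diff cdiff2_compose2[where h = "Fs n"] cdiff2_intros simp: W_def R)
    then show ?case unfolding FsS by (rule divquot_holomorphic2[OF W]) simp
  qed
  have step: "Fs n (x, y) = Fs n (a, y) + (x - a) * Fs (Suc n) (x, y)" for n x y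
    unfolding FsS by (auto simp: divquot_def)
  have expand: "F (x, y) = (\<Sum>k<n. Fs k (a, y) * (x - a) ^ k) + (x - a) ^ n * Fs n (x, y)" for n x y
  proof (induction n)
    case (Suc n) then show ?case using step[of n x y] by (simp add: algebra_simps)
  qed (simp add: Fs0)
  have "compact (F ` (cball a r \<times> cball b r))"
    using sub by (intro compact_continuous_image compact_Times compact_cball
      continuous_on_subset[OF holomorphic2_on_imp_continuous_on[OF F]]) auto
  from compact_imp_bounded[OF this]
  obtain M where "\<forall>z \<in> F ` (cball a r \<times> cball b r). norm z \<le> M"
    unfolding bounded_iff by (elim exE)
  then have M: "norm (F (x, y)) \<le> M" if "x \<in> cball a r" "y \<in> cball b r" for x y
    using that by simp
  have M0: "M \<ge> 0" using M[of a b] r order_trans[OF norm_ge_zero] by auto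
  \<comment> \<open>Each division subtracts the value at x = a, which at most doubles the bound, and
    then divides by x - a, which by the maximum principle costs 1 / r.\<close>
  have bound: "norm (Fs n (x, y)) \<le> M * (2 / r) ^ n" if "x \<in> cball a r" "y \<in> cball b r" for n x y
    using that
  proof (induction n arbitrary: x y)
    case 0 then show ?case using M by (simp add: Fs0)
  next
    case (Suc n)
    have "norm (Fs (Suc n) (x, y)) \<le> (M * (2 / r) ^ n + M * (2 / r) ^ n) / r"
    proof (rule cball_quotient_bound[where h = "\<lambda>x. Fs (Suc n) (x, y)"])
      show "(\<lambda>x. Fs (Suc n) (x, y)) holomorphic_on ball a R"
        by (rule holomorphic2_slice1[OF hol W]) (use Suc.prems sub in \<open>auto simp: W_def\<close>)
      fix z assume z: "dist a z = r"
      have "(z - a) * Fs (Suc n) (z, y) = Fs n (z, y) - Fs n (a, y)" using step[of n z y] by simp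
      also have "norm \<dots> \<le> norm (Fs n (z, y)) + norm (Fs n (a, y))" by (rule norm_triangle_ineq4)
      also have "\<dots> \<le> M * (2 / r) ^ n + M * (2 / r) ^ n"
        using z r Suc.prems by (intro add_mono Suc.IH) auto
      finally show "norm ((z - a) * Fs (Suc n) (z, y)) \<le> M * (2 / r) ^ n + M * (2 / r) ^ n" .
    qed (use Suc.prems sub r in auto)
    then show ?case by (simp add: field_simps)
  qed
  define e where "e = (\<lambda>(n, m). (deriv ^^ m) (\<lambda>y. Fs n (a, y)) b / fact m)"
  have hol2: "(\<lambda>y. Fs n (a, y)) holomorphic_on ball b R" for n
    by (rule holomorphic2_slice2[OF hol W]) (use R in \<open>auto simp: W_def\<close>)
  have ebound: "norm (e (n, m)) \<le> M * (2 / r) ^ n / r ^ m" for n m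
  proof -
    have "norm ((deriv ^^ m) (\<lambda>y. Fs n (a, y)) b) \<le> fact m * (M * (2 / r) ^ n) / r ^ m"
      by (rule Cauchy_inequality)
        (use r sub bound[of a] in \<open>auto intro!: holomorphic_on_subset[OF hol2]
          continuous_on_subset[OF holomorphic_on_imp_continuous_on[OF hol2]] simp: dist_norm\<close>)
    then show ?thesis by (simp add: e_def norm_divide field_simps)
  qed
  have geo: "summable (\<lambda>n. q ^ n)" if "0 \<le> q" "q < 1" for q :: real
    using that by (intro summable_geometric) auto
  show thesis
  proof (rule that)
    fix u v :: complex assume u: "norm u < R / 4" and v: "norm v < R / 4"
    define qu where "qu = 2 * norm u / r"
    define qv where "qv = norm v / r"
    have qu: "0 \<le> qu" "qu < 1" and qv: "0 \<le> qv" "qv < 1"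
      using u v r by (auto simp: qu_def qv_def r_def field_simps)
    have bd: "norm (e (n, m) * u ^ n * v ^ m) \<le> M * qu ^ n * qv ^ m" for n m
    proof -
      have "norm (e (n, m) * u ^ n * v ^ m) = norm (e (n, m)) * (norm u ^ n * norm v ^ m)"
        by (simp add: norm_mult norm_power)
      also have "\<dots> \<le> M * (2 / r) ^ n / r ^ m * (norm u ^ n * norm v ^ m)"
        by (intro mult_right_mono ebound) auto
      also have "\<dots> = M * qu ^ n * qv ^ m"
        by (simp add: qu_def qv_def power_divide power_mult_distrib)
      finally show ?thesis .
    qed
    have inner: "((\<lambda>m. e (n, m) * u ^ n * v ^ m) has_sum Fs n (a, b + v) * u ^ n) UNIV" for n
    proof (rule norm_summable_imp_has_sum)
      show "summable (\<lambda>m. norm (e (n, m) * u ^ n * v ^ m))"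
        by (rule summable_comparison_test'[where g = "\<lambda>m. M * qu ^ n * qv ^ m" and N = 0])
          (use bd geo[OF qv] in \<open>auto intro!: summable_mult\<close>)
      have "b + v \<in> ball b R" using v R by (simp add: dist_norm)
      from sums_mult2[OF holomorphic_power_series[OF hol2 this, of n], of "u ^ n"]
      show "(\<lambda>m. e (n, m) * u ^ n * v ^ m) sums (Fs n (a, b + v) * u ^ n)"
        by (simp add: e_def mult_ac)
    qed
    have au: "a + u \<in> cball a r" "b + v \<in> cball b r" using u v R by (auto simp: dist_norm r_def)
    have small: "norm (Fs n (x, b + v) * u ^ n) \<le> M * qu ^ n" if "x \<in> cball a r" for n x
    proof -
      have "norm (Fs n (x, b + v) * u ^ n) \<le> M * (2 / r) ^ n * norm u ^ n"
        unfolding norm_mult norm_power by (intro mult_right_mono bound that au) auto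
      then show ?thesis by (simp add: qu_def power_divide power_mult_distrib)
    qed
    have outer: "((\<lambda>n. Fs n (a, b + v) * u ^ n) has_sum F (a + u, b + v)) UNIV"
    proof (rule norm_summable_imp_has_sum)
      show "summable (\<lambda>n. norm (Fs n (a, b + v) * u ^ n))"
        by (rule summable_comparison_test'[where g = "\<lambda>n. M * qu ^ n" and N = 0])
          (use small[of a] r geo[OF qu] in \<open>auto intro!: summable_mult\<close>)
      have lim: "(\<lambda>n. M * qu ^ n) \<longlonglongrightarrow> 0"
        using qu by (intro tendsto_mult_right_zero LIMSEQ_realpow_zero) auto
      have "(\<lambda>n. u ^ n * Fs n (a + u, b + v)) \<longlonglongrightarrow> 0"
        by (rule Lim_null_comparison[OF _ lim])
          (use small[OF au(1)] in \<open>auto simp: mult.commute intro!: always_eventually\<close>)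
      then have "(\<lambda>n. F (a + u, b + v) - u ^ n * Fs n (a + u, b + v)) \<longlonglongrightarrow> F (a + u, b + v) - 0"
        by (intro tendsto_diff tendsto_const)
      moreover have "(\<Sum>k<n. Fs k (a, b + v) * u ^ k) = F (a + u, b + v) - u ^ n * Fs n (a + u, b + v)" for n
        using expand[of "a + u" "b + v" n] by simp
      ultimately show "(\<lambda>n. Fs n (a, b + v) * u ^ n) sums F (a + u, b + v)"
        unfolding sums_def by simp
    qed
    have "(\<lambda>p. norm ((\<lambda>(n, m). e (n, m) * u ^ n * v ^ m) p)) summable_on (UNIV \<times> UNIV)"
    proof (rule Infinite_Sum.abs_summable_on_comparison_test)
      have gs: "((\<lambda>n. of_real (q ^ n) :: complex) has_sum of_real (1 / (1 - q))) UNIV"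
        if "0 \<le> q" "q < 1" for q :: real
      proof (rule norm_summable_imp_has_sum)
        show "summable (\<lambda>n. norm (of_real (q ^ n) :: complex))"
          using geo[OF that] that by (simp add: norm_power)
        show "(\<lambda>n. of_real (q ^ n) :: complex) sums of_real (1 / (1 - q))"
          using that by (intro sums_of_real geometric_sums) auto
      qed
      \<comment> \<open>Absolute summability over pairs is what allows the iterated sums to be
        joined. The geometric majorant is written with complex values so that
        \<open>has_sum_product_complex\<close> applies to it.\<close>
      have "((\<lambda>(n, m). (of_real M * of_real (qu ^ n)) * of_real (qv ^ m) :: complex) has_sum
          (of_real M * of_real (1 / (1 - qu))) * of_real (1 / (1 - qv))) (UNIV \<times> UNIV)"
        by (intro has_sum_product_complex has_sum_cmult_right gs qu qv)
      then show "(\<lambda>p. norm ((\<lambda>(n, m). (of_real M * of_real (qu ^ n)) * of_real (qv ^ m) :: complex) p))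
          summable_on (UNIV \<times> UNIV)"
        using summable_on_iff_abs_summable_on_complex has_sum_imp_summable by blast
      show "norm (case p of (n, m) \<Rightarrow> e (n, m) * u ^ n * v ^ m) \<le>
        norm ((\<lambda>(n, m). (of_real M * of_real (qu ^ n)) * of_real (qv ^ m) :: complex) p)" for p
        using bd M0 qu qv by (cases p) (auto simp: norm_mult norm_power)
    qed
    then have "(\<lambda>(n, m). e (n, m) * u ^ n * v ^ m) summable_on (UNIV \<times> UNIV)"
      using abs_summable_summable by blast
    from has_sum_SigmaI[OF _ outer this] inner
    show "((\<lambda>(n, m). e (n, m) * u ^ n * v ^ m) has_sum F (a + u, b + v)) UNIV" by simp
  qed
qed

lemma Basis_C2: "(Basis :: (complex \<times> complex) set) = {(1, 0), (\<i>, 0), (0, 1), (0, \<i>)}"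
  by (auto simp: Basis_prod_def Basis_complex_def)

definition C2_mono :: "complex \<times> complex \<Rightarrow> (complex \<times> complex \<Rightarrow> nat) \<Rightarrow> real" where
  "C2_mono h \<alpha> = (\<Prod>b\<in>Basis. (h \<bullet> b) ^ \<alpha> b)"

text \<open>The restriction to \<open>Basis\<close> puts these exponents into the index set of
  \<open>real_analytic_at\<close>.\<close>

definition C2_exps :: "nat \<Rightarrow> nat \<Rightarrow> nat \<Rightarrow> nat \<Rightarrow> complex \<times> complex \<Rightarrow> nat" where
  "C2_exps i j k l = (\<lambda>b\<in>Basis. if b = (1, 0) then i else if b = (\<i>, 0) then j
     else if b = (0, 1) then k else l)"

lemma C2_mono_exps: "C2_mono (u, v) (C2_exps i j k l) = Re u ^ i * Im u ^ j * Re v ^ k * Im v ^ l"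
  unfolding C2_mono_def C2_exps_def by (simp add: Basis_C2 complex_eq_iff inner_complex_def mult.assoc)

lemma C2_mono_add:
  "C2_mono h (restrict (\<lambda>b. \<alpha> b + \<beta> b) Basis) = C2_mono h \<alpha> * C2_mono h \<beta>"
  unfolding C2_mono_def by (simp add: power_add prod.distrib)

text \<open>An expansion with complex coefficients and an arbitrary index set, in which many indices
  may share a monomial, is enough: equal multi-indices are collected, and real parts may be taken
  because the monomials and the sum are real.\<close>

lemma real_analytic_at_regroup:
  fixes F :: "'i \<Rightarrow> complex" and g :: "complex \<times> complex \<Rightarrow> real"
  assumes r: "r > 0" and \<alpha>: "\<And>x. x \<in> X \<Longrightarrow> \<alpha> x \<in> Basis \<rightarrow>\<^sub>E UNIV"
    and sum: "\<And>h. norm h < r \<Longrightarrow>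
      ((\<lambda>x. F x * of_real (C2_mono h (\<alpha> x))) has_sum of_real (g (p + h))) X"
  shows "real_analytic_at g p"
  unfolding real_analytic_at_def
proof (intro exI conjI allI impI)
  fix h :: "complex \<times> complex" assume h: "norm h < r"
  have "((\<lambda>y. infsum (\<lambda>x. F x * of_real (C2_mono h (\<alpha> x))) {x \<in> X. \<alpha> x = y}) has_sum
      of_real (g (p + h))) (Basis \<rightarrow>\<^sub>E UNIV)"
    by (rule has_sum_regroup[OF sum[OF h] \<alpha>])
  also have "(\<lambda>y. infsum (\<lambda>x. F x * of_real (C2_mono h (\<alpha> x))) {x \<in> X. \<alpha> x = y}) =
      (\<lambda>y. infsum F {x \<in> X. \<alpha> x = y} * of_real (C2_mono h y))"
  proof
    fix y
    have "infsum (\<lambda>x. F x * of_real (C2_mono h (\<alpha> x))) {x \<in> X. \<alpha> x = y} =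
        infsum (\<lambda>x. F x * of_real (C2_mono h y)) {x \<in> X. \<alpha> x = y}"
      by (intro infsum_cong) auto
    then show "infsum (\<lambda>x. F x * of_real (C2_mono h (\<alpha> x))) {x \<in> X. \<alpha> x = y} =
        infsum F {x \<in> X. \<alpha> x = y} * of_real (C2_mono h y)"
      by (simp add: infsum_cmult_left')
  qed
  finally have "((\<lambda>y. Re (infsum F {x \<in> X. \<alpha> x = y} * of_real (C2_mono h y))) has_sum
      Re (of_real (g (p + h)))) (Basis \<rightarrow>\<^sub>E UNIV)"
    by (rule has_sum_Re)
  then have "((\<lambda>y. Re (infsum F {x \<in> X. \<alpha> x = y}) * C2_mono h y) has_sum g (p + h))
      (Basis \<rightarrow>\<^sub>E UNIV)"
    by simp
  then show "((\<lambda>y. Re (infsum F {x \<in> X. \<alpha> x = y}) * (\<Prod>b\<in>Basis. (h \<bullet> b) ^ y b)) has_sum g (p + h))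
      (Basis \<rightarrow>\<^sub>E UNIV)"
    unfolding C2_mono_def .
qed (rule r)

lemma complex_power_binomial:
  "(u :: complex) ^ n = (\<Sum>j\<le>n. of_nat (n choose j) * \<i> ^ (n - j) * of_real (Re u ^ j * Im u ^ (n - j)))"
proof -
  have "u = of_real (Re u) + \<i> * of_real (Im u)" by (simp add: complex_eq_iff)
  then have "u ^ n = (of_real (Re u) + \<i> * of_real (Im u)) ^ n" by (rule arg_cong)
  also have "\<dots> = (\<Sum>j\<le>n. of_nat (n choose j) * of_real (Re u) ^ j * (\<i> * of_real (Im u)) ^ (n - j))"
    by (rule binomial_ring)
  finally show ?thesis by (simp only: power_mult_distrib of_real_mult of_real_power mult_ac)
qed

text \<open>Binomial expansion of u^n and v^m in real and imaginary parts turns the double series of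
  \<open>E\<close> into a series of real monomials with complex coefficients. The squared norm is E
  * cnj E, hence a product of two such series; monomials multiply by adding exponents.\<close>

lemma real_analytic_at_norm_square:
  assumes E: "E holomorphic2_on N" and N: "open N" "p \<in> N"
    and g: "\<And>q. q \<in> N \<Longrightarrow> g q = (norm (E q))\<^sup>2"
  shows "real_analytic_at g p"
proof -
  obtain a b where p: "p = (a, b)" by force
  obtain R where R: "R > 0" "cball a R \<times> cball b R \<subseteq> N"
    using open_contains_polydisc[OF N(1)] N(2) p by metis
  have EB: "E holomorphic2_on ball a R \<times> ball b R"
    by (rule holomorphic2_on_subset[OF E order_trans[OF Sigma_mono[OF ball_subset_cball ball_subset_cball] R(2)]])
  obtain e where e: "\<And>u v. norm u < R / 4 \<Longrightarrow> norm v < R / 4 \<Longrightarrow>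
       ((\<lambda>(n, m). e (n, m) * u ^ n * v ^ m) has_sum E (a + u, b + v)) UNIV"
    by (rule double_power_series[OF EB R(1)]) blast
  define X where "X = Sigma (UNIV :: (nat \<times> nat) set) (\<lambda>(n, m). {..n} \<times> {..m})"
  define F where "F = (\<lambda>((n, m), (j, k)). e (n, m) *
    (of_nat (n choose j) * \<i> ^ (n - j)) * (of_nat (m choose k) * \<i> ^ (m - k)))"
  define \<alpha> where "\<alpha> = (\<lambda>((n, m), (j, k)). C2_exps j (n - j) k (m - k))"
  have sumE: "((\<lambda>x. F x * of_real (C2_mono (u, v) (\<alpha> x))) has_sum E (a + u, b + v)) X"
    if uv: "norm (u, v) < R / 8" for u v
  proof -
    have nu: "norm u < R / 8" "norm v < R / 8"
      using uv norm_fst_le[of u v] norm_snd_le[of v u] by auto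
    \<comment> \<open>Replacing every term by its absolute value turns the binomial sums into s^n
      and t^m, so absolute summability follows from that of the double series at the real point (s,
      t). As s <= 2 |u|, the radius R / 8 keeps s and t below R / 4.\<close>
    define s where "s = \<bar>Re u\<bar> + \<bar>Im u\<bar>"
    define t where "t = \<bar>Re v\<bar> + \<bar>Im v\<bar>"
    have st: "s < R / 4" "t < R / 4" "0 \<le> s" "0 \<le> t"
      unfolding s_def t_def using nu abs_Re_le_cmod[of u] abs_Im_le_cmod[of u]
        abs_Re_le_cmod[of v] abs_Im_le_cmod[of v] by auto
    define f where "f = (\<lambda>x. F x * of_real (C2_mono (u, v) (\<alpha> x)))"
    have feq: "f ((n, m), (j, k)) = e (n, m) *
        (of_nat (n choose j) * \<i> ^ (n - j) * of_real (Re u ^ j * Im u ^ (n - j))) *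
        (of_nat (m choose k) * \<i> ^ (m - k) * of_real (Re v ^ k * Im v ^ (m - k)))" for n m j k
      by (simp add: f_def F_def \<alpha>_def C2_mono_exps mult_ac)
    have inner: "((\<lambda>y. f (x, y)) has_sum (\<lambda>(n, m). e (n, m) * u ^ n * v ^ m) x)
        ((\<lambda>(n, m). {..n} \<times> {..m}) x)" for x
    proof -
      obtain n m where x: "x = (n, m)" by force
      have "(\<Sum>y\<in>{..n} \<times> {..m}. f (x, y)) = (\<Sum>j\<le>n. \<Sum>k\<le>m. e (n, m) *
          (of_nat (n choose j) * \<i> ^ (n - j) * of_real (Re u ^ j * Im u ^ (n - j))) *
          (of_nat (m choose k) * \<i> ^ (m - k) * of_real (Re v ^ k * Im v ^ (m - k))))"
        unfolding x sum.cartesian_product' feq ..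
      also have "\<dots> = e (n, m) * u ^ n * v ^ m"
        unfolding complex_power_binomial[of u n] complex_power_binomial[of v m]
        by (simp only: sum_distrib_left[symmetric] sum_distrib_right[symmetric])
      finally have "(\<Sum>y\<in>{..n} \<times> {..m}. f (x, y)) = e (n, m) * u ^ n * v ^ m" .
      then show ?thesis using has_sum_finite[of "{..n} \<times> {..m}" "\<lambda>y. f (x, y)"] x by simp
    qed
    have nsum: "(\<Sum>y\<in>{..n} \<times> {..m}. norm (f ((n, m), y))) = norm (e (n, m)) * s ^ n * t ^ m" for n m
    proof -
      have "norm (f ((n, m), (j, k))) = norm (e (n, m)) *
          (of_nat (n choose j) * \<bar>Re u\<bar> ^ j * \<bar>Im u\<bar> ^ (n - j)) *
          (of_nat (m choose k) * \<bar>Re v\<bar> ^ k * \<bar>Im v\<bar> ^ (m - k))" for j k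
        by (simp add: feq norm_mult norm_power power_abs mult.assoc)
      then show ?thesis
        unfolding s_def t_def binomial_ring sum.cartesian_product'
        by (simp only: sum_distrib_left[symmetric] sum_distrib_right[symmetric])
    qed
    have "(\<lambda>x. norm (f x)) summable_on X"
      unfolding X_def Infinite_Sum.abs_summable_on_Sigma_iff
    proof (intro conjI ballI)
      show "(\<lambda>y. norm (f (x, y))) summable_on (case x of (n, m) \<Rightarrow> {..n} \<times> {..m})" for x
        by (cases x) (auto intro!: summable_on_finite)
      have "((\<lambda>(n, m). e (n, m) * of_real s ^ n * of_real t ^ m) has_sum E (a + of_real s, b + of_real t)) UNIV"
        using st by (intro e) auto
      then have "(\<lambda>x. norm ((\<lambda>(n, m). e (n, m) * of_real s ^ n * of_real t ^ m) x)) summable_on UNIV"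
        using summable_on_iff_abs_summable_on_complex has_sum_imp_summable by blast
      also have "(\<lambda>x. norm ((\<lambda>(n, m). e (n, m) * of_real s ^ n * of_real t ^ m) x)) =
          (\<lambda>x. norm (infsum (\<lambda>y. norm (f (x, y))) (case x of (n, m) \<Rightarrow> {..n} \<times> {..m})))"
        using st by (auto simp: nsum norm_mult norm_power)
      finally show "(\<lambda>x. norm (infsum (\<lambda>y. norm (f (x, y))) (case x of (n, m) \<Rightarrow> {..n} \<times> {..m}))) summable_on UNIV" .
    qed
    then have "f summable_on X" by (rule abs_summable_summable)
    then have "(f has_sum E (a + u, b + v)) X"
      unfolding X_def using has_sum_SigmaI[OF inner e] nu R(1) by auto
    then show ?thesis by (simp add: f_def)
  qed
  show ?thesis
  proof (rule real_analytic_at_regroup[where r = "R / 8" and X = "X \<times> X"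
        and F = "\<lambda>(x, x'). F x * cnj (F x')"
        and \<alpha> = "\<lambda>(x, x'). restrict (\<lambda>b. \<alpha> x b + \<alpha> x' b) Basis"])
    fix h :: "complex \<times> complex" assume h: "norm h < R / 8"
    obtain u v where uv: "h = (u, v)" by force
    have S: "((\<lambda>x. F x * of_real (C2_mono h (\<alpha> x))) has_sum E (p + h)) X"
      using sumE[of u v] h p uv by simp
    then have "((\<lambda>x. cnj (F x * of_real (C2_mono h (\<alpha> x)))) has_sum cnj (E (p + h))) X"
      by (simp only: has_sum_cnj_iff)
    from has_sum_product_complex[OF S this]
    have "((\<lambda>(x, x'). F x * of_real (C2_mono h (\<alpha> x)) * cnj (F x' * of_real (C2_mono h (\<alpha> x')))) has_sum
        E (p + h) * cnj (E (p + h))) (X \<times> X)" .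
    also have "E (p + h) * cnj (E (p + h)) = of_real (g (p + h))"
    proof -
      have "norm u \<le> norm h" "norm v \<le> norm h"
        using norm_fst_le[of u v] norm_snd_le[of v u] uv by auto
      then have "p + h \<in> N" using h uv p R by (intro subsetD[OF R(2)]) (auto simp: dist_norm)
      then show ?thesis using g[of "p + h"] by (simp only: complex_norm_square)
    qed
    also have "(\<lambda>(x, x'). F x * of_real (C2_mono h (\<alpha> x)) * cnj (F x' * of_real (C2_mono h (\<alpha> x')))) =
      (\<lambda>x. (case x of (x, x') \<Rightarrow> F x * cnj (F x')) *
         of_real (C2_mono h (case x of (x, x') \<Rightarrow> restrict (\<lambda>b. \<alpha> x b + \<alpha> x' b) Basis)))"
      by (auto simp: C2_mono_add mult_ac)
    finally show "((\<lambda>x. (case x of (x, x') \<Rightarrow> F x * cnj (F x')) *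
         of_real (C2_mono h (case x of (x, x') \<Rightarrow> restrict (\<lambda>b. \<alpha> x b + \<alpha> x' b) Basis))) has_sum
         of_real (g (p + h))) (X \<times> X)" .
  qed (use R(1) in auto)
qed

section \<open>Dynamics of \<open>(x, y) \<mapsto> (z0 + G(x, y) (x - z0) (y - z0), x)\<close>\<close>

lemma phi_gt_1: "phi > 1"
  unfolding phi_def using real_sqrt_less_mono[of 1 5] by simp

lemma phi_mult_phi: "phi * phi = phi + 1"
  unfolding phi_def by (simp add: field_simps)

lemma inverse_phi: "1 / phi = phi - 1"
  using phi_gt_1 phi_mult_phi by (simp add: field_simps)

lemma phi_plus_inverse: "phi + 1 / phi = sqrt 5"
  unfolding inverse_phi unfolding phi_def by (simp add: field_simps)

text \<open>The total of the weights 1 / (sqrt 5 phi^k), hence the factor of w0 in the central value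
  of \<open>H\<close>.\<close>

lemma sqrt5_sum: "1 / sqrt 5 * (1 / (1 - 1 / phi)) = (5 + 3 * sqrt 5) / 10"
proof -
  have s: "sqrt 5 * sqrt 5 = (5 :: real)" by simp
  have "1 - 1 / phi = 2 - phi" unfolding inverse_phi by simp
  moreover have "(2 - phi) * (phi + 1) = 1" using phi_mult_phi by (simp add: algebra_simps)
  ultimately have "1 / (1 - 1 / phi) = phi + 1"
    by (metis divide_eq_eq mult.commute mult_zero_left zero_neq_one)
  moreover have "1 / sqrt 5 = sqrt 5 / 5" by (simp add: field_simps)
  ultimately have "1 / sqrt 5 * (1 / (1 - 1 / phi)) = sqrt 5 / 5 * (phi + 1)" by (simp only:)
  also have "\<dots> = (5 + 3 * sqrt 5) / 10" unfolding phi_def by (simp add: algebra_simps s)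
  finally show ?thesis .
qed

text \<open>The coordinate with eigenvalue phi collects the perturbations \<open>l k\<close> with
  weights phi^(-k); the other one stays bounded and dies after division by phi^n. Since a n = (phi *
  B n + q * D n) / sqrt 5, the initial value B 0 = a 0 + c 0 / phi produces the exponents phi / sqrt
  5 and 1 / sqrt 5 of the monomial.\<close>

lemma weighted_recursion_limit:
  fixes a c l :: "nat \<Rightarrow> real"
  assumes a: "\<And>n. a (Suc n) = l n + a n + c n" and c: "\<And>n. c (Suc n) = a n"
    and K: "\<And>n. \<bar>l n\<bar> \<le> K"
  shows "(\<lambda>n. a n / phi ^ n) \<longlonglongrightarrow>
    (\<Sum>k. l k / (sqrt 5 * phi ^ k)) + phi / sqrt 5 * a 0 + c 0 / sqrt 5"
proof -
  define q where "q = 1 / phi"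
  have "0 < q" "q < 1" "phi * q = 1" unfolding q_def using phi_gt_1 by auto
  then have q: "0 < q" "q < 1" "phi * q = 1" "q = phi - 1" "phi + q = sqrt 5"
    using phi_plus_inverse by (simp_all only: q_def inverse_phi)
  have cancel: "phi * (q * x) = x" "q * (phi * x) = x" for x
    using q(3) by (simp_all only: mult.assoc[symmetric] mult.commute[of q phi] mult_1_left)
  have qp: "x / phi ^ k = x * q ^ k" for x k by (simp add: q_def power_divide)
  have summ: "summable (\<lambda>k. q ^ k * l k)"
  proof (rule summable_comparison_test'[where g = "\<lambda>k. K * q ^ k" and N = 0])
    show "summable (\<lambda>k. K * q ^ k)" using q by (intro summable_mult summable_geometric) auto
    show "norm (q ^ k * l k) \<le> K * q ^ k" for k
      using K[of k] q(1) by (simp add: abs_mult mult.commute mult_left_mono)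
  qed
  text \<open>The two eigen-coordinates of the Fibonacci recursion, with eigenvalues \<open>phi\<close> and \<open>- 1 / phi\<close>.\<close>
  define B where "B n = a n + q * c n" for n
  define D where "D n = a n - phi * c n" for n
  have B: "q ^ n * B n = B 0 + q * (\<Sum>k<n. q ^ k * l k)" for n
  proof (induction n)
    case (Suc n)
    have "B (Suc n) = l n + (1 + q) * a n + c n"
      unfolding B_def by (simp add: a c algebra_simps)
    also have "\<dots> = l n + phi * B n"
      unfolding B_def by (simp add: q(4) distrib_left cancel[unfolded q(4)])
    finally have "q ^ Suc n * B (Suc n) = q * (q ^ n * l n) + (phi * q) * (q ^ n * B n)"
      by (simp add: algebra_simps)
    then show ?case using Suc q(3) by (simp add: algebra_simps)
  qed simp
  have Blim: "(\<lambda>n. q ^ n * B n) \<longlonglongrightarrow> B 0 + q * (\<Sum>k. q ^ k * l k)"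
    unfolding B by (intro tendsto_intros summable_LIMSEQ summ)
  \<comment> \<open>K / (1 - q) is the fixed point of t \<mapsto> K + q * t, so the bound reproduces
    itself under |D (Suc n)| <= K + q * |D n|.\<close>
  define C where "C = \<bar>D 0\<bar> + K / (1 - q)"
  have K0: "K \<ge> 0" using K[of 0] by simp
  have D: "\<bar>D n\<bar> \<le> C" for n
  proof (induction n)
    case 0 then show ?case using K0 q by (simp add: C_def)
  next
    case (Suc n)
    have "D (Suc n) = l n - q * D n"
      unfolding D_def by (simp add: a c right_diff_distrib cancel) (simp add: q(4) algebra_simps)
    then have "\<bar>D (Suc n)\<bar> \<le> \<bar>l n\<bar> + q * \<bar>D n\<bar>"
      using q(1) by (metis abs_mult abs_of_pos abs_triangle_ineq4)
    also have "\<dots> \<le> K + q * C" using Suc K q by (intro add_mono mult_left_mono) auto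
    also have "\<dots> \<le> C"
    proof -
      define J where "J = K / (1 - q)"
      have "J * (1 - q) = K" unfolding J_def using q by simp
      moreover have "q * \<bar>D 0\<bar> \<le> 1 * \<bar>D 0\<bar>" using q by (intro mult_right_mono) auto
      ultimately show ?thesis unfolding C_def J_def[symmetric] by (simp add: algebra_simps)
    qed
    finally show ?case .
  qed
  have Dlim: "(\<lambda>n. q ^ n * D n) \<longlonglongrightarrow> 0"
  proof (rule Lim_null_comparison)
    show "(\<lambda>n. q ^ n * C) \<longlonglongrightarrow> 0"
      using q by (intro tendsto_mult_left_zero LIMSEQ_realpow_zero) auto
    show "\<forall>\<^sub>F n in sequentially. norm (q ^ n * D n) \<le> q ^ n * C"
      using D q by (intro always_eventually) (auto simp: abs_mult mult_left_mono)
  qed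
  have "a n / phi ^ n = (phi * (q ^ n * B n) + q * (q ^ n * D n)) / sqrt 5" for n
  proof -
    have "phi * B n + q * D n = (phi + q) * a n" unfolding B_def D_def by (simp add: algebra_simps)
    then have "q ^ n * (phi * B n + q * D n) = sqrt 5 * (q ^ n * a n)" using q(5) by simp
    then show ?thesis by (simp add: qp algebra_simps)
  qed
  then have "(\<lambda>n. a n / phi ^ n) \<longlonglongrightarrow>
      (phi * (B 0 + q * (\<Sum>k. q ^ k * l k)) + q * 0) / sqrt 5"
    by (simp only:) (intro tendsto_intros Blim Dlim, simp)
  also have "(phi * (B 0 + q * (\<Sum>k. q ^ k * l k)) + q * 0) / sqrt 5 =
      ((phi * q) * (\<Sum>k. q ^ k * l k) + phi * a 0 + (phi * q) * c 0) / sqrt 5"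
    unfolding B_def by (simp add: algebra_simps)
  also have "\<dots> = (\<Sum>k. q ^ k * l k) / sqrt 5 + phi / sqrt 5 * a 0 + c 0 / sqrt 5"
    using q(3) by (simp add: add_divide_distrib)
  also have "(\<Sum>k. q ^ k * l k) / sqrt 5 = (\<Sum>k. l k / (sqrt 5 * phi ^ k))"
    using suminf_divide[OF summ, of "sqrt 5"] by (simp add: q_def power_divide field_simps)
  finally show ?thesis .
qed

text \<open>What the asymptotics use of the secant map, with \<open>A\<close> the basin and
  \<open>G\<close> the cofactor. The assumption f''(z0) \<noteq> 0 enters as
  \<open>G_centre\<close>.\<close>

locale fibonacci_basin =
  fixes A :: "(complex \<times> complex) set" and T :: "complex \<times> complex \<Rightarrow> complex \<times> complex"
    and G :: "complex \<times> complex \<Rightarrow> complex" and z0 :: complex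
  assumes open_A: "open A" and centre: "(z0, z0) \<in> A"
    and T_A: "p \<in> A \<Longrightarrow> T p \<in> A"
    and T_eq: "p \<in> A \<Longrightarrow> T p = (z0 + G p * (fst p - z0) * (snd p - z0), fst p)"
    and G_hol: "G holomorphic2_on A" and G_centre: "G (z0, z0) \<noteq> 0"
    and orbit: "p \<in> A \<Longrightarrow> (\<lambda>n. (T ^^ n) p) \<longlonglongrightarrow> (z0, z0)"
begin

lemma funpow_A: "p \<in> A \<Longrightarrow> (T ^^ n) p \<in> A"
  by (induction n) (auto intro: T_A)

lemma G_cdiff2: "p \<in> A \<Longrightarrow> cdiff2 G p"
  using G_hol open_A by (simp add: holomorphic2_on_cdiff2)

lemma cdiff2_T:
  assumes "p \<in> A" "cdiff2 K (T p)"
  shows "cdiff2 (\<lambda>q. K (T q)) p"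
proof (rule cdiff2_transform[OF _ open_A assms(1)])
  show "cdiff2 (\<lambda>q. K (z0 + G q * (fst q - z0) * (snd q - z0), fst q)) p"
    using assms T_eq[OF assms(1)]
    by (intro cdiff2_compose2[where h = K] cdiff2_intros G_cdiff2) auto
qed (simp add: T_eq)

lemma isCont_T:
  assumes "p \<in> A"
  shows "isCont T p"
proof -
  have "isCont (\<lambda>q. (z0 + G q * (fst q - z0) * (snd q - z0), fst q)) p"
    by (intro continuous_intros cdiff2_isCont G_cdiff2 assms)
  then show ?thesis
    by (rule isCont_cong[THEN iffD1, rotated])
      (use eventually_nhds_in_open[OF open_A assms] in \<open>auto elim!: eventually_mono simp: T_eq\<close>)
qed

lemma T_centre: "(T ^^ n) (z0, z0) = (z0, z0)"
  by (induction n) (auto simp: T_eq centre)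

lemma axis_absorbing:
  assumes "p \<in> A" "fst ((T ^^ n) p) = z0" "n \<le> m"
  shows "fst ((T ^^ m) p) = z0"
  using assms(3,2)
proof (induction m rule: dec_induct)
  case (step m) then show ?case using T_eq[OF funpow_A[OF assms(1), of m]] by simp
qed

text \<open>The orbit tends to the centre, where \<open>G\<close> is not 0, so the logarithms
  converge. The finitely many iterates at which \<open>G\<close> may vanish do no harm because
  \<open>ln\<close> is total.\<close>

lemma log_bounded:
  assumes "p \<in> A"
  obtains K where "\<And>n. \<bar>ln (norm (G ((T ^^ n) p)))\<bar> \<le> K"
proof -
  have "(\<lambda>n. ln (norm (G ((T ^^ n) p)))) \<longlonglongrightarrow> ln (norm (G (z0, z0)))"
    using G_centre
    by (intro tendsto_intros isCont_tendsto_compose[OF cdiff2_isCont[OF G_cdiff2[OF centre]] orbit[OF assms]]) auto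
  from convergent_imp_Bseq[OF convergentI[OF this]]
  obtain K where "\<forall>n. norm (ln (norm (G ((T ^^ n) p)))) \<le> K" unfolding Bseq_def by blast
  then show thesis by (intro that[of K]) simp
qed

text \<open>As \<open>ln\<close> is total, the series alone would give a positive number on orbits
  that meet a zero of \<open>G\<close>; hence the case distinction.\<close>

definition rate :: "complex \<times> complex \<Rightarrow> real" where
  "rate p = (if \<exists>k. G ((T ^^ k) p) = 0 then 0
     else exp (\<Sum>k. ln (norm (G ((T ^^ k) p))) / (sqrt 5 * phi ^ k)))"

lemma log_summable:
  assumes "p \<in> A"
  shows "summable (\<lambda>k. ln (norm (G ((T ^^ k) p))) / (sqrt 5 * phi ^ k))"
proof -
  obtain K where K: "\<And>n. \<bar>ln (norm (G ((T ^^ n) p)))\<bar> \<le> K" using log_bounded[OF assms] by blast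
  show ?thesis
  proof (rule summable_comparison_test'[where g = "\<lambda>k. K / sqrt 5 * (1 / phi) ^ k" and N = 0])
    show "summable (\<lambda>k. K / sqrt 5 * (1 / phi) ^ k)"
      using phi_gt_1 by (intro summable_mult summable_geometric) auto
    show "norm (ln (norm (G ((T ^^ k) p))) / (sqrt 5 * phi ^ k)) \<le> K / sqrt 5 * (1 / phi) ^ k" for k
      using K[of k] phi_gt_1 by (simp add: abs_mult power_divide divide_right_mono)
  qed
qed

lemma rate_nonneg: "rate p \<ge> 0"
  by (simp add: rate_def)

text \<open>If the orbit meets the line x = z0 it stays there, and the left side is eventually 0.
  The right side is 0 too: starting off both axes with \<open>G\<close> never 0 on the orbit,
  \<open>T\<close> would keep both coordinates away from z0. Otherwise all logarithms are genuine
  and the recursion lemma applies.\<close>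

lemma rate_limit:
  assumes p: "p \<in> A"
  shows "(\<lambda>n. norm (fst ((T ^^ n) p) - z0) powr (1 / phi ^ n)) \<longlonglongrightarrow>
    rate p * norm (fst p - z0) powr (phi / sqrt 5) * norm (snd p - z0) powr (1 / sqrt 5)"
proof (cases "\<exists>n. fst ((T ^^ n) p) = z0")
  case True
  then obtain n where n: "fst ((T ^^ n) p) = z0" by blast
  have "\<forall>\<^sub>F m in sequentially. norm (fst ((T ^^ m) p) - z0) powr (1 / phi ^ m) = 0"
    using axis_absorbing[OF p n] by (auto simp: eventually_sequentially)
  then have "(\<lambda>n. norm (fst ((T ^^ n) p) - z0) powr (1 / phi ^ n)) \<longlonglongrightarrow> 0"
    by (rule tendsto_eventually)
  moreover have "rate p = 0 \<or> fst p = z0 \<or> snd p = z0"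
  proof (rule ccontr)
    assume neg: "\<not> (rate p = 0 \<or> fst p = z0 \<or> snd p = z0)"
    then have Gn: "G ((T ^^ k) p) \<noteq> 0" for k unfolding rate_def by (auto split: if_splits)
    have "fst ((T ^^ k) p) \<noteq> z0 \<and> snd ((T ^^ k) p) \<noteq> z0" for k
      by (induction k) (use neg Gn in \<open>auto simp: T_eq funpow_A p\<close>)
    then show False using n by blast
  qed
  ultimately show ?thesis by auto
next
  case False
  then have x: "fst ((T ^^ n) p) \<noteq> z0" for n by blast
  have Gn: "G ((T ^^ k) p) \<noteq> 0" and y: "snd ((T ^^ k) p) \<noteq> z0" for k
    using x[of "Suc k"] T_eq[OF funpow_A[OF p, of k]] by auto
  obtain K where K: "\<And>n. \<bar>ln (norm (G ((T ^^ n) p)))\<bar> \<le> K" using log_bounded[OF p] by blast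
  define a where "a n = ln (norm (fst ((T ^^ n) p) - z0))" for n
  define c where "c n = ln (norm (snd ((T ^^ n) p) - z0))" for n
  have "(\<lambda>n. a n / phi ^ n) \<longlonglongrightarrow>
    (\<Sum>k. ln (norm (G ((T ^^ k) p))) / (sqrt 5 * phi ^ k)) + phi / sqrt 5 * a 0 + c 0 / sqrt 5"
  proof (rule weighted_recursion_limit[OF _ _ K])
    fix n
    show "a (Suc n) = ln (norm (G ((T ^^ n) p))) + a n + c n"
      using x[of n] y[of n] Gn[of n] unfolding a_def c_def
      by (simp add: T_eq funpow_A p norm_mult ln_mult)
    show "c (Suc n) = a n" unfolding a_def c_def by (simp add: T_eq funpow_A p)
  qed
  then have "(\<lambda>n. exp (a n / phi ^ n)) \<longlonglongrightarrow>
    exp ((\<Sum>k. ln (norm (G ((T ^^ k) p))) / (sqrt 5 * phi ^ k)) + phi / sqrt 5 * a 0 + c 0 / sqrt 5)"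
    by (rule tendsto_exp)
  moreover have "exp (a n / phi ^ n) = norm (fst ((T ^^ n) p) - z0) powr (1 / phi ^ n)" for n
    using x[of n] by (simp add: a_def powr_def)
  moreover have "exp ((\<Sum>k. ln (norm (G ((T ^^ k) p))) / (sqrt 5 * phi ^ k)) + phi / sqrt 5 * a 0 + c 0 / sqrt 5)
     = rate p * norm (fst p - z0) powr (phi / sqrt 5) * norm (snd p - z0) powr (1 / sqrt 5)"
    using x[of 0] y[of 0] Gn by (simp add: a_def c_def powr_def rate_def exp_add)
  ultimately show ?thesis by simp
qed

text \<open>Shifting the series: its first term gives the power of |G p|, and the rest is 1 / phi
  times the series at \<open>T p\<close>. If \<open>G\<close> vanishes on the orbit, both sides are
  0 because \<open>0 powr a = 0\<close>.\<close>

lemma rate_functional_equation: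
  assumes p: "p \<in> A"
  shows "rate p = rate (T p) powr (1 / phi) * norm (G p) powr (1 / sqrt 5)"
proof (cases "\<exists>k. G ((T ^^ k) p) = 0")
  case True
  then obtain k where k: "G ((T ^^ k) p) = 0" by blast
  have "G p = 0 \<or> (\<exists>k. G ((T ^^ k) (T p)) = 0)"
  proof (cases k)
    case 0 then show ?thesis using k by simp
  next
    case (Suc j) then show ?thesis using k by (auto simp: funpow_swap1)
  qed
  then show ?thesis using True by (auto simp: rate_def)
next
  case False
  define f where "f k = ln (norm (G ((T ^^ k) p))) / (sqrt 5 * phi ^ k)" for k
  define g where "g k = ln (norm (G ((T ^^ k) (T p)))) / (sqrt 5 * phi ^ k)" for k
  have "summable f" unfolding f_def by (rule log_summable[OF p])
  have "summable g" unfolding g_def by (rule log_summable[OF T_A[OF p]])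
  have "suminf f = f 0 + (\<Sum>k. f (Suc k))" using suminf_split_head[OF \<open>summable f\<close>] by simp
  also have "(\<lambda>k. f (Suc k)) = (\<lambda>k. g k / phi)" by (simp add: f_def g_def funpow_swap1 mult_ac)
  also have "(\<Sum>k. g k / phi) = suminf g / phi" using \<open>summable g\<close> by (rule suminf_divide)
  finally have "exp (suminf f) = exp (suminf g / phi) * exp (f 0)" by (simp add: exp_add)
  moreover have "\<not> (\<exists>k. G ((T ^^ k) (T p)) = 0)" using False by (metis comp_apply funpow_Suc_right)
  then have "rate (T p) = exp (suminf g)" by (simp add: rate_def g_def[abs_def])
  moreover have "rate p = exp (suminf f)" using False by (simp add: rate_def f_def[abs_def])
  moreover have "G p \<noteq> 0" using False by (metis funpow_0)
  ultimately show ?thesis by (simp add: powr_def f_def)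
qed

lemma local_polydisc:
  obtains r where "r > 0" "ball z0 r \<times> ball z0 r \<subseteq> A"
    "\<And>p. p \<in> ball z0 r \<times> ball z0 r \<Longrightarrow> T p \<in> ball z0 r \<times> ball z0 r"
    "\<And>p. p \<in> ball z0 r \<times> ball z0 r \<Longrightarrow> norm (G p / G (z0, z0) - 1) < 1 / 2"
proof -
  define g where "g = G (z0, z0)"
  have g: "g \<noteq> 0" using G_centre g_def by simp
  have "open (A \<inter> G -` ball g (norm g / 2))"
    using holomorphic2_on_imp_continuous_on[OF G_hol] open_A by (intro continuous_open_preimage) auto
  moreover have "(z0, z0) \<in> A \<inter> G -` ball g (norm g / 2)" using centre g by (simp add: g_def)
  ultimately obtain s where s: "s > 0" "cball z0 s \<times> cball z0 s \<subseteq> A \<inter> G -` ball g (norm g / 2)"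
    using open_contains_polydisc by metis
  \<comment> \<open>With |G| <= 2 |g| this radius gives |G p| |x - z0| <= 1, so the new first
    coordinate is no further from z0 than y was. Hence the polydisc is invariant.\<close>
  define r where "r = min s (1 / (2 * norm g))"
  have r: "r > 0" "r \<le> s" "r \<le> 1 / (2 * norm g)" using s g by (auto simp: r_def)
  have "2 * norm g * r \<le> 2 * norm g * (1 / (2 * norm g))" using r by (intro mult_left_mono) auto
  then have gr: "2 * norm g * r \<le> 1" using g by simp
  have sub: "p \<in> A" "dist g (G p) < norm g / 2" if "p \<in> ball z0 r \<times> ball z0 r" for p
  proof -
    have "p \<in> cball z0 s \<times> cball z0 s" using that r by (cases p) auto
    then show "p \<in> A" "dist g (G p) < norm g / 2" using s(2) by auto
  qed
  show thesis
  proof (rule that[OF r(1)])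
    show "ball z0 r \<times> ball z0 r \<subseteq> A" using sub by blast
    fix p assume p: "p \<in> ball z0 r \<times> ball z0 r"
    have "G p / g - 1 = (G p - g) / g" using g by (simp add: field_simps)
    then have "norm (G p / g - 1) = dist g (G p) / norm g"
      by (simp add: norm_divide dist_norm norm_minus_commute)
    then show "norm (G p / G (z0, z0) - 1) < 1 / 2"
      using sub(2)[OF p] divide_strict_right_mono[of "dist g (G p)" "norm g / 2" "norm g"] g
      unfolding g_def[symmetric] by simp
    have "norm (G p) \<le> 2 * norm g"
      using sub(2)[OF p] norm_triangle_ineq3[of "G p" g] norm_ge_zero[of g]
      by (simp only: dist_norm norm_minus_commute[of g])
    moreover have xy: "norm (fst p - z0) < r" "norm (snd p - z0) < r"
      using p by (auto simp: dist_norm norm_minus_commute)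
    ultimately have "norm (G p) * norm (fst p - z0) * norm (snd p - z0) \<le> (2 * norm g * r) * norm (snd p - z0)"
      by (intro mult_right_mono mult_mono) auto
    also have "\<dots> \<le> 1 * norm (snd p - z0)" using gr by (intro mult_right_mono) auto
    also have "\<dots> < r" using xy by simp
    finally have "norm (G p * (fst p - z0) * (snd p - z0)) < r" by (simp add: norm_mult)
    then show "T p \<in> ball z0 r \<times> ball z0 r"
      using p T_eq[OF sub(1)[OF p]] by (auto simp: dist_norm norm_minus_commute)
  qed
qed

lemma local_logarithm:
  assumes w0: "exp w0 = G (z0, z0)"
  obtains r h where "r > 0" "ball z0 r \<times> ball z0 r \<subseteq> A"
    "\<And>p. p \<in> ball z0 r \<times> ball z0 r \<Longrightarrow> T p \<in> ball z0 r \<times> ball z0 r"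
    "h holomorphic2_on ball z0 r \<times> ball z0 r"
    "\<And>p. p \<in> ball z0 r \<times> ball z0 r \<Longrightarrow> rate p = exp (Re (h p))"
    "h (z0, z0) = of_real ((5 + 3 * sqrt 5) / 10) * w0"
proof -
  obtain r where r: "r > 0" and rA: "ball z0 r \<times> ball z0 r \<subseteq> A"
    and rT: "\<And>p. p \<in> ball z0 r \<times> ball z0 r \<Longrightarrow> T p \<in> ball z0 r \<times> ball z0 r"
    and rG: "\<And>p. p \<in> ball z0 r \<times> ball z0 r \<Longrightarrow> norm (G p / G (z0, z0) - 1) < 1 / 2"
    using local_polydisc by metis
  define P where "P = ball z0 r \<times> ball z0 r"
  have P: "open P" "P \<subseteq> A" "(z0, z0) \<in> P" unfolding P_def using r rA by (auto intro: open_Times)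
  have TP: "(T ^^ n) p \<in> P" if "p \<in> P" for n p
    using that by (induction n) (use rT in \<open>auto simp: P_def\<close>)
  \<comment> \<open>Division by the central value moves \<open>G\<close> close to 1, where
    \<open>Ln\<close> is holomorphic and bounded by 1. Adding w0 then selects the branch with value
    w0 at the centre; invariance of \<open>P\<close> makes the bound uniform along orbits.\<close>
  define L where "L p = w0 + Ln (G p / G (z0, z0))" for p
  have near1: "G p / G (z0, z0) \<notin> \<real>\<^sub>\<le>\<^sub>0" "norm (Ln (G p / G (z0, z0))) \<le> 1"
    and expL: "exp (L p) = G p" and G0: "G p \<noteq> 0" if "p \<in> P" for p
  proof -
    have n: "norm (G p / G (z0, z0) - 1) < 1 / 2" using rG that by (simp add: P_def)
    have "\<bar>Re (G p / G (z0, z0) - 1)\<bar> < 1 / 2" using n abs_Re_le_cmod order_le_less_trans by blast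
    then have Rep: "Re (G p / G (z0, z0)) > 0" by (simp add: abs_if split: if_splits)
    then show nonpos: "G p / G (z0, z0) \<notin> \<real>\<^sub>\<le>\<^sub>0" by (auto simp: complex_nonpos_Reals_iff)
    show "norm (Ln (G p / G (z0, z0))) \<le> 1"
      using norm_Ln_le[of "G p / G (z0, z0) - 1"] n by simp
    show "G p \<noteq> 0" using nonpos by auto
    then show "exp (L p) = G p" using G_centre by (simp add: L_def exp_add w0)
  qed
  have Lhol: "L holomorphic2_on P"
    unfolding holomorphic2_on_cdiff2[OF P(1)] L_def
    using near1(1) P(2) G_centre
    by (intro ballI cdiff2_intros cdiff2_compose1[where k = Ln] G_cdiff2 field_differentiable_at_Ln) auto
  have LT: "(\<lambda>p. L ((T ^^ n) p)) holomorphic2_on P" for n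
  proof (induction n)
    case 0 then show ?case using Lhol by simp
  next
    case (Suc n)
    have "cdiff2 (\<lambda>p. L ((T ^^ n) (T p))) p" if "p \<in> P" for p
      using Suc[unfolded holomorphic2_on_cdiff2[OF P(1)]] TP[OF that, of 1] that P(2)
      by (intro cdiff2_T) auto
    then show ?case unfolding holomorphic2_on_cdiff2[OF P(1)] by (simp add: funpow_swap1)
  qed
  define f where "f k p = L ((T ^^ k) p) / of_real (sqrt 5 * phi ^ k)" for k p
  define M where "M k = (norm w0 + 1) / sqrt 5 * (1 / phi) ^ k" for k
  have fM: "norm (f k p) \<le> M k" if "p \<in> P" for k p
  proof -
    have "norm (L ((T ^^ k) p)) \<le> norm w0 + 1"
      unfolding L_def by (rule norm_triangle_le) (use near1(2)[OF TP[OF that, of k]] in simp)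
    then have "norm (L ((T ^^ k) p)) / (sqrt 5 * phi ^ k) \<le> (norm w0 + 1) / (sqrt 5 * phi ^ k)"
      using phi_gt_1 by (intro divide_right_mono) auto
    then show ?thesis using phi_gt_1
      by (simp add: f_def M_def norm_divide norm_mult norm_power power_divide)
  qed
  have Msum: "summable M"
    unfolding M_def using phi_gt_1 by (intro summable_mult summable_geometric) auto
  define h where "h p = (\<Sum>k. f k p)" for p
  have fsum: "summable (\<lambda>k. f k p)" if "p \<in> P" for p
    by (rule summable_comparison_test'[OF Msum]) (rule fM[OF that])
  have "h holomorphic2_on P"
  proof (rule uniform_limit_holomorphic2[OF P(1)])
    show "uniform_limit P (\<lambda>n p. \<Sum>k<n. f k p) h sequentially"
      unfolding h_def by (rule Weierstrass_m_test[OF _ Msum]) (rule fM)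
    have "cdiff2 (\<lambda>p. \<Sum>k<n. f k p) p" if "p \<in> P" for n p
    proof (induction n)
      case (Suc n)
      have "cdiff2 (f n) p"
        using LT[of n, unfolded holomorphic2_on_cdiff2[OF P(1)]] that phi_gt_1 unfolding f_def
        by (intro cdiff2_intros) auto
      then show ?case using Suc cdiff2_add by simp
    qed (simp add: cdiff2_const)
    then show "(\<lambda>p. \<Sum>k<n. f k p) holomorphic2_on P" for n
      by (simp add: holomorphic2_on_cdiff2[OF P(1)])
  qed
  moreover have "rate p = exp (Re (h p))" if "p \<in> P" for p
  proof -
    have "Re (f k p) = ln (norm (G ((T ^^ k) p))) / (sqrt 5 * phi ^ k)" for k
    proof -
      have "norm (G ((T ^^ k) p)) = exp (Re (L ((T ^^ k) p)))"
        using expL[OF TP[OF that, of k]] by (metis norm_exp_eq_Re)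
      then show ?thesis by (simp add: f_def Re_divide_of_real del: of_real_mult)
    qed
    then have "Re (h p) = (\<Sum>k. ln (norm (G ((T ^^ k) p))) / (sqrt 5 * phi ^ k))"
      unfolding h_def using bounded_linear.suminf[OF bounded_linear_Re fsum[OF that]] by simp
    then show ?thesis using G0[OF TP[OF that]] by (simp add: rate_def)
  qed
  moreover have "h (z0, z0) = of_real ((5 + 3 * sqrt 5) / 10) * w0"
  proof -
    have "(\<lambda>k. (1 / phi) ^ k) sums (1 / (1 - 1 / phi))"
      using phi_gt_1 by (intro geometric_sums) auto
    from sums_mult[OF this, of "1 / sqrt 5"]
    have "(\<lambda>k. 1 / sqrt 5 * (1 / phi) ^ k) sums ((5 + 3 * sqrt 5) / 10)"
      unfolding sqrt5_sum .
    from sums_mult2[OF sums_of_real[OF this, where ?'a = complex], of w0]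
    have "(\<lambda>k. of_real (1 / sqrt 5 * (1 / phi) ^ k) * w0) sums (of_real ((5 + 3 * sqrt 5) / 10) * w0)" .
    moreover have "(\<lambda>k. of_real (1 / sqrt 5 * (1 / phi) ^ k) * w0) = (\<lambda>k. f k (z0, z0))"
      using G_centre by (simp add: f_def L_def T_centre power_divide fun_eq_iff)
    ultimately show ?thesis unfolding h_def using sums_unique by metis
  qed
  ultimately show thesis using that[OF r rA rT] unfolding P_def by blast
qed

lemma orbit_enters:
  assumes "p \<in> A" "open P" "(z0, z0) \<in> P"
  obtains n where "(T ^^ n) p \<in> P"
  using topological_tendstoD[OF orbit[OF assms(1)] assms(2,3)] unfolding eventually_sequentially by blast

text \<open>Induction on the time at which the orbit enters the polydisc: a property that holds
  where the rate is exp (Re h) and passes from \<open>T p\<close> back to \<open>p\<close> holds on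
  all of \<open>A\<close>.\<close>

lemma rate_local_induct [consumes 1, case_names local pullback]:
  assumes p: "p \<in> A"
    and loc: "\<And>r h p. r > 0 \<Longrightarrow> ball z0 r \<times> ball z0 r \<subseteq> A \<Longrightarrow> h holomorphic2_on ball z0 r \<times> ball z0 r \<Longrightarrow>
      (\<And>p. p \<in> ball z0 r \<times> ball z0 r \<Longrightarrow> rate p = exp (Re (h p))) \<Longrightarrow> p \<in> ball z0 r \<times> ball z0 r \<Longrightarrow> Q p"
    and pull: "\<And>p. p \<in> A \<Longrightarrow> Q (T p) \<Longrightarrow> Q p"
  shows "Q p"
proof -
  obtain w0 where "exp w0 = G (z0, z0)" using G_centre exp_Ln by blast
  then obtain r h where rh: "r > 0" "ball z0 r \<times> ball z0 r \<subseteq> A"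
    "h holomorphic2_on ball z0 r \<times> ball z0 r"
    "\<And>p. p \<in> ball z0 r \<times> ball z0 r \<Longrightarrow> rate p = exp (Re (h p))"
    using local_logarithm by metis
  obtain n where "(T ^^ n) p \<in> ball z0 r \<times> ball z0 r"
    using orbit_enters[OF p, of "ball z0 r \<times> ball z0 r"] rh(1) by (auto intro: open_Times)
  then show ?thesis using p
  proof (induction n arbitrary: p)
    case 0 then show ?case using loc[OF rh] by simp
  next
    case (Suc n) then show ?case using pull T_A by (simp add: funpow_swap1)
  qed
qed

lemma rate_continuous: "continuous_on A rate"
proof (intro continuous_at_imp_continuous_on ballI)
  fix p assume "p \<in> A"
  then show "isCont rate p"
  proof (induction rule: rate_local_induct)
    case (local r h p)
    have o: "open (ball z0 r \<times> ball z0 r)" by (intro open_Times open_ball)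
    have "isCont h p"
      using local(3,5) by (auto simp: holomorphic2_on_cdiff2[OF o] cdiff2_isCont)
    then have "isCont (\<lambda>q. exp (Re (h q))) p"
      unfolding isCont_def by (intro tendsto_intros)
    then show ?case
      by (rule isCont_cong[THEN iffD1, rotated])
        (use eventually_nhds_in_open[OF o local(5)] in \<open>auto elim!: eventually_mono simp: local(4)\<close>)
  next
    case (pullback p)
    have "isCont (\<lambda>q. rate (T q)) p"
      using isCont_o2[OF isCont_T[OF pullback(1)] pullback(2)] .
    \<comment> \<open>The bases may vanish at p; \<open>tendsto_powr2\<close> covers this case, as
      the bases are nonnegative and the exponents positive.\<close>
    then have "isCont (\<lambda>q. rate (T q) powr (1 / phi) * norm (G q) powr (1 / sqrt 5)) p"
      using cdiff2_isCont[OF G_cdiff2[OF pullback(1)]] phi_gt_1 unfolding isCont_def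
      by (intro tendsto_mult tendsto_powr2 tendsto_norm tendsto_const) (auto simp: rate_nonneg)
    then show ?case
      by (rule isCont_cong[THEN iffD1, rotated])
        (use eventually_nhds_in_open[OF open_A pullback(1)] in
          \<open>auto elim!: eventually_mono simp: rate_functional_equation[symmetric]\<close>)
  qed
qed

text \<open>By the functional equation a nonzero rate at p forces a nonzero rate at
  \<open>T p\<close> and G p \<noteq> 0, so the representation, unlike the bare nonvanishing of the
  series, can be pulled back step by step.\<close>

lemma rate_local_logarithm:
  assumes "p \<in> A" "rate p \<noteq> 0"
  shows "\<exists>N h. open N \<and> p \<in> N \<and> h holomorphic2_on N \<and> (\<forall>q\<in>N. rate q = exp (Re (h q)))"
  using assms
proof (induction rule: rate_local_induct)
  case (local r h p)
  then show ?case by (intro exI[of _ "ball z0 r \<times> ball z0 r"] exI[of _ h]) (auto intro: open_Times)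
next
  case (pullback p)
  have "rate (T p) \<noteq> 0" and G0: "G p \<noteq> 0"
    using pullback rate_functional_equation[OF pullback(1)] by auto
  then obtain N h where N: "open N" "T p \<in> N" "h holomorphic2_on N" "\<And>q. q \<in> N \<Longrightarrow> rate q = exp (Re (h q))"
    using pullback by blast
  \<comment> \<open>The radius |G p| makes G q / G p lie in the unit disc around 1, hence in the
    right half plane, where \<open>Ln\<close> is holomorphic.\<close>
  define N' where "N' = (A \<inter> T -` N) \<inter> (A \<inter> G -` ball (G p) (norm (G p)))"
  have "continuous_on A T" using isCont_T by (simp add: continuous_at_imp_continuous_on)
  then have N': "open N'" "p \<in> N'"
    unfolding N'_def using pullback(1) N G0 open_A holomorphic2_on_imp_continuous_on[OF G_hol]
    by (auto intro!: continuous_open_preimage)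
  \<comment> \<open>Only the real part matters, so no branch of the logarithm of \<open>G\<close>
    itself is needed: the real constant ln |G p| undoes the normalisation.\<close>
  define h' where "h' q = h (T q) / of_real phi + (Ln (G q / G p) + of_real (ln (norm (G p)))) / of_real (sqrt 5)" for q
  have nonpos: "G q / G p \<notin> \<real>\<^sub>\<le>\<^sub>0" and Gq0: "G q \<noteq> 0" if "q \<in> N'" for q
  proof -
    have "norm (G q / G p - 1) = dist (G p) (G q) / norm (G p)"
      using G0 by (simp add: dist_norm norm_minus_commute diff_divide_distrib flip: norm_divide)
    also have "\<dots> < 1" using that G0 by (simp add: N'_def)
    finally have "\<bar>Re (G q / G p - 1)\<bar> < 1" using abs_Re_le_cmod order_le_less_trans by blast
    then have "Re (G q / G p) > 0" by (simp add: abs_if split: if_splits)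
    then show "G q / G p \<notin> \<real>\<^sub>\<le>\<^sub>0" by (auto simp: complex_nonpos_Reals_iff)
    then show "G q \<noteq> 0" by auto
  qed
  have "cdiff2 h' q" if "q \<in> N'" for q
    unfolding h'_def using that N(3) G0 nonpos phi_gt_1
    by (intro cdiff2_intros cdiff2_T cdiff2_compose1[where k = Ln] G_cdiff2 field_differentiable_at_Ln)
      (auto simp: N'_def holomorphic2_on_cdiff2[OF N(1)])
  moreover have "rate q = exp (Re (h' q))" if q: "q \<in> N'" for q
  proof -
    have "Re (h' q) = Re (h (T q)) / phi + ln (norm (G q)) / sqrt 5"
      using G0 Gq0[OF q] unfolding h'_def by (simp add: Re_divide_of_real norm_divide ln_div)
    moreover have "rate q = rate (T q) powr (1 / phi) * norm (G q) powr (1 / sqrt 5)"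
      using q by (intro rate_functional_equation) (auto simp: N'_def)
    moreover have "rate (T q) = exp (Re (h (T q)))" using q N by (auto simp: N'_def)
    ultimately show ?thesis using Gq0[OF q] by (simp add: powr_def exp_add)
  qed
  ultimately show ?case using N' holomorphic2_on_cdiff2[OF N'(1)] by (intro exI[of _ N'] exI[of _ h']) auto
qed

end

section \<open>The secant map\<close>

text \<open>Agreement at one point of every neighbourhood is enough, since a nonzero difference at p
  would persist nearby. This form also serves for density along a single line.\<close>

lemma eq_by_density:
  fixes g1 g2 :: "'a :: t2_space \<Rightarrow> 'b :: real_normed_vector"
  assumes "isCont g1 p" "isCont g2 p" and dense: "\<And>N. open N \<Longrightarrow> p \<in> N \<Longrightarrow> \<exists>q\<in>N. g1 q = g2 q"
  shows "g1 p = g2 p"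
proof (rule ccontr)
  assume "g1 p \<noteq> g2 p"
  have "((\<lambda>q. g1 q - g2 q) \<longlongrightarrow> g1 p - g2 p) (nhds p)"
    using assms(1,2) unfolding isCont_def tendsto_at_iff_tendsto_nhds by (rule tendsto_diff)
  then have "\<forall>\<^sub>F q in nhds p. g1 q - g2 q \<noteq> 0"
    using \<open>g1 p \<noteq> g2 p\<close> by (intro tendsto_imp_eventually_ne) auto
  then show False using dense unfolding eventually_nhds by force
qed

lemma exists_off_axes:
  fixes p :: "complex \<times> complex"
  assumes "open N" "p \<in> N"
  shows "\<exists>q\<in>N. fst q \<noteq> z \<and> snd q \<noteq> z"
proof -
  obtain a b where p: "p = (a, b)" by force
  obtain r where r: "r > 0" "cball a r \<times> cball b r \<subseteq> N"
    using open_contains_polydisc[OF assms(1)] assms(2) p by metis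
  have off: "\<exists>x\<in>cball a r. x \<noteq> z" for a :: complex
  proof (cases "a = z")
    case True then show ?thesis using r(1) by (intro bexI[of _ "a + of_real r"]) (auto simp: dist_norm)
  qed (use r(1) in auto)
  obtain x where "x \<in> cball a r" "x \<noteq> z" using off[of a] by blast
  moreover obtain y where "y \<in> cball b r" "y \<noteq> z" using off[of b] by blast
  ultimately show ?thesis using r(2) by (intro bexI[of _ "(x, y)"]) auto
qed

section \<open>Maps into the Riemann sphere\<close>

lemma sphere_holomorphic2_on_subset:
  assumes "h sphere_holomorphic2_on W" "open V" "V \<subseteq> W"
  shows "h sphere_holomorphic2_on V"
  unfolding sphere_holomorphic2_on_def
proof
  fix p assume p: "p \<in> V"
  then have "p \<in> W" using assms(3) by blast
  from bspec[OF assms(1)[unfolded sphere_holomorphic2_on_def] this]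
  obtain N where N: "open N" "p \<in> N"
    "Infty \<notin> h ` N \<and> (aff \<circ> h) holomorphic2_on N \<or> Fin 0 \<notin> h ` N \<and> (coaff \<circ> h) holomorphic2_on N"
    by (elim exE conjE)
  have s: "N \<inter> V \<subseteq> N" by blast
  have "Infty \<notin> h ` (N \<inter> V) \<and> (aff \<circ> h) holomorphic2_on (N \<inter> V) \<or>
      Fin 0 \<notin> h ` (N \<inter> V) \<and> (coaff \<circ> h) holomorphic2_on (N \<inter> V)"
    using N(3)
  proof (elim disjE conjE)
    assume "Infty \<notin> h ` N" "(aff \<circ> h) holomorphic2_on N"
    then show ?thesis using holomorphic2_on_subset[OF _ s, of "aff \<circ> h"] by (intro disjI1 conjI) auto
  next
    assume "Fin 0 \<notin> h ` N" "(coaff \<circ> h) holomorphic2_on N"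
    then show ?thesis using holomorphic2_on_subset[OF _ s, of "coaff \<circ> h"] by (intro disjI2 conjI) auto
  qed
  then show "\<exists>N. open N \<and> p \<in> N \<and> N \<subseteq> V \<and>
      (Infty \<notin> h ` N \<and> (aff \<circ> h) holomorphic2_on N \<or> Fin 0 \<notin> h ` N \<and> (coaff \<circ> h) holomorphic2_on N)"
    by (intro exI[of _ "N \<inter> V"] conjI) (use N(1,2) p assms(2) in \<open>auto intro: open_Int\<close>)
qed

lemma inverse_coaff: "h \<noteq> Infty \<Longrightarrow> inverse (coaff h) = aff h"
  by (cases h) auto

lemma inverse_aff: "h \<noteq> Infty \<Longrightarrow> inverse (aff h) = coaff h"
  by (cases h) auto

text \<open>The definition chooses the chart, whereas here the value at p prescribes it. If the
  chosen one is \<open>coaff\<close>, its value at p is not 0; on the open set where this persists,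
  inversion gives \<open>aff\<close>.\<close>

lemma sphere_aff_chart:
  assumes "h sphere_holomorphic2_on W" "p \<in> W" "h p \<noteq> Infty"
  obtains N where "open N" "p \<in> N" "N \<subseteq> W" "Infty \<notin> h ` N" "(aff \<circ> h) holomorphic2_on N"
proof -
  from bspec[OF assms(1)[unfolded sphere_holomorphic2_on_def] assms(2)]
  obtain N where N: "open N" "p \<in> N" "N \<subseteq> W"
    "Infty \<notin> h ` N \<and> (aff \<circ> h) holomorphic2_on N \<or> Fin 0 \<notin> h ` N \<and> (coaff \<circ> h) holomorphic2_on N"
    by (elim exE conjE)
  show thesis
  proof (cases "Infty \<notin> h ` N \<and> (aff \<circ> h) holomorphic2_on N")
    case True then show ?thesis using that N by blast
  next
    case False
    then have c: "Fin 0 \<notin> h ` N" "(coaff \<circ> h) holomorphic2_on N" using N(4) by blast+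
    define N' where "N' = N \<inter> (coaff \<circ> h) -` (- {0})"
    have N': "open N'" unfolding N'_def
      by (intro continuous_open_preimage holomorphic2_on_imp_continuous_on[OF c(2)] N(1)) auto
    have "h p \<noteq> Fin 0" using c(1) N(2) by (metis imageI)
    then have "coaff (h p) \<noteq> 0" using assms(3) by (cases "h p") auto
    then have pN': "p \<in> N'" using N(2) by (simp add: N'_def)
    have ni: "h q \<noteq> Infty" "coaff (h q) \<noteq> 0" if "q \<in> N'" for q
      using that by (auto simp: N'_def)
    have "cdiff2 (aff \<circ> h) q" if q: "q \<in> N'" for q
    proof (rule cdiff2_transform[OF _ N' q])
      show "cdiff2 (\<lambda>q. inverse ((coaff \<circ> h) q)) q"
        using c(2) q ni(2)[OF q] by (intro cdiff2_inverse) (auto simp: holomorphic2_on_cdiff2[OF N(1)] N'_def o_def)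
    qed (simp add: ni inverse_coaff)
    then have "(aff \<circ> h) holomorphic2_on N'" using holomorphic2_on_cdiff2[OF N'] by blast
    moreover have "N' \<subseteq> W" using N(3) by (auto simp: N'_def)
    moreover have "Infty \<notin> h ` N'" using ni(1) by force
    ultimately show ?thesis by (intro that[OF N' pN'])
  qed
qed

lemma sphere_coaff_chart:
  assumes "h sphere_holomorphic2_on W" "p \<in> W" "h p \<noteq> Fin 0"
  obtains N where "open N" "p \<in> N" "N \<subseteq> W" "Fin 0 \<notin> h ` N" "(coaff \<circ> h) holomorphic2_on N"
proof -
  from bspec[OF assms(1)[unfolded sphere_holomorphic2_on_def] assms(2)]
  obtain N where N: "open N" "p \<in> N" "N \<subseteq> W"
    "Infty \<notin> h ` N \<and> (aff \<circ> h) holomorphic2_on N \<or> Fin 0 \<notin> h ` N \<and> (coaff \<circ> h) holomorphic2_on N"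
    by (elim exE conjE)
  show thesis
  proof (cases "Fin 0 \<notin> h ` N \<and> (coaff \<circ> h) holomorphic2_on N")
    case True then show ?thesis using that N by blast
  next
    case False
    then have c: "Infty \<notin> h ` N" "(aff \<circ> h) holomorphic2_on N" using N(4) by blast+
    define N' where "N' = N \<inter> (aff \<circ> h) -` (- {0})"
    have N': "open N'" unfolding N'_def
      by (intro continuous_open_preimage holomorphic2_on_imp_continuous_on[OF c(2)] N(1)) auto
    have "h p \<noteq> Infty" using c(1) N(2) by (metis imageI)
    then have "aff (h p) \<noteq> 0" using assms(3) by (cases "h p") auto
    then have pN': "p \<in> N'" using N(2) by (simp add: N'_def)
    have ni: "h q \<noteq> Infty" "aff (h q) \<noteq> 0" "h q \<noteq> Fin 0" if "q \<in> N'" for q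
      using that by (auto simp: N'_def)
    have "cdiff2 (coaff \<circ> h) q" if q: "q \<in> N'" for q
    proof (rule cdiff2_transform[OF _ N' q])
      show "cdiff2 (\<lambda>q. inverse ((aff \<circ> h) q)) q"
        using c(2) q ni(2)[OF q] by (intro cdiff2_inverse) (auto simp: holomorphic2_on_cdiff2[OF N(1)] N'_def o_def)
    qed (simp add: ni inverse_aff)
    then have "(coaff \<circ> h) holomorphic2_on N'" using holomorphic2_on_cdiff2[OF N'] by blast
    moreover have "N' \<subseteq> W" using N(3) by (auto simp: N'_def)
    moreover have "Fin 0 \<notin> h ` N'" using ni(3) by force
    ultimately show ?thesis by (intro that[OF N' pN'])
  qed
qed

text \<open>Together with the next lemma this separates \<open>Fin 0\<close> from
  \<open>Infty\<close>, the only pair of values that no standard chart contains.\<close>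

lemma sphere_chart_at_zero:
  assumes "h sphere_holomorphic2_on W" "p \<in> W" "h p = Fin 0"
  obtains N where "open N" "p \<in> N" "\<And>q. q \<in> N \<Longrightarrow> \<exists>z. h q = Fin z \<and> norm z < 1"
proof -
  obtain N where N: "open N" "p \<in> N" "N \<subseteq> W" "Infty \<notin> h ` N" "(aff \<circ> h) holomorphic2_on N"
    using sphere_aff_chart[OF assms(1,2)] assms(3) by auto
  show thesis
  proof (rule that)
    show "open (N \<inter> (aff \<circ> h) -` ball 0 1)"
      by (intro continuous_open_preimage holomorphic2_on_imp_continuous_on[OF N(5)] N(1)) auto
    show "\<exists>z. h q = Fin z \<and> norm z < 1" if "q \<in> N \<inter> (aff \<circ> h) -` ball 0 1" for q
      using that N(4) by (cases "h q") (auto simp: image_iff)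
  qed (use N(2) assms(3) in auto)
qed

lemma sphere_chart_at_infinity:
  assumes "h sphere_holomorphic2_on W" "p \<in> W" "h p = Infty"
  obtains N where "open N" "p \<in> N" "\<And>q z. q \<in> N \<Longrightarrow> h q = Fin z \<Longrightarrow> norm z > 1"
proof -
  obtain N where N: "open N" "p \<in> N" "N \<subseteq> W" "Fin 0 \<notin> h ` N" "(coaff \<circ> h) holomorphic2_on N"
    using sphere_coaff_chart[OF assms(1,2)] assms(3) by auto
  show thesis
  proof (rule that)
    show "open (N \<inter> (coaff \<circ> h) -` ball 0 1)"
      by (intro continuous_open_preimage holomorphic2_on_imp_continuous_on[OF N(5)] N(1)) auto
    show "norm z > 1" if q: "q \<in> N \<inter> (coaff \<circ> h) -` ball 0 1" "h q = Fin z" for q z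
    proof -
      have "z \<noteq> 0" using N(4) q by (metis IntD1 imageI)
      moreover have "inverse (norm z) < 1" using q by (auto simp: norm_inverse)
      ultimately show ?thesis using one_less_inverse[of "inverse (norm z)"] by simp
    qed
  qed (use N(2) assms(3) in auto)
qed

text \<open>If one chart contains both values, \<open>eq_by_density\<close> applies in it. Otherwise
  the values are \<open>Fin 0\<close> and \<open>Infty\<close>, and a nearby common value would have
  modulus both below and above 1.\<close>

lemma sphere_eq_by_density:
  assumes h: "h1 sphere_holomorphic2_on W" "h2 sphere_holomorphic2_on W" and p: "p \<in> W"
    and dense: "\<And>N. open N \<Longrightarrow> p \<in> N \<Longrightarrow> \<exists>q\<in>N. h1 q = h2 q"
  shows "h1 p = h2 p"
proof -
  have mixed: False if k: "k1 sphere_holomorphic2_on W" "k2 sphere_holomorphic2_on W" "k1 p = Fin 0" "k2 p = Infty"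
    "\<And>N. open N \<Longrightarrow> p \<in> N \<Longrightarrow> \<exists>q\<in>N. k1 q = k2 q" for k1 k2
  proof -
    obtain N1 where N1: "open N1" "p \<in> N1" "\<And>q. q \<in> N1 \<Longrightarrow> \<exists>z. k1 q = Fin z \<and> norm z < 1"
      using sphere_chart_at_zero[OF k(1) p k(3)] by blast
    obtain N2 where N2: "open N2" "p \<in> N2" "\<And>q z. q \<in> N2 \<Longrightarrow> k2 q = Fin z \<Longrightarrow> norm z > 1"
      using sphere_chart_at_infinity[OF k(2) p k(4)] by blast
    obtain q where "q \<in> N1 \<inter> N2" "k1 q = k2 q"
      using k(5)[OF open_Int[OF N1(1) N2(1)]] N1(2) N2(2) by blast
    then show False using N1(3)[of q] N2(3)[of q] by force
  qed
  consider "h1 p \<noteq> Infty" "h2 p \<noteq> Infty" | "h1 p \<noteq> Fin 0" "h2 p \<noteq> Fin 0"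
    | "h1 p = Fin 0" "h2 p = Infty" | "h2 p = Fin 0" "h1 p = Infty"
    by (metis riemann_sphere.distinct(1))
  then show ?thesis
  proof cases
    case 1
    obtain N1 where N1: "open N1" "p \<in> N1" "(aff \<circ> h1) holomorphic2_on N1"
      using sphere_aff_chart[OF h(1) p 1(1)] by metis
    obtain N2 where N2: "open N2" "p \<in> N2" "(aff \<circ> h2) holomorphic2_on N2"
      using sphere_aff_chart[OF h(2) p 1(2)] by metis
    have "(aff \<circ> h1) p = (aff \<circ> h2) p"
    proof (rule eq_by_density[where ?g1.0 = "aff \<circ> h1" and ?g2.0 = "aff \<circ> h2"])
      show "isCont (aff \<circ> h1) p" "isCont (aff \<circ> h2) p"
        using N1 N2 holomorphic2_on_cdiff2 cdiff2_isCont by blast+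
      show "\<exists>q\<in>N. (aff \<circ> h1) q = (aff \<circ> h2) q" if "open N" "p \<in> N" for N
        using dense[OF that] by (metis comp_apply)
    qed
    then show ?thesis using 1 by (cases "h1 p"; cases "h2 p") auto
  next
    case 2
    obtain N1 where N1: "open N1" "p \<in> N1" "(coaff \<circ> h1) holomorphic2_on N1"
      using sphere_coaff_chart[OF h(1) p 2(1)] by metis
    obtain N2 where N2: "open N2" "p \<in> N2" "(coaff \<circ> h2) holomorphic2_on N2"
      using sphere_coaff_chart[OF h(2) p 2(2)] by metis
    have "(coaff \<circ> h1) p = (coaff \<circ> h2) p"
    proof (rule eq_by_density[where ?g1.0 = "coaff \<circ> h1" and ?g2.0 = "coaff \<circ> h2"])
      show "isCont (coaff \<circ> h1) p" "isCont (coaff \<circ> h2) p"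
        using N1 N2 holomorphic2_on_cdiff2 cdiff2_isCont by blast+
      show "\<exists>q\<in>N. (coaff \<circ> h1) q = (coaff \<circ> h2) q" if "open N" "p \<in> N" for N
        using dense[OF that] by (metis comp_apply)
    qed
    then show ?thesis using 2 by (cases "h1 p"; cases "h2 p") auto
  next
    case 3
    then show ?thesis using mixed[OF h 3 dense] by blast
  next
    case 4
    then show ?thesis using mixed[OF h(2,1) 4] dense by metis
  qed
qed

lemma sphere_holomorphic2_Fin:
  assumes "open W" "k holomorphic2_on W" "\<And>q. q \<in> W \<Longrightarrow> h q = Fin (k q)"
  shows "h sphere_holomorphic2_on W"
  unfolding sphere_holomorphic2_on_def
proof (intro ballI exI conjI disjI1)
  have "cdiff2 (aff \<circ> h) q" if "q \<in> W" for q
    by (rule cdiff2_transform[of k q W])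
      (use assms that in \<open>auto simp: holomorphic2_on_cdiff2[OF assms(1)]\<close>)
  then show "(aff \<circ> h) holomorphic2_on W" by (simp add: holomorphic2_on_cdiff2[OF assms(1)])
qed (use assms in auto)

lemma to_C2_of_C2 [simp]: "to_C2 (of_C2 p) = p"
  by (cases p) (simp add: to_C2_def of_C2_def)

lemma inj_of_C2: "of_C2 p = of_C2 q \<longleftrightarrow> p = q"
  by (metis to_C2_of_C2)

section \<open>Evaluating the secant map on its domain\<close>

locale secant_setting =
  fixes U :: "complex set" and f :: "complex \<Rightarrow> complex"
  assumes open_U: "open U" and connected_U: "connected U" and mero: "f nicely_meromorphic_on U"
    and nonconst: "\<not> f constant_on U"
begin

lemma eventually_regular_value:
  assumes "z \<in> U"
  shows "\<forall>\<^sub>F w in at z. w \<in> U \<and> \<not> is_pole f w \<and> f w \<noteq> c"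
proof -
  have "\<forall>\<^sub>\<approx>x\<in>U. f x \<noteq> c"
    using nicely_meromorphic_imp_constant_or_avoid[OF mero open_U connected_U, of c] nonconst
    unfolding constant_on_def by blast
  moreover have "\<forall>\<^sub>\<approx>x\<in>U. \<not> is_pole f x"
    using mero meromorphic_on_imp_not_pole_cosparse unfolding nicely_meromorphic_on_def by blast
  ultimately have "\<forall>\<^sub>F w in at z. f w \<noteq> c" "\<forall>\<^sub>F w in at z. \<not> is_pole f w"
    using assms open_U by (auto simp: eventually_cosparse_open_eq)
  then show ?thesis using eventually_at_in_open'[OF open_U assms] by eventually_elim auto
qed

lemma exists_regular_value:
  assumes "z \<in> U" "open N" "z \<in> N"
  shows "\<exists>w\<in>N. w \<in> U \<and> \<not> is_pole f w \<and> f w \<noteq> c"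
proof -
  have "\<forall>\<^sub>F w in at z. w \<in> N \<and> w \<in> U \<and> \<not> is_pole f w \<and> f w \<noteq> c"
    using eventually_regular_value[OF assms(1)] eventually_at_in_open'[OF assms(2,3)]
    by eventually_elim auto
  then show ?thesis using eventually_happens[of _ "at z"] by fastforce
qed

text \<open>y is chosen first and x afterwards, so that it avoids the value \<open>f y\<close>; this
  works because a nonconstant meromorphic function on a connected set is nowhere locally
  constant.\<close>

lemma secant_regular_dense:
  assumes "open N" "p \<in> N" "p \<in> U \<times> U"
  shows "\<exists>q\<in>N. q \<in> secant_regular U f"
proof -
  obtain a b where p: "p = (a, b)" by force
  obtain r where r: "r > 0" "cball a r \<times> cball b r \<subseteq> N"
    using open_contains_polydisc[OF assms(1)] assms(2) p by metis
  obtain y where y: "y \<in> ball b r" "y \<in> U" "\<not> is_pole f y"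
    using exists_regular_value[of b "ball b r" 0] assms(3) p r by force
  obtain x where x: "x \<in> ball a r" "x \<in> U" "\<not> is_pole f x" "f x \<noteq> f y"
    using exists_regular_value[of a "ball a r" "f y"] assms(3) p r by force
  then have "(x, y) \<in> N" using y r(2) by auto
  then show ?thesis using x y by (auto simp: secant_regular_def)
qed

lemma secant_extensionD:
  assumes "secant_extension U f W h"
  shows "open W" "W \<subseteq> U \<times> U" "(fst \<circ> h) sphere_holomorphic2_on W" "(snd \<circ> h) sphere_holomorphic2_on W"
    "q \<in> W \<Longrightarrow> q \<in> secant_regular U f \<Longrightarrow>
      h q = of_C2 ((f (fst q) * snd q - f (snd q) * fst q) / (f (fst q) - f (snd q)), fst q)"
  using assms unfolding secant_extension_def by (simp, simp, simp, simp, force)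

lemma secant_extension_unique:
  assumes e: "secant_extension U f W h" "secant_extension U f W' h'" and p: "p \<in> W" "p \<in> W'"
  shows "h p = h' p"
proof -
  note e1 = secant_extensionD[OF e(1)] and e2 = secant_extensionD[OF e(2)]
  have o: "open (W \<inter> W')" using e1(1) e2(1) by (rule open_Int)
  have d: "\<exists>q\<in>N. h q = h' q" if N: "open N" "p \<in> N" for N
  proof -
    have "\<exists>q\<in>N \<inter> (W \<inter> W'). q \<in> secant_regular U f"
      by (rule secant_regular_dense[of _ p]) (use N o e1(2) p in \<open>auto intro: open_Int\<close>)
    then obtain q where q: "q \<in> N" "q \<in> W" "q \<in> W'" "q \<in> secant_regular U f" by blast
    then have "h q = h' q" by (simp only: e1(5) e2(5))
    then show ?thesis using q(1) by blast
  qed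
  have "(fst \<circ> h) p = (fst \<circ> h') p"
  proof (rule sphere_eq_by_density[of _ "W \<inter> W'"])
    show "\<exists>q\<in>N. (fst \<circ> h) q = (fst \<circ> h') q" if "open N" "p \<in> N" for N
      using d[OF that] by (metis comp_apply)
    show "(fst \<circ> h) sphere_holomorphic2_on W \<inter> W'" "(fst \<circ> h') sphere_holomorphic2_on W \<inter> W'"
      by (rule sphere_holomorphic2_on_subset[OF e1(3) o], blast)
        (rule sphere_holomorphic2_on_subset[OF e2(3) o], blast)
  qed (use p in blast)
  moreover have "(snd \<circ> h) p = (snd \<circ> h') p"
  proof (rule sphere_eq_by_density[of _ "W \<inter> W'"])
    show "\<exists>q\<in>N. (snd \<circ> h) q = (snd \<circ> h') q" if "open N" "p \<in> N" for N
      using d[OF that] by (metis comp_apply)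
    show "(snd \<circ> h) sphere_holomorphic2_on W \<inter> W'" "(snd \<circ> h') sphere_holomorphic2_on W \<inter> W'"
      by (rule sphere_holomorphic2_on_subset[OF e1(4) o], blast)
        (rule sphere_holomorphic2_on_subset[OF e2(4) o], blast)
  qed (use p in blast)
  ultimately show ?thesis by (simp add: prod_eq_iff)
qed

lemma secant_map_eq:
  assumes "secant_extension U f W h" "p \<in> W"
  shows "secant_map U f p = h p"
  unfolding secant_map_def
proof (rule the_equality)
  show "\<exists>W h'. p \<in> W \<and> secant_extension U f W h' \<and> h' p = h p" using assms by blast
qed (use assms secant_extension_unique in blast)

lemma secant_dom_subset: "secant_dom U f \<subseteq> U \<times> U"
  by (auto simp: secant_dom_def secant_extension_def)

lemma snd_secant_map:
  assumes "p \<in> secant_dom U f"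
  shows "snd (secant_map U f p) = Fin (fst p)"
proof -
  obtain W h where Wh: "p \<in> W" "secant_extension U f W h" using assms by (auto simp: secant_dom_def)
  note o = secant_extensionD(1,2)[OF Wh(2)]
  have "(snd \<circ> h) p = (Fin \<circ> fst) p"
  proof (rule sphere_eq_by_density[of _ W])
    show "(Fin \<circ> fst) sphere_holomorphic2_on W"
      by (rule sphere_holomorphic2_Fin[OF o(1), of fst]) (auto simp: holomorphic2_on_cdiff2[OF o(1)] cdiff2_fst)
    show "\<exists>q\<in>N. (snd \<circ> h) q = (Fin \<circ> fst) q" if N: "open N" "p \<in> N" for N
    proof -
      have "\<exists>q\<in>N \<inter> W. q \<in> secant_regular U f"
        by (rule secant_regular_dense[of _ p]) (use N o Wh in \<open>auto intro: open_Int\<close>)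
      then obtain q where q: "q \<in> N" "q \<in> W" "q \<in> secant_regular U f" by blast
      have "(snd \<circ> h) q = (Fin \<circ> fst) q" by (simp add: secant_extensionD(5)[OF Wh(2) q(2,3)] of_C2_def)
      then show ?thesis using q(1) by blast
    qed
  qed (fact Wh(1) secant_extensionD(4)[OF Wh(2)])+
  then show ?thesis using secant_map_eq[OF Wh(2,1)] by simp
qed

definition T :: "complex \<times> complex \<Rightarrow> complex \<times> complex" where
  "T p = to_C2 (secant_map U f p)"

text \<open>Where the first coordinate is \<open>Infty\<close>, \<open>to_C2\<close> returns a junk
  value; on this set \<open>T\<close> is the true secant map. Orbits in the basin never leave
  it.\<close>

definition finite_dom :: "(complex \<times> complex) set" where
  "finite_dom = {p \<in> secant_dom U f. fst (secant_map U f p) \<noteq> Infty}"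

lemma secant_map_finite_dom:
  assumes "p \<in> finite_dom"
  shows "secant_map U f p = of_C2 (T p)" "snd (T p) = fst p"
proof -
  obtain z where "fst (secant_map U f p) = Fin z"
    using assms by (cases "fst (secant_map U f p)") (auto simp: finite_dom_def)
  moreover have "snd (secant_map U f p) = Fin (fst p)"
    using assms snd_secant_map by (simp add: finite_dom_def)
  ultimately have "secant_map U f p = (Fin z, Fin (fst p))" by (simp add: prod_eq_iff)
  then show "secant_map U f p = of_C2 (T p)" "snd (T p) = fst p"
    by (auto simp: T_def to_C2_def of_C2_def)
qed

lemma finite_dom_chart:
  assumes "p \<in> finite_dom"
  obtains N where "open N" "p \<in> N" "N \<subseteq> finite_dom" "(\<lambda>q. fst (T q)) holomorphic2_on N"
proof -
  obtain W h where Wh: "p \<in> W" "secant_extension U f W h"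
    using assms by (auto simp: finite_dom_def secant_dom_def)
  have eq: "secant_map U f q = h q" if "q \<in> W" for q using secant_map_eq[OF Wh(2) that] .
  have "(fst \<circ> h) sphere_holomorphic2_on W" "(fst \<circ> h) p \<noteq> Infty"
    using secant_extensionD(3)[OF Wh(2)] assms eq[OF Wh(1)] by (auto simp: finite_dom_def)
  then obtain N where N: "open N" "p \<in> N" "N \<subseteq> W" "Infty \<notin> (fst \<circ> h) ` N" "(aff \<circ> (fst \<circ> h)) holomorphic2_on N"
    by (rule sphere_aff_chart[OF _ Wh(1)])
  show thesis
  proof (rule that[OF N(1,2)])
    show "N \<subseteq> finite_dom"
    proof
      fix q assume q: "q \<in> N"
      then have "q \<in> W" using N(3) by blast
      moreover have "fst (h q) \<noteq> Infty" using q N(4) by (metis comp_apply imageI)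
      ultimately show "q \<in> finite_dom"
        using Wh(2) eq[of q] unfolding finite_dom_def secant_dom_def by auto
    qed
    have "cdiff2 (\<lambda>q. fst (T q)) q" if "q \<in> N" for q
    proof (rule cdiff2_transform[OF _ N(1) that])
      show "cdiff2 (aff \<circ> (fst \<circ> h)) q" using N(5) that by (simp add: holomorphic2_on_cdiff2[OF N(1)])
    qed (use N eq in \<open>auto simp: T_def to_C2_def\<close>)
    then show "(\<lambda>q. fst (T q)) holomorphic2_on N" by (simp add: holomorphic2_on_cdiff2[OF N(1)])
  qed
qed

lemma open_finite_dom: "open finite_dom"
  unfolding open_subopen[of finite_dom] using finite_dom_chart by metis

lemma T_cdiff2: "p \<in> finite_dom \<Longrightarrow> cdiff2 (\<lambda>q. fst (T q)) p"
  using finite_dom_chart holomorphic2_on_cdiff2 by metis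

lemma isCont_T: 
  assumes "p \<in> finite_dom"
  shows "isCont T p"
proof -
  have "isCont (\<lambda>q. (fst (T q), fst q)) p"
    by (intro continuous_intros cdiff2_isCont T_cdiff2 assms)
  then show ?thesis
    by (rule isCont_cong[THEN iffD1, rotated])
      (use eventually_nhds_in_open[OF open_finite_dom assms] secant_map_finite_dom(2) in
        \<open>auto elim!: eventually_mono simp: prod_eq_iff\<close>)
qed

lemma T_regular:
  assumes "(x, y) \<in> secant_dom U f" "(x, y) \<in> secant_regular U f"
  shows "T (x, y) = ((f x * y - f y * x) / (f x - f y), x)"
proof -
  obtain W h where Wh: "(x, y) \<in> W" "secant_extension U f W h"
    using assms by (auto simp: secant_dom_def)
  then have "h (x, y) = of_C2 ((f x * y - f y * x) / (f x - f y), x)"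
    using secant_extensionD(5)[OF Wh(2,1) assms(2)] by simp
  then show ?thesis using secant_map_eq[OF Wh(2,1)] by (simp add: T_def)
qed

end

lemma all_nat_split_first: "(\<forall>n. Q n) \<longleftrightarrow> Q 0 \<and> (\<forall>n. Q (Suc n))"
  using not0_implies_Suc by metis

section \<open>The basin of a simple root and the cofactor\<close>

locale secant_root = secant_setting +
  fixes z0 :: complex
  assumes z0_U: "z0 \<in> U" and not_pole: "\<not> is_pole f z0" and root: "f z0 = 0"
    and simple: "deriv f z0 \<noteq> 0"
begin

text \<open>With f z = (z - z0) * g z the numerator f x * y - f y * x equals z0 * (f x - f y) + (x -
  z0) * (y - z0) * (g x - g y). Dividing by f x - f y leaves the quotient \<open>G0\<close> of the
  divided differences of g and f, which is holomorphic across the diagonal near the centre because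
  f'(z0) \<noteq> 0. Its central value is g'(z0) / f'(z0), and f''(z0) = 2 g'(z0).\<close>

lemma local_form:
  obtains N G0 where "open N" "(z0, z0) \<in> N" "N \<subseteq> finite_dom" "G0 holomorphic2_on N"
    "\<And>p. p \<in> N \<Longrightarrow> T p = (z0 + G0 p * (fst p - z0) * (snd p - z0), fst p)"
    "G0 (z0, z0) = (deriv ^^ 2) f z0 / (2 * deriv f z0)"
proof -
  obtain r1 where r1: "r1 > 0" "f holomorphic_on ball z0 r1"
    using nicely_meromorphic_on_imp_analytic_at[OF mero z0_U not_pole] unfolding analytic_on_def by blast
  obtain r2 where r2: "r2 > 0" "ball z0 r2 \<subseteq> U" using open_U z0_U open_contains_ball by blast
  define B where "B = ball z0 (min r1 r2)"
  have B: "open B" "z0 \<in> B" "B \<subseteq> U" using r1 r2 by (auto simp: B_def)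
  have fB: "f holomorphic_on B" by (rule holomorphic_on_subset[OF r1(2)]) (auto simp: B_def)
  define g where "g z = (if z = z0 then deriv f z0 else (f z - f z0) / (z - z0))" for z
  have g: "g holomorphic_on B" unfolding g_def by (rule pole_lemma_open[OF fB B(1)])
  have fg: "f z = (z - z0) * g z" for z by (simp add: g_def root)
  obtain qf where qf: "qf holomorphic2_on B \<times> B" "\<And>x y. f x - f y = (x - y) * qf (x, y)"
    "\<And>x. x \<in> B \<Longrightarrow> qf (x, x) = deriv f x"
    using divided_difference_holomorphic2[OF B(1) fB] by blast
  obtain qg where qg: "qg holomorphic2_on B \<times> B" "\<And>x y. g x - g y = (x - y) * qg (x, y)"
    "\<And>x. x \<in> B \<Longrightarrow> qg (x, x) = deriv g x"
    using divided_difference_holomorphic2[OF B(1) g] by blast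
  have BB: "open (B \<times> B)" using B(1) by (intro open_Times)
  define N where "N = B \<times> B \<inter> qf -` (- {0})"
  have N: "open N" "(z0, z0) \<in> N" "N \<subseteq> U \<times> U"
  proof -
    show "open N" unfolding N_def
      by (intro continuous_open_preimage holomorphic2_on_imp_continuous_on[OF qf(1)] BB) auto
    show "(z0, z0) \<in> N" using B(2) qf(3)[OF B(2)] simple by (simp add: N_def)
    show "N \<subseteq> U \<times> U" using B(3) by (auto simp: N_def)
  qed
  define G0 where "G0 p = qg p / qf p" for p
  have G0: "G0 holomorphic2_on N"
    using qf(1) qg(1) unfolding holomorphic2_on_cdiff2[OF N(1)] holomorphic2_on_cdiff2[OF BB] G0_def
    by (auto intro!: cdiff2_divide simp: N_def)
  define k where "k p = z0 + G0 p * (fst p - z0) * (snd p - z0)" for p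
  have k: "k holomorphic2_on N"
    using G0 unfolding holomorphic2_on_cdiff2[OF N(1)] k_def by (auto intro!: cdiff2_intros)
  define h where "h p = of_C2 (k p, fst p)" for p
  have ext: "secant_extension U f N h"
    unfolding secant_extension_def
  proof (intro conjI ballI)
    show "(fst \<circ> h) sphere_holomorphic2_on N"
      by (rule sphere_holomorphic2_Fin[OF N(1) k]) (simp add: h_def of_C2_def)
    show "(snd \<circ> h) sphere_holomorphic2_on N"
      by (rule sphere_holomorphic2_Fin[OF N(1), of fst])
        (auto simp: h_def of_C2_def holomorphic2_on_cdiff2[OF N(1)] cdiff2_fst)
    fix p assume p: "p \<in> N \<inter> secant_regular U f"
    obtain x y where xy: "p = (x, y)" by force
    have ne: "f x - f y \<noteq> 0" using p xy by (auto simp: secant_regular_def)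
    then have nz: "x - y \<noteq> 0" "qf (x, y) \<noteq> 0" using qf(2)[of x y] by auto
    have "f x * y - f y * x = z0 * (f x - f y) + (x - z0) * (y - z0) * (g x - g y)"
      unfolding fg[of x] fg[of y] by (simp add: algebra_simps)
    then have "(f x * y - f y * x) / (f x - f y) = z0 + (x - z0) * (y - z0) * (g x - g y) / (f x - f y)"
      using ne by (simp add: add_divide_distrib)
    also have "(x - z0) * (y - z0) * (g x - g y) / (f x - f y) = G0 (x, y) * (x - z0) * (y - z0)"
      unfolding qf(2)[of x y] qg(2)[of x y] G0_def using nz by (simp add: field_simps)
    finally show "case p of (x, y) \<Rightarrow> h (x, y) = of_C2 ((f x * y - f y * x) / (f x - f y), x)"
      by (simp add: xy h_def k_def)
  qed (use N in auto)
  have map: "secant_map U f p = of_C2 (k p, fst p)" if "p \<in> N" for p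
    using secant_map_eq[OF ext that] by (simp add: h_def)
  show thesis
  proof (rule that[OF N(1,2) _ G0])
    show "N \<subseteq> finite_dom"
    proof
      fix p assume p: "p \<in> N"
      then have "p \<in> secant_dom U f" using ext unfolding secant_dom_def by blast
      then show "p \<in> finite_dom" using map[OF p] by (simp add: finite_dom_def of_C2_def)
    qed
    show "T p = (z0 + G0 p * (fst p - z0) * (snd p - z0), fst p)" if "p \<in> N" for p
      using map[OF that] by (simp add: T_def k_def)
    have dg: "(g has_field_derivative deriv g z) (at z)" if "z \<in> B" for z
      using holomorphic_derivI[OF g B(1) that] .
    have df: "deriv f z = g z + (z - z0) * deriv g z" if "z \<in> B" for z
    proof -
      have "((\<lambda>z. (z - z0) * g z) has_field_derivative g z + (z - z0) * deriv g z) (at z)"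
        by (auto intro!: derivative_eq_intros dg[OF that])
      moreover have "f = (\<lambda>z. (z - z0) * g z)" using fg by blast
      ultimately show ?thesis using DERIV_imp_deriv by metis
    qed
    have "(deriv g has_field_derivative deriv (deriv g) z0) (at z0)"
      by (rule holomorphic_derivI[OF holomorphic_deriv[OF g B(1)] B(1,2)])
    then have "((\<lambda>z. g z + (z - z0) * deriv g z) has_field_derivative 2 * deriv g z0) (at z0)"
      by (auto intro!: derivative_eq_intros dg[OF B(2)])
    then have "(deriv f has_field_derivative 2 * deriv g z0) (at z0)"
      by (rule has_field_derivative_transform_within_open[OF _ B(1,2)]) (simp add: df)
    then have "(deriv ^^ 2) f z0 = 2 * deriv g z0"
      by (simp add: numeral_2_eq_2 DERIV_imp_deriv)
    then show "G0 (z0, z0) = (deriv ^^ 2) f z0 / (2 * deriv f z0)"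
      using qf(3)[OF B(2)] qg(3)[OF B(2)] by (simp add: G0_def)
  qed
qed

lemma secant_iter_eq:
  assumes "\<And>k. k < n \<Longrightarrow> (T ^^ k) p \<in> finite_dom"
  shows "secant_iter U f n p = Some (of_C2 ((T ^^ n) p))"
  using assms
proof (induction n)
  case (Suc n)
  have "(T ^^ n) p \<in> finite_dom" using Suc.prems by simp
  then show ?case
    using Suc secant_map_finite_dom(1)[of "(T ^^ n) p"] by (auto simp: finite_dom_def)
qed simp

lemma basin_orbit:
  assumes "p \<in> secant_basin U f z0"
  shows "(T ^^ n) p \<in> finite_dom \<and> (T ^^ n) p \<in> U \<times> U \<and> secant_orbit U f n p = (T ^^ n) p"
proof -
  have it: "secant_iter U f n p \<in> Some ` of_C2 ` (U \<times> U)" for n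
    using assms by (auto simp: secant_basin_def)
  \<comment> \<open>Iterate n is seen to be in \<open>finite_dom\<close> from iterate n + 1: that
    one exists and is a point of the complex plane squared, so its first coordinate is not
    \<open>Infty\<close>.\<close>
  have step: "(T ^^ n) p \<in> finite_dom" if eq: "secant_iter U f n p = Some (of_C2 ((T ^^ n) p))" for n
  proof -
    obtain q where "secant_iter U f (Suc n) p = Some (of_C2 q)" using it[of "Suc n"] by blast
    then have "of_C2 ((T ^^ n) p) \<in> of_C2 ` secant_dom U f" "secant_map U f ((T ^^ n) p) = of_C2 q"
      by (auto simp: eq split: if_splits)
    then show ?thesis unfolding finite_dom_def by (auto simp: inj_of_C2 image_iff) (simp add: of_C2_def)
  qed
  have eq: "secant_iter U f n p = Some (of_C2 ((T ^^ n) p))" for n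
  proof (induction n rule: less_induct)
    case (less n) then show ?case using step by (intro secant_iter_eq) blast
  qed
  have "(T ^^ n) p \<in> U \<times> U" using it[of n] by (auto simp: eq inj_of_C2)
  then show ?thesis using step[OF eq] eq[of n] by (simp add: secant_orbit_def)
qed

lemma basin_iff:
  "p \<in> secant_basin U f z0 \<longleftrightarrow>
     (\<forall>n. (T ^^ n) p \<in> finite_dom \<and> (T ^^ n) p \<in> U \<times> U) \<and> (\<lambda>n. (T ^^ n) p) \<longlonglongrightarrow> (z0, z0)"
proof
  assume p: "p \<in> secant_basin U f z0"
  then have "(\<lambda>n. secant_orbit U f n p) \<longlonglongrightarrow> (z0, z0)" by (simp add: secant_basin_def)
  then show "(\<forall>n. (T ^^ n) p \<in> finite_dom \<and> (T ^^ n) p \<in> U \<times> U) \<and> (\<lambda>n. (T ^^ n) p) \<longlonglongrightarrow> (z0, z0)"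
    using basin_orbit[OF p] by simp
next
  assume r: "(\<forall>n. (T ^^ n) p \<in> finite_dom \<and> (T ^^ n) p \<in> U \<times> U) \<and> (\<lambda>n. (T ^^ n) p) \<longlonglongrightarrow> (z0, z0)"
  then have eq: "secant_iter U f n p = Some (of_C2 ((T ^^ n) p))" for n by (intro secant_iter_eq) auto
  then have "secant_iter U f n p \<in> Some ` of_C2 ` (U \<times> U)" for n using r by auto
  moreover have "p \<in> U \<times> U" using r by (metis funpow_0)
  ultimately show "p \<in> secant_basin U f z0"
    using r by (auto simp: secant_basin_def secant_orbit_def eq)
qed

lemma basin_step: "p \<in> secant_basin U f z0 \<longleftrightarrow> p \<in> finite_dom \<and> p \<in> U \<times> U \<and> T p \<in> secant_basin U f z0"
proof -
  have a: "(\<forall>n. (T ^^ n) p \<in> finite_dom \<and> (T ^^ n) p \<in> U \<times> U) \<longleftrightarrow>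
      (p \<in> finite_dom \<and> p \<in> U \<times> U) \<and> (\<forall>n. (T ^^ n) (T p) \<in> finite_dom \<and> (T ^^ n) (T p) \<in> U \<times> U)"
    using all_nat_split_first[of "\<lambda>n. (T ^^ n) p \<in> finite_dom \<and> (T ^^ n) p \<in> U \<times> U"]
    by (simp only: funpow.simps id_apply comp_apply funpow_swap1)
  have l: "(\<lambda>n. (T ^^ n) p) \<longlonglongrightarrow> (z0, z0) \<longleftrightarrow> (\<lambda>n. (T ^^ n) (T p)) \<longlonglongrightarrow> (z0, z0)"
    using filterlim_sequentially_Suc[of "\<lambda>n. (T ^^ n) p" "nhds (z0, z0)"] by (simp add: funpow_swap1)
  show ?thesis unfolding basin_iff[of p] basin_iff[of "T p"] a l by (simp only: conj_assoc)
qed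

text \<open>On a small polydisc |G0| |y - z0| <= 1 / 2, so every step halves the distance of the
  first coordinate from z0; the second coordinate is the first one delayed by a step.\<close>

lemma basin_neighbourhood:
  obtains P where "open P" "(z0, z0) \<in> P" "P \<subseteq> secant_basin U f z0"
proof -
  obtain N G0 where N: "open N" "(z0, z0) \<in> N" "N \<subseteq> finite_dom" "G0 holomorphic2_on N"
    and TN: "\<And>p. p \<in> N \<Longrightarrow> T p = (z0 + G0 p * (fst p - z0) * (snd p - z0), fst p)"
    and "G0 (z0, z0) = (deriv ^^ 2) f z0 / (2 * deriv f z0)"
    by (fact local_form)
  \<comment> \<open>The summand 1 absorbs the deviation of \<open>G0\<close> from its central value
    and keeps \<open>K\<close> positive, so that 1 / (2 * K) can serve as a radius.\<close>
  define K where "K = norm (G0 (z0, z0)) + 1"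
  have "open (N \<inter> G0 -` ball (G0 (z0, z0)) 1)"
    by (intro continuous_open_preimage holomorphic2_on_imp_continuous_on N open_ball)
  moreover have "(z0, z0) \<in> N \<inter> G0 -` ball (G0 (z0, z0)) 1" using N by simp
  ultimately obtain s where s: "s > 0" "cball z0 s \<times> cball z0 s \<subseteq> N \<inter> G0 -` ball (G0 (z0, z0)) 1"
    using open_contains_polydisc by metis
  define r where "r = min s (1 / (2 * K))"
  have K: "K > 0" unfolding K_def by (simp add: add_nonneg_pos)
  then have r: "r > 0" "r \<le> s" "K * r \<le> 1 / 2"
    using s(1) by (auto simp: r_def min_def field_simps)
  define P where "P = ball z0 r \<times> ball z0 r"
  have PN: "p \<in> N" "norm (G0 p) \<le> K" if "p \<in> P" for p
  proof -
    have "p \<in> cball z0 s \<times> cball z0 s" using that r by (cases p) (auto simp: P_def)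
    then have "p \<in> N" "dist (G0 (z0, z0)) (G0 p) < 1" using s(2) by auto
    then show "p \<in> N" "norm (G0 p) \<le> K"
      using norm_triangle_ineq2[of "G0 p" "G0 (z0, z0)"] by (auto simp: K_def dist_norm norm_minus_commute)
  qed
  have contr: "norm (fst (T p) - z0) \<le> norm (fst p - z0) / 2" if p: "p \<in> P" for p
  proof -
    have "norm (snd p - z0) \<le> r" using p by (auto simp: P_def dist_norm norm_minus_commute)
    then have "norm (G0 p) * norm (snd p - z0) \<le> K * r"
      using PN(2)[OF p] K by (intro mult_mono) auto
    then have "norm (G0 p) * norm (snd p - z0) * norm (fst p - z0) \<le> 1 / 2 * norm (fst p - z0)"
      using r(3) by (intro mult_right_mono) auto
    then show ?thesis using TN[OF PN(1)[OF p]] by (simp add: norm_mult mult_ac)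
  qed
  have TP: "T p \<in> P" if p: "p \<in> P" for p
  proof -
    have "norm (fst p - z0) < r" using p by (auto simp: P_def dist_norm norm_minus_commute)
    then have "norm (fst (T p) - z0) < r" using contr[OF p] norm_ge_zero[of "fst p - z0"] by linarith
    then have "fst (T p) \<in> ball z0 r" by (simp add: dist_norm norm_minus_commute)
    moreover have "snd (T p) \<in> ball z0 r" using TN[OF PN(1)[OF p]] p by (auto simp: P_def)
    ultimately show ?thesis unfolding P_def by (cases "T p") auto
  qed
  have iP: "(T ^^ n) p \<in> P" if "p \<in> P" for n p by (induction n) (use that TP in auto)
  show thesis
  proof (rule that)
    show "open P" "(z0, z0) \<in> P" using r(1) by (auto simp: P_def intro: open_Times)
    show "P \<subseteq> secant_basin U f z0"
    proof
      fix p assume p: "p \<in> P"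
      have fd: "(T ^^ n) p \<in> finite_dom" for n using iP[OF p, of n] PN(1) N(3) by blast
      moreover have "finite_dom \<subseteq> U \<times> U" using secant_dom_subset unfolding finite_dom_def by blast
      moreover have "(\<lambda>n. (T ^^ n) p) \<longlonglongrightarrow> (z0, z0)"
      proof -
        have b: "norm (fst ((T ^^ n) p) - z0) \<le> norm (fst p - z0) * (1 / 2) ^ n" for n
        proof (induction n)
          case (Suc n)
          have "norm (fst (T ((T ^^ n) p)) - z0) \<le> norm (fst ((T ^^ n) p) - z0) / 2" by (rule contr[OF iP[OF p]])
          then show ?case using Suc by simp
        qed simp
        have "(\<lambda>n. fst ((T ^^ n) p) - z0) \<longlonglongrightarrow> 0"
        proof (rule Lim_null_comparison)
          show "\<forall>\<^sub>F n in sequentially. norm (fst ((T ^^ n) p) - z0) \<le> norm (fst p - z0) * (1 / 2) ^ n"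
            using b by simp
          show "(\<lambda>n. norm (fst p - z0) * (1 / 2) ^ n) \<longlonglongrightarrow> 0"
            by (intro tendsto_mult_right_zero LIMSEQ_realpow_zero) auto
        qed
        then have x: "(\<lambda>n. fst ((T ^^ n) p)) \<longlonglongrightarrow> z0" by (simp add: LIM_zero_iff)
        then have "(\<lambda>n. snd ((T ^^ Suc n) p)) \<longlonglongrightarrow> z0"
          using secant_map_finite_dom(2)[OF fd] by simp
        then have "(\<lambda>n. snd ((T ^^ n) p)) \<longlonglongrightarrow> z0" by (rule filterlim_sequentially_Suc[THEN iffD1])
        from tendsto_Pair[OF x this] show ?thesis by simp
      qed
      ultimately show "p \<in> secant_basin U f z0" unfolding basin_iff by blast
    qed
  qed
qed

lemma centre_in_basin: "(z0, z0) \<in> secant_basin U f z0"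
  using basin_neighbourhood by blast

text \<open>Induction on the time of entry into \<open>P\<close>: by \<open>basin_step\<close>,
  preimages under \<open>T\<close> of open subsets of the basin stay in the basin.\<close>

lemma open_basin: "open (secant_basin U f z0)"
proof -
  obtain P where P: "open P" "(z0, z0) \<in> P" "P \<subseteq> secant_basin U f z0" using basin_neighbourhood .
  have nbhd: "\<exists>N. open N \<and> p \<in> N \<and> N \<subseteq> secant_basin U f z0"
    if "p \<in> secant_basin U f z0" "(T ^^ n) p \<in> P" for n p
    using that
  proof (induction n arbitrary: p)
    case 0 then show ?case using P by auto
  next
    case (Suc n)
    note p = Suc.prems(1)[unfolded basin_step[of p]]
    have "(T ^^ n) (T p) \<in> P" using Suc.prems(2) by (simp add: funpow_swap1)
    then obtain N where N: "open N" "T p \<in> N" "N \<subseteq> secant_basin U f z0" using Suc.IH p by blast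
    have oD: "open (finite_dom \<inter> U \<times> U)" by (intro open_Int open_finite_dom open_Times open_U)
    have "continuous_on (finite_dom \<inter> U \<times> U) T"
      using isCont_T by (auto intro!: continuous_at_imp_continuous_on)
    from continuous_open_preimage[OF this oD N(1)]
    have "open ((finite_dom \<inter> U \<times> U) \<inter> T -` N)" .
    moreover have "p \<in> (finite_dom \<inter> U \<times> U) \<inter> T -` N" using p N(2) by auto
    moreover have "(finite_dom \<inter> U \<times> U) \<inter> T -` N \<subseteq> secant_basin U f z0"
    proof
      fix q assume "q \<in> (finite_dom \<inter> U \<times> U) \<inter> T -` N"
      then show "q \<in> secant_basin U f z0" using N(3) unfolding basin_step[of q] by blast
    qed
    ultimately show ?case by blast
  qed
  show ?thesis
  proof (subst open_subopen, rule ballI)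
    fix p assume p: "p \<in> secant_basin U f z0"
    then have "(\<lambda>n. (T ^^ n) p) \<longlonglongrightarrow> (z0, z0)" by (simp add: basin_iff)
    from topological_tendstoD[OF this P(1,2)] obtain n where "(T ^^ n) p \<in> P"
      unfolding eventually_sequentially by blast
    then show "\<exists>N. open N \<and> p \<in> N \<and> N \<subseteq> secant_basin U f z0" by (rule nbhd[OF p])
  qed
qed

text \<open>If one argument is z0 and f does not vanish at the other, the secant formula gives z0.
  At a pole or a further root the formula says nothing, so the value is obtained by continuity along
  the axis itself, on which regular points are dense.\<close>

lemma T_axes:
  assumes "(x, y) \<in> secant_basin U f z0" "x = z0 \<or> y = z0"
  shows "fst (T (x, y)) = z0"
  using assms(2)
proof
  assume x: "x = z0"
  show ?thesis
  proof (rule eq_by_density[where ?g1.0 = "\<lambda>w. fst (T (x, w))" and ?g2.0 = "\<lambda>_. z0"])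
    have fd: "(x, y) \<in> finite_dom" and y: "y \<in> U" using assms(1) unfolding basin_step[of "(x, y)"] by auto
    show "isCont (\<lambda>w. fst (T (x, w))) y"
      using cdiff2_slice2[OF T_cdiff2[OF fd]] by (rule field_differentiable_imp_continuous_at)
    show "\<exists>w\<in>N. fst (T (x, w)) = z0" if N: "open N" "y \<in> N" for N
    proof -
      have "open (N \<inter> {w. (x, w) \<in> secant_basin U f z0})" by (intro open_Int N open_slice2 open_basin)
      then obtain w where w: "w \<in> N" "(x, w) \<in> secant_basin U f z0" "w \<in> U" "\<not> is_pole f w" "f w \<noteq> 0"
        using exists_regular_value[OF y, of "N \<inter> {w. (x, w) \<in> secant_basin U f z0}" 0] N assms(1) by blast
      have "(x, w) \<in> secant_dom U f" using w(2) unfolding basin_step[of "(x, w)"] finite_dom_def by blast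
      moreover have "(x, w) \<in> secant_regular U f"
        using w x z0_U not_pole root by (auto simp: secant_regular_def)
      ultimately have "fst (T (x, w)) = z0" using T_regular w(5) x root by simp
      then show ?thesis using w(1) by blast
    qed
  qed simp
next
  assume y: "y = z0"
  show ?thesis
  proof (rule eq_by_density[where ?g1.0 = "\<lambda>w. fst (T (w, y))" and ?g2.0 = "\<lambda>_. z0"])
    have fd: "(x, y) \<in> finite_dom" and x: "x \<in> U" using assms(1) unfolding basin_step[of "(x, y)"] by auto
    show "isCont (\<lambda>w. fst (T (w, y))) x"
      using cdiff2_slice1[OF T_cdiff2[OF fd]] by (rule field_differentiable_imp_continuous_at)
    show "\<exists>w\<in>N. fst (T (w, y)) = z0" if N: "open N" "x \<in> N" for N
    proof -
      have "open (N \<inter> {w. (w, y) \<in> secant_basin U f z0})" by (intro open_Int N open_slice1 open_basin)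
      then obtain w where w: "w \<in> N" "(w, y) \<in> secant_basin U f z0" "w \<in> U" "\<not> is_pole f w" "f w \<noteq> 0"
        using exists_regular_value[OF x, of "N \<inter> {w. (w, y) \<in> secant_basin U f z0}" 0] N assms(1) by blast
      have "(w, y) \<in> secant_dom U f" using w(2) unfolding basin_step[of "(w, y)"] finite_dom_def by blast
      moreover have "(w, y) \<in> secant_regular U f"
        using w y z0_U not_pole root by (auto simp: secant_regular_def)
      ultimately have "fst (T (w, y)) = z0" using T_regular w(5) y root by simp
      then show ?thesis using w(1) by blast
    qed
  qed simp
qed

text \<open>\<open>T_axes\<close> makes fst (T p) - z0 vanish on both axes, so it can be divided on
  the whole basin at once. Off the axes the result agrees with the local cofactor \<open>G0\<close>,
  and continuity transfers the central value.\<close>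

lemma cofactor_exists:
  obtains G where "G holomorphic2_on secant_basin U f z0" 
    "\<And>p. p \<in> secant_basin U f z0 \<Longrightarrow> T p = (z0 + G p * (fst p - z0) * (snd p - z0), fst p)"
    "G (z0, z0) = (deriv ^^ 2) f z0 / (2 * deriv f z0)"
proof -
  define A where "A = secant_basin U f z0"
  have A: "open A" unfolding A_def by (rule open_basin)
  have fd: "p \<in> finite_dom" if "p \<in> A" for p using that basin_step[of p] unfolding A_def by blast
  define F where "F p = fst (T p) - z0" for p
  have "F holomorphic2_on A"
    unfolding holomorphic2_on_cdiff2[OF A] F_def by (intro ballI cdiff2_diff T_cdiff2 fd cdiff2_const)
  moreover have "F (z0, y) = 0" if "(z0, y) \<in> A" for y using T_axes that by (simp add: F_def A_def)
  moreover have "F (x, z0) = 0" if "(x, z0) \<in> A" for x using T_axes that by (simp add: F_def A_def)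
  ultimately obtain G where G: "G holomorphic2_on A"
    "\<And>x y. (x, y) \<in> A \<Longrightarrow> F (x, y) = G (x, y) * (x - z0) * (y - z0)"
    using holomorphic2_divide_axes[OF A, of F z0 z0] by blast
  have TG: "T p = (z0 + G p * (fst p - z0) * (snd p - z0), fst p)" if "p \<in> A" for p
    using G(2)[of "fst p" "snd p"] secant_map_finite_dom(2)[OF fd[OF that]] that
    by (auto simp: F_def prod_eq_iff algebra_simps)
  have "G (z0, z0) = (deriv ^^ 2) f z0 / (2 * deriv f z0)"
  proof -
    obtain N G0 where N: "open N" "(z0, z0) \<in> N" "N \<subseteq> finite_dom" "G0 holomorphic2_on N"
      and TN: "\<And>p. p \<in> N \<Longrightarrow> T p = (z0 + G0 p * (fst p - z0) * (snd p - z0), fst p)"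
      and val: "G0 (z0, z0) = (deriv ^^ 2) f z0 / (2 * deriv f z0)"
      by (fact local_form)
    have c: "(z0, z0) \<in> A" unfolding A_def by (rule centre_in_basin)
    have "G (z0, z0) = G0 (z0, z0)"
    proof (rule eq_by_density[where ?g1.0 = G and ?g2.0 = G0])
      show "isCont G (z0, z0)" "isCont G0 (z0, z0)"
        using G(1) N c by (auto intro!: cdiff2_isCont simp: holomorphic2_on_cdiff2[OF A] holomorphic2_on_cdiff2[OF N(1)])
      show "\<exists>q\<in>M. G q = G0 q" if M: "open M" "(z0, z0) \<in> M" for M
      proof -
        have "\<exists>q\<in>M \<inter> A \<inter> N. fst q \<noteq> z0 \<and> snd q \<noteq> z0"
          by (rule exists_off_axes) (use M N A c in \<open>auto intro: open_Int\<close>)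
        then obtain q where q: "q \<in> M" "q \<in> A" "q \<in> N" "fst q \<noteq> z0" "snd q \<noteq> z0" by blast
        then have "G q = G0 q" using TG[OF q(2)] TN[OF q(3)] by auto
        then show ?thesis using q(1) by blast
      qed
    qed
    then show ?thesis using val by simp
  qed
  then show thesis using that[of G] G(1) TG unfolding A_def by blast
qed

text \<open>The secant map determines a cofactor off the axes, and continuity determines it on them;
  the extensional restriction of \<open>G\<close> is therefore the object described.\<close>

lemma cofactor:
  assumes G: "G holomorphic2_on secant_basin U f z0"
    and TG: "\<And>p. p \<in> secant_basin U f z0 \<Longrightarrow> T p = (z0 + G p * (fst p - z0) * (snd p - z0), fst p)"
    and p: "p \<in> secant_basin U f z0"
  shows "secant_cofactor U f z0 p = G p"
proof -
  define A where "A = secant_basin U f z0"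
  have A: "open A" unfolding A_def by (rule open_basin)
  have map: "secant_map U f p = of_C2 (T p)" if "p \<in> A" for p
    using that secant_map_finite_dom(1) basin_step[of p] unfolding A_def by blast
  have "secant_cofactor U f z0 = restrict G A"
    unfolding secant_cofactor_def A_def[symmetric]
  proof (rule the_equality, intro conjI)
    show "restrict G A \<in> extensional A" by simp
    have "cdiff2 (restrict G A) p" if "p \<in> A" for p
      by (rule cdiff2_transform[OF _ A that, of G])
        (use G that holomorphic2_on_cdiff2[OF A] in \<open>auto simp: A_def\<close>)
    then show "restrict G A holomorphic2_on A" by (simp add: holomorphic2_on_cdiff2[OF A])
    show "\<forall>(x, y)\<in>A. secant_map U f (x, y) = of_C2 (z0 + restrict G A (x, y) * (x - z0) * (y - z0), x)"
      using TG map by (auto simp: A_def)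
    fix G' assume G': "G' \<in> extensional A \<and> G' holomorphic2_on A \<and>
      (\<forall>(x, y)\<in>A. secant_map U f (x, y) = of_C2 (z0 + G' (x, y) * (x - z0) * (y - z0), x))"
    have "G' p = restrict G A p" for p
    proof (cases "p \<in> A")
      case False then show ?thesis using extensional_arb[of G' A p] G' by (simp del: split_paired_All)
    next
      case True
      have "G' p = G p"
      proof (rule eq_by_density[where ?g1.0 = G' and ?g2.0 = G])
        show "isCont G' p" "isCont G p"
          using G' G True holomorphic2_on_cdiff2[OF A] by (auto intro!: cdiff2_isCont simp: A_def)
        show "\<exists>q\<in>M. G' q = G q" if M: "open M" "p \<in> M" for M
        proof -
          have "\<exists>q\<in>M \<inter> A. fst q \<noteq> z0 \<and> snd q \<noteq> z0"
            by (rule exists_off_axes) (use M A True in \<open>auto intro: open_Int\<close>)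
          then obtain x y where q: "(x, y) \<in> M" "(x, y) \<in> A" "x \<noteq> z0" "y \<noteq> z0" by auto
          have "of_C2 (T (x, y)) = of_C2 (z0 + G' (x, y) * (x - z0) * (y - z0), x)"
            using G' q(2) map[OF q(2)] by auto
          then have "G' (x, y) = G (x, y)"
            using TG[of "(x, y)"] q by (simp add: inj_of_C2 A_def)
          then show ?thesis using q(1) by blast
        qed
      qed
      then show ?thesis using True by simp
    qed
    then show "G' = restrict G A" by blast
  qed
  then show ?thesis using p by (simp add: A_def)
qed

end

section \<open>Assembly: existence and uniqueness of the asymptotic functions\<close>

theorem theorem3p1:
  fixes U :: "complex set" and f :: "complex \<Rightarrow> complex" and z0 :: complex
  assumes "open U" and "connected U"
    and "f nicely_meromorphic_on U" and "\<not> f constant_on U"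
    and "z0 \<in> U" and "\<not> is_pole f z0" and "f z0 = 0" and "deriv f z0 \<noteq> 0"
    and "(deriv ^^ 2) f z0 \<noteq> 0"
  shows
    "(\<forall>w0. exp w0 = (deriv ^^ 2) f z0 / (2 * deriv f z0) \<longrightarrow>
        (\<exists>V H. secant_local_H U f z0 w0 V H)) \<and>
     (\<forall>w0. exp w0 = (deriv ^^ 2) f z0 / (2 * deriv f z0) \<longrightarrow>
        (\<forall>V1 H1 V2 H2. secant_local_H U f z0 w0 V1 H1 \<and> secant_local_H U f z0 w0 V2 H2 \<longrightarrow>
           (\<forall>p \<in> connected_component_set (V1 \<inter> V2) (z0, z0). H1 p = H2 p))) \<and>
     (\<exists>Hh. secant_global_H U f z0 Hh \<and>
        (\<forall>Hh'. secant_global_H U f z0 Hh' \<longrightarrow> (\<forall>p \<in> secant_basin U f z0. Hh' p = Hh p)) \<and>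
        (\<forall>w0 V H. exp w0 = (deriv ^^ 2) f z0 / (2 * deriv f z0) \<and> secant_local_H U f z0 w0 V H \<longrightarrow>
           (\<forall>p\<in>V. Hh p = norm (H p))) \<and>
        (\<forall>p \<in> secant_basin U f z0.
           Hh p = Hh (to_C2 (secant_map U f p)) powr (1 / phi) *
                  norm (secant_cofactor U f z0 p) powr (1 / sqrt 5)) \<and>
        (\<forall>p \<in> secant_basin U f z0. Hh p \<noteq> 0 \<longrightarrow> real_analytic_at Hh p))"
proof -
  interpret secant_root U f z0 by unfold_locales (use assms in auto)
  define A where "A = secant_basin U f z0"
  have A: "open A" "(z0, z0) \<in> A" unfolding A_def by (rule open_basin, rule centre_in_basin)
  obtain G where G: "G holomorphic2_on A"
    and TG: "\<And>p. p \<in> A \<Longrightarrow> T p = (z0 + G p * (fst p - z0) * (snd p - z0), fst p)"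
    and G0: "G (z0, z0) = (deriv ^^ 2) f z0 / (2 * deriv f z0)"
    unfolding A_def by (fact cofactor_exists)
  have TA: "T p \<in> A" if "p \<in> A" for p using that basin_step[of p] unfolding A_def by blast
  interpret fib: fibonacci_basin A T G z0
  proof
    show "(\<lambda>n. (T ^^ n) p) \<longlonglongrightarrow> (z0, z0)" if "p \<in> A" for p using that by (simp add: A_def basin_iff)
    show "G (z0, z0) \<noteq> 0" using G0 assms(8,9) by simp
  qed (use A TG TA G in auto)
  have map_T: "secant_map U f p = of_C2 (T p)" if "p \<in> A" for p
    using that secant_map_finite_dom(1) basin_step[of p] unfolding A_def by blast
  have rate_at: "secant_rate_at U f z0 p (fib.rate p)" if p: "p \<in> A" for p
    using fib.rate_limit[OF p] basin_orbit[of p] p unfolding secant_rate_at_def A_def by simp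
  \<comment> \<open>Off the axes the monomial is positive and can be cancelled. On the axes it is 0
    and the limit does not determine c, which is why \<open>agree\<close> needs continuity of the
    candidate.\<close>
  have rate_unique: "c = fib.rate p"
    if "p \<in> A" "secant_rate_at U f z0 p c" "fst p \<noteq> z0" "snd p \<noteq> z0" for p c
    using LIMSEQ_unique[OF that(2)[unfolded secant_rate_at_def] rate_at[OF that(1), unfolded secant_rate_at_def]]
      that(3,4) by simp
  have cont_rate: "isCont fib.rate p" if "p \<in> A" for p
    using fib.rate_continuous A(1) that continuous_on_eq_continuous_at by blast
  have agree: "g p = fib.rate p"
    if V: "open V" "V \<subseteq> A" "p \<in> V" and g: "isCont g p" "\<And>q. q \<in> V \<Longrightarrow> secant_rate_at U f z0 q (g q)" for V g p
  proof (rule eq_by_density[where ?g1.0 = g and ?g2.0 = fib.rate])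
    show "isCont fib.rate p" using cont_rate V by blast
    show "\<exists>q\<in>N. g q = fib.rate q" if N: "open N" "p \<in> N" for N
    proof -
      have "\<exists>q\<in>N \<inter> V. fst q \<noteq> z0 \<and> snd q \<noteq> z0"
        by (rule exists_off_axes) (use N V in \<open>auto intro: open_Int\<close>)
      then obtain q where q: "q \<in> N" "q \<in> V" "fst q \<noteq> z0" "snd q \<noteq> z0" by blast
      have "g q = fib.rate q" by (rule rate_unique[OF _ g(2)]) (use q V in auto)
      then show ?thesis using q(1) by blast
    qed
  qed (rule g(1))
  have local_norm: "fib.rate p = norm (H p)" if H: "secant_local_H U f z0 w0 V H" and p: "p \<in> V" for w0 V H p
  proof -
    have V: "open V" "V \<subseteq> A" "H holomorphic2_on V" "\<And>q. q \<in> V \<Longrightarrow> secant_rate_at U f z0 q (norm (H q))"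
      using H unfolding secant_local_H_def A_def by auto
    have "isCont H p" using V(3) p cdiff2_isCont by (auto simp: holomorphic2_on_cdiff2[OF V(1)])
    then have "isCont (\<lambda>q. norm (H q)) p" by (intro continuous_intros)
    from agree[OF V(1,2) p this V(4)] show ?thesis by simp
  qed
  have exists_H: "\<exists>V H. secant_local_H U f z0 w0 V H"
    if w0: "exp w0 = (deriv ^^ 2) f z0 / (2 * deriv f z0)" for w0
  proof -
    have "exp w0 = G (z0, z0)" using w0 G0 by simp
    then obtain r h where r: "r > 0" "ball z0 r \<times> ball z0 r \<subseteq> A"
      and rT: "\<And>p. p \<in> ball z0 r \<times> ball z0 r \<Longrightarrow> T p \<in> ball z0 r \<times> ball z0 r"
      and h: "h holomorphic2_on ball z0 r \<times> ball z0 r"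
      and rate: "\<And>p. p \<in> ball z0 r \<times> ball z0 r \<Longrightarrow> fib.rate p = exp (Re (h p))"
      and h0: "h (z0, z0) = of_real ((5 + 3 * sqrt 5) / 10) * w0"
      by (rule fib.local_logarithm) blast
    define P where "P = ball z0 r \<times> ball z0 r"
    have P: "open P" "(z0, z0) \<in> P" unfolding P_def using r(1) by (auto intro: open_Times)
    have "secant_local_H U f z0 w0 P (\<lambda>p. exp (h p))"
      unfolding secant_local_H_def
    proof (intro conjI ballI)
      show "secant_map U f ` P \<subseteq> of_C2 ` P"
        using map_T rT r(2) unfolding P_def by (intro image_subsetI) (metis image_eqI subsetD)
      have "cdiff2 (\<lambda>p. exp (h p)) p" if "p \<in> P" for p
        using h that P(1) unfolding P_def[symmetric]
        by (intro cdiff2_compose1[where k = exp] field_differentiable_within_exp) (simp add: holomorphic2_on_cdiff2)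
      then show "(\<lambda>p. exp (h p)) holomorphic2_on P" by (simp add: holomorphic2_on_cdiff2[OF P(1)])
      show "secant_rate_at U f z0 p (norm (exp (h p)))" if "p \<in> P" for p
        using rate_at[of p] rate[of p] that r(2) unfolding P_def by (auto simp: norm_exp_eq_Re)
    qed (use P r(2) in \<open>auto simp: h0 P_def A_def\<close>)
    then show ?thesis by blast
  qed
  have unique_H: "H1 p = H2 p"
    if H1: "secant_local_H U f z0 w0 V1 H1" and H2: "secant_local_H U f z0 w0 V2 H2"
      and p: "p \<in> connected_component_set (V1 \<inter> V2) (z0, z0)" for w0 V1 H1 V2 H2 p
  proof -
    define C where "C = connected_component_set (V1 \<inter> V2) (z0, z0)"
    have V: "open V1" "open V2" "(z0, z0) \<in> V1 \<inter> V2" "H1 holomorphic2_on V1" "H2 holomorphic2_on V2"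
      and val: "H1 (z0, z0) = H2 (z0, z0)" "H2 (z0, z0) \<noteq> 0"
      using H1 H2 unfolding secant_local_H_def by auto
    have C: "open C" "connected C" "C \<subseteq> V1 \<inter> V2" "(z0, z0) \<in> C"
    proof -
      show "open C" "connected C"
        unfolding C_def using V(1,2) by (simp_all add: open_connected_component open_Int)
      show "C \<subseteq> V1 \<inter> V2" unfolding C_def by (rule connected_component_subset)
      show "(z0, z0) \<in> C" unfolding C_def using V(3) by simp
    qed
    have hol: "H1 holomorphic2_on C" "H2 holomorphic2_on C"
      using V(4,5) C(3) holomorphic2_on_subset by blast+
    \<comment> \<open>The common central value is an exponential, hence not 0, so the quotient of
      the candidates is defined on a polydisc around the centre.\<close>
    have "open (C \<inter> H2 -` (- {0}))"
      by (intro continuous_open_preimage holomorphic2_on_imp_continuous_on hol C) auto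
    moreover have "(z0, z0) \<in> C \<inter> H2 -` (- {0})" using C(4) val(2) by simp
    ultimately obtain r where r: "r > 0" "cball z0 r \<times> cball z0 r \<subseteq> C \<inter> H2 -` (- {0})"
      using open_contains_polydisc by metis
    define B where "B = ball z0 r \<times> ball z0 r"
    have B: "open B" "(z0, z0) \<in> B" "B \<subseteq> C" "\<And>q. q \<in> B \<Longrightarrow> H2 q \<noteq> 0"
    proof -
      show "open B" "(z0, z0) \<in> B" using r(1) by (auto simp: B_def intro: open_Times)
      have "B \<subseteq> C \<inter> H2 -` (- {0})"
        unfolding B_def by (rule order_trans[OF Sigma_mono[OF ball_subset_cball ball_subset_cball] r(2)])
      then show "B \<subseteq> C" "\<And>q. q \<in> B \<Longrightarrow> H2 q \<noteq> 0" by auto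
    qed
    have "H1 q = H2 q" if q: "q \<in> B" for q
    proof -
      have "(\<lambda>q. H1 q / H2 q) q = (\<lambda>q. H1 q / H2 q) (z0, z0)"
      proof (rule holomorphic2_unimodular_const)
        show "(\<lambda>q. H1 q / H2 q) holomorphic2_on ball z0 r \<times> ball z0 r"
          unfolding B_def[symmetric] holomorphic2_on_cdiff2[OF B(1)]
          using hol B(3,4) by (auto intro!: cdiff2_divide simp: holomorphic2_on_cdiff2[OF C(1)])
        show "norm (H1 q / H2 q) = 1" if "q \<in> ball z0 r \<times> ball z0 r" for q
        proof -
          have "q \<in> B" using that by (simp add: B_def)
          then have "q \<in> V1" "q \<in> V2" "H2 q \<noteq> 0" using B(3,4) C(3) by blast+
          then have "norm (H1 q) = norm (H2 q)" "H2 q \<noteq> 0"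
            using local_norm[OF H1, of q] local_norm[OF H2, of q] by simp_all
          then show ?thesis by (simp add: norm_divide)
        qed
      qed (use q in \<open>simp add: B_def\<close>)
      then show ?thesis using val B(4)[OF q] by simp
    qed
    from holomorphic2_identity[OF C(1,2) hol B(1,2,3) this] show ?thesis
      using p by (simp add: C_def)
  qed
  have glob: "secant_global_H U f z0 fib.rate"
    unfolding secant_global_H_def A_def[symmetric] using rate_at fib.rate_continuous by blast
  have uniq: "Hh' p = fib.rate p" if "secant_global_H U f z0 Hh'" "p \<in> A" for Hh' p
  proof (rule agree[OF A(1) order_refl that(2)])
    show "isCont Hh' p"
      using that A(1) unfolding secant_global_H_def A_def[symmetric]
      by (simp add: continuous_on_eq_continuous_at)
    show "secant_rate_at U f z0 q (Hh' q)" if "q \<in> A" for q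
      using \<open>secant_global_H U f z0 Hh'\<close> that unfolding secant_global_H_def A_def[symmetric] by blast
  qed
  have func: "fib.rate p = fib.rate (to_C2 (secant_map U f p)) powr (1 / phi) *
      norm (secant_cofactor U f z0 p) powr (1 / sqrt 5)" if p: "p \<in> A" for p
    using fib.rate_functional_equation[OF p] cofactor[of G p] G TG p unfolding A_def T_def by simp
  have ana: "real_analytic_at fib.rate p" if p: "p \<in> A" "fib.rate p \<noteq> 0" for p
  proof -
    obtain N h where N: "open N" "p \<in> N" "h holomorphic2_on N" "\<forall>q\<in>N. fib.rate q = exp (Re (h q))"
      using fib.rate_local_logarithm[OF p] by blast
    show ?thesis
    proof (rule real_analytic_at_norm_square[OF _ N(1,2)])
      \<comment> \<open>Half of \<open>h\<close> is taken so that the rate becomes the square of a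
        norm; unlike the norm, the square is a product of power series.\<close>
      have "cdiff2 (\<lambda>q. exp (h q / 2)) q" if "q \<in> N" for q
        using N(3) that unfolding holomorphic2_on_cdiff2[OF N(1)]
        by (intro cdiff2_compose1[where k = exp] field_differentiable_within_exp cdiff2_divide cdiff2_const) auto
      then show "(\<lambda>q. exp (h q / 2)) holomorphic2_on N" by (simp add: holomorphic2_on_cdiff2[OF N(1)])
      show "fib.rate q = (norm (exp (h q / 2)))\<^sup>2" if "q \<in> N" for q
        using N(4) that by (simp add: norm_exp_eq_Re flip: exp_double)
    qed
  qed
  show ?thesis
  proof (intro conjI allI impI exI[of _ fib.rate] ballI)
    show "\<exists>V H. secant_local_H U f z0 w0 V H" if "exp w0 = (deriv ^^ 2) f z0 / (2 * deriv f z0)" for w0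
      by (rule exists_H[OF that])
    show "H1 p = H2 p"
      if "secant_local_H U f z0 w0 V1 H1 \<and> secant_local_H U f z0 w0 V2 H2"
        "p \<in> connected_component_set (V1 \<inter> V2) (z0, z0)" for w0 V1 H1 V2 H2 p
      by (rule unique_H[OF conjunct1[OF that(1)] conjunct2[OF that(1)] that(2)])
    show "secant_global_H U f z0 fib.rate" by (rule glob)
    show "Hh' p = fib.rate p" if "secant_global_H U f z0 Hh'" "p \<in> secant_basin U f z0" for Hh' p
      by (rule uniq[OF that(1)]) (simp add: A_def that(2))
    show "fib.rate p = norm (H p)"
      if "exp w0 = (deriv ^^ 2) f z0 / (2 * deriv f z0) \<and> secant_local_H U f z0 w0 V H" "p \<in> V" for w0 V H p
      by (rule local_norm[OF conjunct2[OF that(1)] that(2)])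
    show "fib.rate p = fib.rate (to_C2 (secant_map U f p)) powr (1 / phi) *
        norm (secant_cofactor U f z0 p) powr (1 / sqrt 5)" if "p \<in> secant_basin U f z0" for p
      by (rule func) (simp add: A_def that)
    show "real_analytic_at fib.rate p" if "p \<in> secant_basin U f z0" "fib.rate p \<noteq> 0" for p
      by (rule ana[OF _ that(2)]) (simp add: A_def that(1))
  qed
qed

end
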